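(* Let $\nu=h\Lambda$ be an absolutely continuous Borel probability measure on $(0,1]^d$ with density $h$, and let $s_h=\sup\{s>0:\|h\|_s<\infty\}$ (with $d/s_h=0$ if $s_h=\infty$). For every $r\in\mathbb{R}$ with $r\neq d/s_h-d$, and also for $r=d/s_h-d$ provided $\|h\|_{s_h}=\infty$, the $d$-dimensional quantization coefficient $\mathfrak{C}_{r,d}(\nu)=\lim_{n\to\infty}n^{1/d}\mathfrak{e}_{n,r}(\nu)$ of order $r$ of $\nu$ exists and its finite value equals $$\mathfrak{C}_{r,d}(\nu)=\mathfrak{C}_{r,d}(\Lambda)\,\Phi_r(h).$$ Moreover, $\mathfrak{C}_{r,d}(\nu)>0$ for $r>d/s_h-d$, and $\mathfrak{C}_{r,d}(\nu)=0$ for $r<d/s_h-d$ or, if $\|h\|_{s_h}=\infty$, also for $r=d/s_h-d$.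
   Context: $\mathbb{R}^d$ is equipped with a fixed norm $\|\cdot\|$. $\Lambda$ denotes the Lebesgue measure restricted to the unit cube $(0,1]^d$; for a measurable function $h$ and $s>0$, $\|h\|_s=\big(\int |h|^s\,d\Lambda\big)^{1/s}$, and $\|h\|_\infty$ is the $\Lambda$-essential supremum. For $A\subset\mathbb{R}^d$ finite and non-empty, $d(x,A)=\min_{y\in A}\|x-y\|$; $\mathcal{A}_n=\{A\subset\mathbb{R}^d:1\le\operatorname{card}(A)\le n\}$. The $n$-th quantization error of order $r\in\mathbb{R}$ of a compactly supported probability measure $\nu$ is $$\mathfrak{e}_{n,r}(\nu)=\inf_{A\in\mathcal{A}_n}\Big(\int d(x,A)^r\,d\nu(x)\Big)^{1/r}\ (r\neq0),\qquad \mathfrak{e}_{n,0}(\nu)=\inf_{A\in\mathcal{A}_n}\exp\int\log d(x,A)\,d\nu(x),$$ with $0^r=+\infty$ and $(+\infty)^{1/r}=0$ for $r<0$. For $\kappa>0$, the $\kappa$-dimensional quantization coefficient of order $r$ of $\nu$ is $\mathfrak{C}_{r,\kappa}(\nu)=\lim_{n\to\infty}n^{1/\kappa}\mathfrak{e}_{n,r}(\nu)$, whenever this limit exists in $[0,+\infty]$. (For the uniform distribution $\Lambda$, the coefficient $\mathfrak{C}_{r,d}(\Lambda)$ exists and is finite for all $r\in\mathbb{R}$, and is positive exactly for $r>-d$.) For a measurable $h\ge0$ put $$\Phi_r(h)=\begin{cases}\|h\|_{d/(d+r)}^{1/r}, & r\in(-d,\infty)\setminus\{0\},\\ \exp\big(-\tfrac1d\int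 h\log h\,d\Lambda\big), & r=0,\\ 0, & r\le -d,\end{cases}$$ where $\|h\|_{d/(d+r)}^{1/r}:=0$ whenever $r<0$ and $h^{d/(d+r)}$ is not integrable. *)

theory Defs
  imports "HOL-Probability.Probability"
begin

section \<open>Extended real calculus\<close>

text \<open>Real powers on the extended half-line \<open>[0,\<infinity>]\<close>, with \<open>0\<^sup>r = \<infinity>\<close> and \<open>\<infinity>\<^sup>r = 0\<close> for \<open>r < 0\<close>.
  The case distinction is needed since the library has \<open>0 powr r = 0\<close> for every real \<open>r\<close>.\<close>

definition epowr :: "ennreal \<Rightarrow> real \<Rightarrow> ennreal" (infixr "epowr" 80) where
  "x epowr r =
    (if r = 0 then 1
     else if x = 0 then (if r < 0 then \<infinity> else 0)
     else if x = \<infinity> then (if r < 0 then 0 else \<infinity>)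
     else ennreal (enn2real x powr r))"

definition eexp :: "ereal \<Rightarrow> ennreal" where
  "eexp x = (if x = \<infinity> then \<infinity> else if x = -\<infinity> then 0 else ennreal (exp (real_of_ereal x)))"

text \<open>The logarithm of a nonnegative real number, with \<open>log 0 = -\<infinity>\<close>.\<close>

definition eln :: "real \<Rightarrow> ereal" where
  "eln x = (if x = 0 then -\<infinity> else ereal (ln x))"

text \<open>The extended integral as the integral of the positive part minus that of the negative part;
  \<^const>\<open>e2ennreal\<close> maps negative values to \<open>0\<close>. It is used only where at most one of the two is
  infinite.\<close>

definition ext_integral :: "'a measure \<Rightarrow> ('a \<Rightarrow> ereal) \<Rightarrow> ereal" where
  "ext_integral M f =
    enn2ereal (\<integral>\<^sup>+x. e2ennreal (f x) \<partial>M) - enn2ereal (\<integral>\<^sup>+x. e2ennreal (- f x) \<partial>M)"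


section \<open>Norms and the unit cube\<close>

definition is_norm :: "('a::real_vector \<Rightarrow> real) \<Rightarrow> bool" where
  "is_norm N \<longleftrightarrow>
    (\<forall>x. 0 \<le> N x) \<and> (\<forall>x. N x = 0 \<longleftrightarrow> x = 0) \<and>
    (\<forall>c x. N (c *\<^sub>R x) = \<bar>c\<bar> * N x) \<and> (\<forall>x y. N (x + y) \<le> N x + N y)"

definition unit_cube :: "(real ^ 'd) set" where
  "unit_cube = {x. \<forall>i. 0 < x $ i \<and> x $ i \<le> 1}"

definition unit_lebesgue :: "(real ^ 'd) measure" where
  "unit_lebesgue = restrict_space lborel unit_cube"

definition Lnorm :: "ereal \<Rightarrow> (real ^ 'd \<Rightarrow> real) \<Rightarrow> ennreal" where
  "Lnorm s h =
    (if s = \<infinity> then esssup unit_lebesgue (\<lambda>x. ennreal \<bar>h x\<bar>)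
     else (\<integral>\<^sup>+x. ennreal (\<bar>h x\<bar> powr real_of_ereal s) \<partial>unit_lebesgue) epowr (1 / real_of_ereal s))"


section \<open>Quantization errors and coefficients\<close>

text \<open>The measure may live on any Borel subset of the ambient space, whereas the codebooks \<open>A\<close> are
  arbitrary subsets of the whole space. The argument \<open>N\<close> is the norm.\<close>

definition dist_set :: "('a::real_vector \<Rightarrow> real) \<Rightarrow> 'a \<Rightarrow> 'a set \<Rightarrow> real" where
  "dist_set N x A = Min ((\<lambda>y. N (x - y)) ` A)"

definition codebooks :: "nat \<Rightarrow> 'a set set" where
  "codebooks n = {A. finite A \<and> 1 \<le> card A \<and> card A \<le> n}"

definition quant_error ::
    "('a::real_vector \<Rightarrow> real) \<Rightarrow> nat \<Rightarrow> real \<Rightarrow> 'a measure \<Rightarrow> ennreal" where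
  "quant_error N n r \<nu> =
    (if r = 0
     then (INF A \<in> codebooks n. eexp (ext_integral \<nu> (\<lambda>x. eln (dist_set N x A))))
     else (INF A \<in> codebooks n. (\<integral>\<^sup>+x. ennreal (dist_set N x A) epowr r \<partial>\<nu>) epowr (1 / r)))"

definition quant_seq ::
    "('a::real_vector \<Rightarrow> real) \<Rightarrow> real \<Rightarrow> real \<Rightarrow> 'a measure \<Rightarrow> nat \<Rightarrow> ennreal" where
  "quant_seq N r \<kappa> \<nu> n = ennreal (real n powr (1 / \<kappa>)) * quant_error N n r \<nu>"

text \<open>The coefficient is meaningful only if it exists, as a limit in \<open>[0,\<infinity>]\<close>.\<close>

definition quant_coeff_exists ::
    "('a::real_vector \<Rightarrow> real) \<Rightarrow> real \<Rightarrow> real \<Rightarrow> 'a measure \<Rightarrow> bool" where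
  "quant_coeff_exists N r \<kappa> \<nu> \<longleftrightarrow> convergent (quant_seq N r \<kappa> \<nu>)"

definition quant_coeff ::
    "('a::real_vector \<Rightarrow> real) \<Rightarrow> real \<Rightarrow> real \<Rightarrow> 'a measure \<Rightarrow> ennreal" where
  "quant_coeff N r \<kappa> \<nu> = lim (quant_seq N r \<kappa> \<nu>)"


section \<open>The functional of the density and the critical exponent\<close>

text \<open>If \<open>-d < r < 0\<close> and \<open>h\<close> to the power \<open>d/(d+r)\<close> is not integrable, the middle case is
  \<open>\<infinity> epowr (1/r) = 0\<close>. The Isabelle convention \<open>ln 0 = 0\<close> does not matter in \<open>h x * ln (h x)\<close>.\<close>

definition Phi :: "real \<Rightarrow> (real ^ 'd \<Rightarrow> real) \<Rightarrow> ennreal" where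
  "Phi r h = (let d = real CARD('d) in
     if r \<le> - d then 0
     else if r = 0
       then eexp (ereal (- 1 / d) * ext_integral unit_lebesgue (\<lambda>x. ereal (h x * ln (h x))))
     else Lnorm (ereal (d / (d + r))) h epowr (1 / r))"

definition integrability_sup :: "(real ^ 'd \<Rightarrow> real) \<Rightarrow> ereal" where
  "integrability_sup h = Sup {ereal s |s. 0 < s \<and> Lnorm (ereal s) h < \<infinity>}"

text \<open>The critical order \<open>d/s - d\<close>; division in \<^typ>\<open>ereal\<close> gives \<open>d/\<infinity> = 0\<close>.\<close>

definition critical_order :: "(real ^ 'd \<Rightarrow> real) \<Rightarrow> ereal" where
  "critical_order h = ereal (real CARD('d)) / integrability_sup h - ereal (real CARD('d))"

end

theory Submission
  imports Defs
begin

text \<open>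
  All orders are treated at once through the increasing cost \<open>\<phi>(t) = (t\<^sup>r - 1)/r\<close> (\<open>ln t\<close> for
  \<open>r = 0\<close>), whose derivative is \<open>t\<^bsup>r-1\<^esup>\<close> for every \<open>r\<close>: the error of a codebook is \<open>\<phi>\<^sup>-\<^sup>1\<close> of its expected
  cost. For \<open>r > -d\<close>, subdividing the cube shows that the coefficient \<open>C\<close> of the uniform distribution
  is an infimum over all codebooks, which yields lower bounds valid for every codebook. If \<open>\<rho>\<close> denotes
  the local density of code points, the limiting cost of a density \<open>h\<close> is \<open>\<integral> \<phi>(C \<rho>\<^bsup>-1/d\<^esup>) h\<close>. This is convex
  in \<open>\<rho>\<close>, and for step functions \<open>h\<close> its tangent at the optimal \<open>\<rho> \<sim> h\<^bsup>d/(d+r)\<^esup>\<close> gives the lower bound.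
  Above the critical order \<open>h\<close> has a moment of order \<open>q > d/(d+r)\<close> (for \<open>r \<le> 0\<close>), and the cost is
  continuous in \<open>h\<close> in the corresponding \<open>L\<^sup>q\<close> sense, uniformly in the codebook, because negative powers
  of the distance are integrable up to the exponent \<open>-d\<close>. Below it, truncation of \<open>h\<close> gives the
  coefficient \<open>0\<close>; and for \<open>r \<le> -d\<close> averaging over the position of a single point already gives error \<open>0\<close>.
\<close>

section \<open>The cost function\<close>

text \<open>For r \<le> 0 the cost is unbounded below near distance 0, so it cannot be estimated by
  discarding regions or code points. The substitute is a moment of order p in (-d, 0) of the
  rescaled distance, bounded over all codebooks with at most a fixed multiple of n points. A second
  obstacle concerns lower bounds on a cell: the nearest code point may belong to a neighbouring
  cell. Adding a fixed finite dense set to every codebook forces the points of a slightly smaller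
  concentric cube to see only code points of their own cell, at the price of a vanishing share of
  the n points; the thin remaining layer is controlled by the moment. Limits are established for
  every budget of \<theta> n points, not only for n, because replacing one density by another spends
  \<delta> n further points; continuity in \<theta> then removes \<delta>.\<close>

definition phi :: "real \<Rightarrow> real \<Rightarrow> real" where
  "phi r t = (if r = 0 then ln t else (t powr r - 1) / r)"

lemma phi_deriv:
  assumes "0 < t"
  shows "(phi r has_real_derivative t powr (r - 1)) (at t)"
proof (cases "r = 0")
  case True
  then have "phi r = ln" by (auto simp: phi_def)
  then show ?thesis using True assms
    by (auto intro!: derivative_eq_intros simp: powr_minus divide_simps)
next
  case False
  then have "phi r = (\<lambda>t. (t powr r - 1) / r)" by (auto simp: phi_def)
  then show ?thesis using False assms
    by (auto intro!: derivative_eq_intros simp: powr_diff)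
qed

lemma phi_isCont: "0 < t \<Longrightarrow> isCont (phi r) t"
  using DERIV_isCont phi_deriv by blast

lemma phi_measurable [measurable]: "phi r \<in> borel_measurable borel"
  unfolding phi_def by measurable

lemma phi_strict_mono:
  assumes "0 < s" "s < t" shows "phi r s < phi r t"
proof (rule DERIV_pos_imp_increasing[OF assms(2)])
  fix x assume "s \<le> x" "x \<le> t"
  then show "\<exists>y. DERIV (phi r) x :> y \<and> 0 < y"
    using assms by (intro exI[of _ "x powr (r - 1)"] conjI phi_deriv) auto
qed

lemma phi_mono: "0 < s \<Longrightarrow> s \<le> t \<Longrightarrow> phi r s \<le> phi r t"
  using phi_strict_mono[of s t r] by (cases "s = t") auto

lemma phi_le_iff: "0 < s \<Longrightarrow> 0 < t \<Longrightarrow> phi r s \<le> phi r t \<longleftrightarrow> s \<le> t"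
  using phi_strict_mono[of t s r] phi_mono[of s t r] by linarith

lemma phi_one [simp]: "phi r 1 = 0"
  by (simp add: phi_def)

text \<open>Rescaling acts on costs by an affine map, also for r = 0, where the logarithm turns the
  factor into an additive constant. This makes self-similarity arguments work alike for all
  orders.\<close>

lemma phi_scale:
  assumes "0 < c" "0 < t"
  shows "phi r (c * t) = c powr r * phi r t + phi r c"
  using assms by (auto simp: phi_def ln_mult powr_mult field_simps)

text \<open>As a function of u = t^p the cost has derivative t^(r-p)/p, which increases with u
  because p < 0 < r - p; so it is convex in u and lies above its tangent at c^p. With p > -d this
  plays the role of Jensen's inequality for the uniform distribution; with p = -d the variable u is,
  up to a factor, a local density of code points.\<close>

lemma phi_tangent:
  assumes "p < 0" "p < r" "0 < c" "0 < t"
  shows "phi r c + c powr (r - p) / p * (t powr p - c powr p) \<le> phi r t"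
proof -
  define F where "F t = phi r t - c powr (r - p) / p * (t powr p - c powr p)" for t
  have D: "(F has_real_derivative x powr (p - 1) * (x powr (r - p) - c powr (r - p))) (at x)"
    if "0 < x" for x
  proof -
    have "x powr (r - 1) = x powr (p - 1) * x powr (r - p)"
      by (simp flip: powr_add)
    then show ?thesis unfolding F_def using that assms
      by (auto intro!: derivative_eq_intros phi_deriv simp: field_simps powr_diff)
  qed
  have "F c \<le> F t"
  proof (cases "c \<le> t")
    case True
    then show ?thesis
    proof (rule DERIV_nonneg_imp_nondecreasing)
      fix x assume "c \<le> x" "x \<le> t"
      then show "\<exists>y. DERIV F x :> y \<and> 0 \<le> y"
        using assms by (intro exI[of _ "x powr (p - 1) * (x powr (r - p) - c powr (r - p))"] conjI D)
            (auto intro!: mult_nonneg_nonneg powr_mono2)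
    qed
  next
    case False
    then have "t \<le> c" by simp
    then show ?thesis
    proof (rule DERIV_nonpos_imp_nonincreasing)
      fix x assume "t \<le> x" "x \<le> c"
      then show "\<exists>y. DERIV F x :> y \<and> y \<le> 0"
        using assms by (intro exI[of _ "x powr (p - 1) * (x powr (r - p) - c powr (r - p))"] conjI D)
            (auto intro!: mult_nonneg_nonpos powr_mono2)
    qed
  qed
  then show ?thesis by (simp add: F_def)
qed

section \<open>Growth of the cost against negative powers of the distance\<close>

definition admissible :: "real \<Rightarrow> real \<Rightarrow> real \<Rightarrow> bool" where
  "admissible d r q \<longleftrightarrow> 1 \<le> q \<and> (r \<le> 0 \<longrightarrow> d / (d + r) < q)"

text \<open>A form of Young's inequality for the conjugate exponents q/(q-1) and q, with an
  arbitrarily small constant at the power of t. With p = p1 q/(q-1), the first term alone suffices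
  if y \<le> \<eta> t^(p-p1), and otherwise the second one does.\<close>

lemma powr_mult_split:
  fixes p1 q \<eta> :: real
  assumes "q > 1" "p1 < 0" "0 < \<eta>"
  shows "\<exists>K\<ge>0. \<forall>t>0. \<forall>y\<ge>0. t powr p1 * y \<le> \<eta> * t powr (p1 * q / (q - 1)) + K * y powr q"
proof -
  define p where "p = p1 * q / (q - 1)"
  have "p = (p1 * (q - 1) + p1) / (q - 1)" by (simp add: p_def algebra_simps)
  also have "\<dots> = p1 + p1 / (q - 1)" by (subst add_divide_distrib) (use assms in simp)
  finally have pp: "p - p1 = p1 / (q - 1)" by simp
  then have pp0: "p - p1 < 0" using assms by (simp add: divide_neg_pos)
  define K where "K = \<eta> powr (- (q - 1))"
  have "t powr p1 * y \<le> \<eta> * t powr p + K * y powr q" if t: "t > 0" and y: "y \<ge> 0" for t y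
  proof (cases "y \<le> \<eta> * t powr (p - p1)")
    case True
    then have "t powr p1 * y \<le> t powr p1 * (\<eta> * t powr (p - p1))"
      by (intro mult_left_mono) auto
    also have "\<dots> = \<eta> * t powr p" using t by (simp flip: powr_add)
    also have "\<dots> \<le> \<dots> + K * y powr q" by (simp add: K_def)
    finally show ?thesis .
  next
    case False
    then have y0: "y > 0" using assms t by (smt (verit) mult_nonneg_nonneg powr_ge_zero)
    have "t powr p1 = (t powr (p - p1)) powr (q - 1)"
      using assms by (simp add: powr_powr pp)
    also have "\<dots> \<le> (y / \<eta>) powr (q - 1)"
      using False assms by (intro powr_mono2) (auto simp: field_simps)
    also have "\<dots> = K * y powr (q - 1)"
      using y0 assms by (simp add: K_def powr_divide powr_diff)
    finally have "t powr p1 * y \<le> K * y powr (q - 1) * y"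
      using y by (intro mult_right_mono) auto
    also have "\<dots> = K * y powr q" using y0 by (simp add: powr_diff)
    also have "\<dots> \<le> \<eta> * t powr p + \<dots>" using assms by simp
    finally show ?thesis .
  qed
  then show ?thesis unfolding p_def by (intro exI[of _ K]) (auto simp: K_def)
qed

text \<open>For \<open>r \<le> 0\<close> the strict inequality in \<^const>\<open>admissible\<close> is what allows an exponent \<open>p > -d\<close>
  here, so that \<open>t\<^sup>p\<close> is integrable when \<open>t\<close> is a distance in dimension \<open>d\<close>.\<close>

lemma phi_mult_bound:
  assumes "0 < d" "- d < r" "admissible d r q"
  shows "\<exists>p. - d < p \<and> p < 0 \<and> p \<le> r \<and>
    (\<forall>T>0. \<forall>\<eta>>0. \<exists>K\<ge>0. \<forall>t>0. t \<le> T \<longrightarrow>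
      (\<forall>y\<ge>0. \<bar>phi r t\<bar> * y \<le> \<eta> * t powr p + K * (y + y powr q)))"
proof (cases "r > 0")
  case True
  show ?thesis
  \<comment> \<open>For r > 0 the cost is bounded on (0, T], so any exponent in (-d, 0)
    serves.\<close>
  proof (rule exI[of _ "-d/2"], intro conjI allI impI)
    fix T \<eta> :: real assume "0 < T" "0 < \<eta>"
    define K where "K = 1 / r + \<bar>phi r T\<bar>"
    have "\<bar>phi r t\<bar> * y \<le> \<eta> * t powr (-d/2) + K * (y + y powr q)" if "0 < t" "t \<le> T" "0 \<le> y" for t y
    proof -
      have "\<bar>phi r t\<bar> \<le> K"
      proof -
        have "- 1 / r \<le> phi r t" using True by (simp add: phi_def field_simps)
        moreover have "phi r t \<le> phi r T" using that by (intro phi_mono)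
        moreover have "0 < 1 / r" using True by simp
        ultimately show ?thesis unfolding K_def by linarith
      qed
      then have "\<bar>phi r t\<bar> * y \<le> K * y" using that by (intro mult_right_mono)
      also have "K * y \<le> K * (y + y powr q)" using True by (intro mult_left_mono) (auto simp: K_def)
      finally show ?thesis using \<open>0 < \<eta>\<close> by (smt (verit) mult_nonneg_nonneg powr_ge_zero)
    qed
    then show "\<exists>K\<ge>0. \<forall>t>0. t \<le> T \<longrightarrow> (\<forall>y\<ge>0. \<bar>phi r t\<bar> * y \<le> \<eta> * t powr (-d/2) + K * (y + y powr q))"
      using True by (intro exI[of _ K]) (auto simp: K_def)
  qed (use assms True in auto)
next
  case False
  then have q: "d / (d + r) < q" using assms by (simp add: admissible_def)
  have "1 \<le> d / (d + r)" using False assms by (simp add: field_simps)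
  then have q1: "q > 1" using q by simp
  have qr: "- d * (q - 1) < r * q" using q assms by (simp add: field_simps)
  \<comment> \<open>For r = 0 the logarithm is dominated by a small negative power, and this choice
    gives p = -d/2 below. For r < 0 the power is dictated by r, and q > d/(d+r) keeps p = r q/(q-1)
    above -d.\<close>
  define p1 where "p1 = (if r = 0 then - d * (q - 1) / (2 * q) else r)"
  have p1: "p1 < 0" "p1 \<le> r" "- d * (q - 1) < p1 * q"
    using False assms q1 qr by (auto simp: p1_def field_simps)
  define p where "p = p1 * q / (q - 1)"
  have p: "- d < p" "p < 0" "p \<le> p1"
    using p1 q1 mult_neg_pos[of p1 q] by (auto simp: p_def field_simps)
  show ?thesis
  proof (rule exI[of _ p], intro conjI allI impI)
    fix T \<eta> :: real assume T: "0 < T" and \<eta>: "0 < \<eta>"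
    have "\<exists>K1>0. \<forall>t>0. t \<le> T \<longrightarrow> \<bar>phi r t\<bar> \<le> K1 * (t powr p1 + 1)"
    proof (cases "r = 0")
      case True
      have "\<bar>phi r t\<bar> \<le> (1 / (-p1) + \<bar>ln T\<bar>) * (t powr p1 + 1)" if "0 < t" "t \<le> T" for t
      proof -
        have pos: "0 \<le> t powr p1 / (-p1)" using p1 by (simp add: divide_nonneg_neg)
        have "ln t \<le> \<bar>ln T\<bar>" using that by (smt (verit) ln_le_cancel_iff)
        moreover have "- ln t \<le> t powr p1 / (-p1)"
        proof (cases "t \<le> 1")
          case True
          have "ln (1 / t) \<le> (1 / t) powr (-p1) / (-p1)"
            using that p1 True by (intro ln_powr_bound) (auto simp: field_simps)
          then show ?thesis using that by (simp add: ln_div powr_divide powr_minus_divide)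
        next
          case False
          then have "- ln t \<le> 0" by simp
          then show ?thesis using pos by linarith
        qed
        ultimately have "\<bar>ln t\<bar> \<le> t powr p1 / (-p1) + \<bar>ln T\<bar>" using pos by linarith
        also have "\<dots> \<le> (1 / (-p1) + \<bar>ln T\<bar>) * (t powr p1 + 1)"
        proof -
          have "0 \<le> 1 / (-p1) + \<bar>ln T\<bar> * t powr p1"
            using p1 by (intro add_nonneg_nonneg mult_nonneg_nonneg) auto
          then show ?thesis by (simp add: algebra_simps)
        qed
        finally show ?thesis using True by (simp add: phi_def)
      qed
      moreover have "1 / (-p1) + \<bar>ln T\<bar> > 0" using p1 by (intro add_pos_nonneg) auto
      ultimately show ?thesis by blast
    next
      case r: False
      have "\<bar>phi r t\<bar> \<le> 1 / (-r) * (t powr p1 + 1)" if "0 < t" for t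
      proof -
        have "\<bar>phi r t\<bar> = \<bar>t powr r - 1\<bar> / (- r)" using r False by (simp add: phi_def)
        also have "\<dots> \<le> (t powr r + 1) / (- r)"
          using r False by (intro divide_right_mono) (auto simp: abs_le_iff)
        finally show ?thesis using r by (simp add: p1_def)
      qed
      then show ?thesis using r False by (intro exI[of _ "1/(-r)"]) auto
    qed
    then obtain K1 where K1: "K1 > 0" "\<And>t. 0 < t \<Longrightarrow> t \<le> T \<Longrightarrow> \<bar>phi r t\<bar> \<le> K1 * (t powr p1 + 1)"
      by blast
    obtain K2 where K2: "K2 \<ge> 0"
      "\<And>t y. 0 < t \<Longrightarrow> 0 \<le> y \<Longrightarrow> t powr p1 * y \<le> \<eta> / K1 * t powr p + K2 * y powr q"
      using powr_mult_split[OF q1 p1(1), of "\<eta> / K1"] \<eta> K1(1) unfolding p_def by fastforce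
    define K where "K = K1 * (K2 + 1)"
    have "\<bar>phi r t\<bar> * y \<le> \<eta> * t powr p + K * (y + y powr q)" if "0 < t" "t \<le> T" "0 \<le> y" for t y
    proof -
      have "\<bar>phi r t\<bar> * y \<le> K1 * (t powr p1 + 1) * y" using K1 that by (intro mult_right_mono) auto
      also have "\<dots> = K1 * (t powr p1 * y + y)" by (simp add: algebra_simps)
      also have "\<dots> \<le> K1 * (\<eta> / K1 * t powr p + K2 * y powr q + y)"
        using K1 K2 that by (intro mult_left_mono add_right_mono) auto
      also have "\<dots> = \<eta> * t powr p + K1 * K2 * y powr q + K1 * y"
        using K1 by (simp add: algebra_simps)
      also have "\<dots> \<le> \<eta> * t powr p + K * (y + y powr q)"
      proof -
        have "0 \<le> K1 * K2 * y" "0 \<le> K1 * y powr q" using K1 K2 that by auto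
        then show ?thesis by (simp add: K_def algebra_simps)
      qed
      finally show ?thesis .
    qed
    then show "\<exists>K\<ge>0. \<forall>t>0. t \<le> T \<longrightarrow> (\<forall>y\<ge>0. \<bar>phi r t\<bar> * y \<le> \<eta> * t powr p + K * (y + y powr q))"
      using K1 K2 by (intro exI[of _ K]) (auto simp: K_def)
  qed (use p p1 in auto)
qed

text \<open>For distances above 1 the cost is nonnegative, so the two-sided bound on (0, 1] yields a
  one-sided bound at all distances. It serves where the rescaled distance has no upper bound
  independent of n.\<close>

lemma neg_phi_mult_bound:
  assumes "\<forall>t>0. t \<le> 1 \<longrightarrow> (\<forall>y\<ge>0. \<bar>phi r t\<bar> * y \<le> \<eta> * t powr p + K * (y + y powr q))"
    and "0 \<le> K" "0 \<le> \<eta>" "0 < t" "0 \<le> y"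
  shows "- (phi r t * y) \<le> \<eta> * t powr p + K * (y + y powr q)"
proof (cases "t \<le> 1")
  case True
  then have "\<bar>phi r t\<bar> * y \<le> \<eta> * t powr p + K * (y + y powr q)" using assms by blast
  moreover have "- (phi r t * y) \<le> \<bar>phi r t\<bar> * y"
    using assms(5) by (metis abs_ge_minus_self abs_mult abs_of_nonneg)
  ultimately show ?thesis by simp
next
  case False
  then have "0 \<le> phi r t" using phi_mono[of 1 t r] by simp
  then have "0 \<le> phi r t * y" using assms by simp
  moreover have "0 \<le> \<eta> * t powr p + K * (y + y powr q)"
    using assms by (intro add_nonneg_nonneg mult_nonneg_nonneg) auto
  ultimately show ?thesis by linarith
qed

section \<open>Elementary estimates and limits\<close>

lemma power_near_one:
  fixes \<delta> :: real
  assumes "0 < \<delta>" "0 < n"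
  obtains b :: real where "0 < b" "b < 1" "1 - b ^ n \<le> \<delta>"
proof
  define \<epsilon> where "\<epsilon> = min (1/2) \<delta> / n"
  have n: "1 \<le> real n" using assms by simp
  have \<epsilon>: "0 < \<epsilon>" "n * \<epsilon> = min (1/2) \<delta>" using assms by (auto simp: \<epsilon>_def)
  have "1 * \<epsilon> \<le> n * \<epsilon>" using n \<epsilon>(1) by (intro mult_right_mono) auto
  then have \<epsilon>1: "\<epsilon> < 1" using \<epsilon>(2) by linarith
  then show "0 < 1 - \<epsilon>" "1 - \<epsilon> < 1" using \<epsilon> by auto
  have "1 + n * (- \<epsilon>) \<le> (1 + - \<epsilon>) ^ n" using \<epsilon>1 by (intro Bernoulli_inequality) linarith
  then show "1 - (1 - \<epsilon>) ^ n \<le> \<delta>" using \<epsilon>(2) by simp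
qed

text \<open>Rounding down a number of subdivisions or of code points costs only a factor tending to
  1.\<close>

lemma tendsto_div_floor: "((\<lambda>x. x / real (nat \<lfloor>x\<rfloor>)) \<longlongrightarrow> 1) at_top"
proof (rule tendsto_sandwich[where f = "\<lambda>_. 1" and h = "\<lambda>x. 1 + 1 / (x - 1)"])
  have "filterlim (\<lambda>x::real. - 1 + x) at_top at_top"
    by (rule filterlim_tendsto_add_at_top[OF tendsto_const filterlim_ident])
  then have "((\<lambda>x::real. 1 + inverse (- 1 + x)) \<longlongrightarrow> 1 + 0) at_top"
    by (intro tendsto_add tendsto_const tendsto_inverse_0_at_top)
  then show "((\<lambda>x::real. 1 + 1 / (x - 1)) \<longlongrightarrow> 1) at_top"
    by (simp add: inverse_eq_divide)
  show "\<forall>\<^sub>F x in at_top. x / real (nat \<lfloor>x\<rfloor>) \<le> 1 + 1 / (x - 1)"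
    using eventually_gt_at_top[of "1::real"]
  proof eventually_elim
    case (elim x)
    have "x - 1 < real (nat \<lfloor>x\<rfloor>)" using elim by linarith
    then have "x / real (nat \<lfloor>x\<rfloor>) \<le> x / (x - 1)" using elim by (intro divide_left_mono) auto
    also have "\<dots> = 1 + 1 / (x - 1)" using elim by (simp add: field_simps)
    finally show ?case .
  qed
  show "\<forall>\<^sub>F x in at_top. 1 \<le> x / real (nat \<lfloor>x\<rfloor>)"
    using eventually_gt_at_top[of "1::real"]
  proof eventually_elim
    case (elim x)
    have "real (nat \<lfloor>x\<rfloor>) \<le> x" "0 < real (nat \<lfloor>x\<rfloor>)" using elim by linarith+
    then show ?case by simp
  qed
qed simp

lemma filterlim_powr_at_top:
  fixes a :: real
  assumes "0 < a" shows "filterlim (\<lambda>x::real. x powr a) at_top at_top"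
proof -
  have "filterlim (\<lambda>x::real. a * ln x) at_top at_top"
    using assms by (rule filterlim_tendsto_pos_mult_at_top[OF tendsto_const _ ln_at_top])
  then have "filterlim (\<lambda>x::real. exp (a * ln x)) at_top at_top"
    by (rule filterlim_compose[OF exp_at_top])
  then show ?thesis
    by (rule filterlim_mono_eventually) (auto simp: powr_def intro!: eventually_mono[OF eventually_gt_at_top[of 0]])
qed

lemma abs_mult_ln_le:
  fixes y :: real
  assumes "0 \<le> y" "y \<le> 1"
  shows "\<bar>y * ln y\<bar> \<le> 2 * y powr (1/2)"
proof (cases "y = 0")
  case False
  then have y: "0 < y" using assms by simp
  have "ln (1 / y) \<le> (1 / y) powr (1/2) / (1/2)"
    using y assms by (intro ln_powr_bound) (auto simp: field_simps)
  then have "- ln y \<le> 2 / y powr (1/2)" using y by (simp add: ln_div powr_divide)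
  then have "y * (- ln y) \<le> y * (2 / y powr (1/2))" using y by (intro mult_left_mono) auto
  also have "\<dots> = 2 * y powr (1/2)"
  proof -
    have "y = y powr (1/2) * y powr (1/2)" using y by (simp flip: powr_add)
    then show ?thesis using y by (simp add: field_simps)
  qed
  finally show ?thesis using y assms by (simp add: abs_mult)
qed simp

text \<open>Away from 0 this is continuity of the logarithm; at 0 the square-root bound on y ln y
  takes over.\<close>

lemma tendsto_mult_ln:
  fixes f :: "'a \<Rightarrow> real"
  assumes f: "(f \<longlongrightarrow> a) F" and nonneg: "\<forall>\<^sub>F x in F. 0 \<le> f x"
  shows "((\<lambda>x. f x * ln (f x)) \<longlongrightarrow> a * ln a) F"
proof (cases "a = 0")
  case True
  have "((\<lambda>x. 2 * f x powr (1/2)) \<longlongrightarrow> 2 * a powr (1/2)) F"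
    using nonneg by (intro tendsto_intros tendsto_powr'[OF f]) auto
  then have lim: "((\<lambda>x. 2 * f x powr (1/2)) \<longlongrightarrow> 0) F" using True by simp
  have "\<forall>\<^sub>F x in F. f x < 1" using f True by (intro order_tendstoD(2)) auto
  then have "\<forall>\<^sub>F x in F. norm (f x * ln (f x)) \<le> 2 * f x powr (1/2)"
    using nonneg
  proof eventually_elim
    case (elim x)
    then show ?case using abs_mult_ln_le[of "f x"] by simp
  qed
  from Lim_null_comparison[OF this lim] show ?thesis using True by simp
qed (intro tendsto_intros f)

section \<open>Extended powers and extended integrals\<close>

lemma epowr_ennreal:
  "0 \<le> t \<Longrightarrow> ennreal t epowr r = (if r = 0 then 1 else if t = 0 then (if r < 0 then \<infinity> else 0) else ennreal (t powr r))"
  by (auto simp: epowr_def)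

lemma epowr_ennreal_pos: "0 < t \<Longrightarrow> r \<noteq> 0 \<Longrightarrow> ennreal t epowr r = ennreal (t powr r)"
  by (simp add: epowr_ennreal)

lemma epowr_antimono:
  assumes "a < 0" "x \<le> y" shows "y epowr a \<le> x epowr a"
proof (cases "x = 0 \<or> y = \<infinity>")
  case False
  then have "y \<noteq> 0" "x \<noteq> \<infinity>" "y < top" using assms by (auto simp: top_unique less_top)
  then have "0 < enn2real x" "enn2real x \<le> enn2real y"
    using False assms by (auto simp: enn2real_positive_iff less_top zero_less_iff_neq_zero intro!: enn2real_mono)
  then show ?thesis
    using False assms \<open>y \<noteq> 0\<close> \<open>x \<noteq> \<infinity>\<close> by (auto simp: epowr_def intro!: ennreal_leI powr_mono2')
qed (use assms in \<open>auto simp: epowr_def\<close>)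

lemma epowr_finite_iff: "0 < a \<Longrightarrow> x epowr a < \<infinity> \<longleftrightarrow> x < \<infinity>"
  by (auto simp: epowr_def less_top)

lemma ext_integral_ereal:
  assumes "integrable M f"
  shows "ext_integral M (\<lambda>x. ereal (f x)) = ereal (\<integral>x. f x \<partial>M)"
proof -
  have fin: "(\<integral>\<^sup>+x. ennreal (f x) \<partial>M) \<noteq> \<infinity>" "(\<integral>\<^sup>+x. ennreal (- f x) \<partial>M) \<noteq> \<infinity>"
    using assms unfolding real_integrable_def by auto
  have "ext_integral M (\<lambda>x. ereal (f x))
      = enn2ereal (\<integral>\<^sup>+x. ennreal (f x) \<partial>M) - enn2ereal (\<integral>\<^sup>+x. ennreal (- f x) \<partial>M)"
    unfolding ext_integral_def by simp
  also have "\<dots> = ereal (\<integral>x. f x \<partial>M)"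
    unfolding real_lebesgue_integral_def[OF assms] using fin
    by (cases rule: ennreal2_cases[of "\<integral>\<^sup>+x. ennreal (f x) \<partial>M" "\<integral>\<^sup>+x. ennreal (- f x) \<partial>M"])
       (auto simp: enn2ereal_ennreal)
  finally show ?thesis .
qed

lemma ext_integral_cong_AE:
  assumes "AE x in M. f x = g x" shows "ext_integral M f = ext_integral M g"
proof -
  have "(\<integral>\<^sup>+x. e2ennreal (f x) \<partial>M) = (\<integral>\<^sup>+x. e2ennreal (g x) \<partial>M)"
    "(\<integral>\<^sup>+x. e2ennreal (- f x) \<partial>M) = (\<integral>\<^sup>+x. e2ennreal (- g x) \<partial>M)"
    using assms by (auto intro!: nn_integral_cong_AE elim: eventually_mono)
  then show ?thesis by (simp only: ext_integral_def)
qed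

section \<open>Norms, distances and the unit cube\<close>

locale normed_cube =
  fixes N :: "real ^ 'd \<Rightarrow> real"
  assumes is_norm: "is_norm N"
begin

abbreviation U :: "(real ^ 'd) measure" where "U \<equiv> unit_lebesgue"

lemma d_pos: "0 < real CARD('d)" by simp

lemma N_nonneg [simp]: "0 \<le> N x"
  and N_eq_0 [simp]: "N x = 0 \<longleftrightarrow> x = 0"
  and N_scaleR: "N (c *\<^sub>R x) = \<bar>c\<bar> * N x"
  and N_triangle: "N (x + y) \<le> N x + N y"
  using is_norm unfolding is_norm_def by auto

lemma N_zero [simp]: "N 0 = 0"
  using N_eq_0 by blast

lemma N_minus: "N (x - y) = N (y - x)"
  using N_scaleR[of "-1" "x - y"] by simp

lemma N_pos: "x \<noteq> 0 \<Longrightarrow> 0 < N x"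
  using N_nonneg[of x] N_eq_0[of x] by linarith

lemma N_sum: "finite S \<Longrightarrow> N (sum f S) \<le> (\<Sum>i\<in>S. N (f i))"
proof (induction S rule: finite_induct)
  case (insert x F)
  then show ?case using N_triangle[of "f x" "sum f F"] by simp
qed simp

lemma N_le_norm: obtains K where "0 < K" "\<And>x. N x \<le> K * norm x"
proof
  show "0 < (\<Sum>b\<in>Basis. N b) + 1" by (intro add_nonneg_pos sum_nonneg) auto
  fix x
  have "N x = N (\<Sum>b\<in>Basis. (x \<bullet> b) *\<^sub>R b)" by (simp add: euclidean_representation)
  also have "\<dots> \<le> (\<Sum>b\<in>Basis. N ((x \<bullet> b) *\<^sub>R b))" by (rule N_sum) simp
  also have "\<dots> \<le> (\<Sum>b\<in>Basis. norm x * N b)"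
    by (intro sum_mono) (auto simp: N_scaleR intro!: mult_right_mono Basis_le_norm)
  also have "\<dots> = norm x * (\<Sum>b\<in>Basis. N b)" by (simp add: sum_distrib_left)
  also have "\<dots> \<le> ((\<Sum>b\<in>Basis. N b) + 1) * norm x" by (simp add: algebra_simps)
  finally show "N x \<le> ((\<Sum>b\<in>Basis. N b) + 1) * norm x" .
qed

lemma N_continuous: "continuous_on UNIV N"
proof -
  obtain K where K: "0 < K" "\<And>x. N x \<le> K * norm x" by (rule N_le_norm) blast
  have "\<bar>N x - N y\<bar> \<le> K * dist x y" for x y
  proof -
    have "N x \<le> N (x - y) + N y" "N y \<le> N (x - y) + N x"
      using N_triangle[of "x - y" y] N_triangle[of "y - x" x] by (auto simp: N_minus)
    then show ?thesis using K(2)[of "x - y"] by (auto simp: dist_norm)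
  qed
  then have "K-lipschitz_on UNIV N" using K by (auto simp: lipschitz_on_def dist_real_def)
  then show ?thesis by (rule lipschitz_on_continuous_on)
qed

lemma N_measurable [measurable]: "N \<in> borel_measurable borel"
  using N_continuous by (rule borel_measurable_continuous_onI)

lemma norm_le_N: obtains k where "0 < k" "\<And>x. k * norm x \<le> N x"
proof -
  have "sphere 0 1 \<noteq> ({} :: (real^'d) set)" by simp
  then obtain x0 where x0: "x0 \<in> sphere 0 1" "\<And>y. y \<in> sphere 0 1 \<Longrightarrow> N x0 \<le> N y"
    using continuous_attains_inf[of "sphere 0 1" N] continuous_on_subset[OF N_continuous, of "sphere 0 1"]
    by (auto simp del: mem_sphere)
  show ?thesis
  proof
    show "0 < N x0" using x0(1) by (intro N_pos) auto
    fix x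
    show "N x0 * norm x \<le> N x"
    proof (cases "x = 0")
      case False
      then have "N x0 \<le> N ((1 / norm x) *\<^sub>R x)" by (intro x0(2)) auto
      then show ?thesis using False by (simp add: N_scaleR field_simps)
    qed simp
  qed
qed

section \<open>Distances to finite sets\<close>

lemma dist_set_le: "finite A \<Longrightarrow> a \<in> A \<Longrightarrow> dist_set N x A \<le> N (x - a)"
  unfolding dist_set_def by (intro Min_le) auto

lemma dist_set_attained:
  assumes "finite A" "A \<noteq> {}" obtains a where "a \<in> A" "dist_set N x A = N (x - a)"
proof -
  have "Min ((\<lambda>y. N (x - y)) ` A) \<in> (\<lambda>y. N (x - y)) ` A" using assms by (intro Min_in) auto
  then show ?thesis using that unfolding dist_set_def by blast
qed

lemma dist_set_nonneg: "finite A \<Longrightarrow> A \<noteq> {} \<Longrightarrow> 0 \<le> dist_set N x A"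
  by (metis N_nonneg dist_set_attained)

lemma dist_set_pos: "finite A \<Longrightarrow> A \<noteq> {} \<Longrightarrow> x \<notin> A \<Longrightarrow> 0 < dist_set N x A"
  by (metis N_pos dist_set_attained eq_iff_diff_eq_0)

lemma dist_set_greatest:
  "finite A \<Longrightarrow> A \<noteq> {} \<Longrightarrow> (\<And>a. a \<in> A \<Longrightarrow> c \<le> N (x - a)) \<Longrightarrow> c \<le> dist_set N x A"
  by (metis dist_set_attained)

lemma dist_set_antimono: "finite B \<Longrightarrow> A \<noteq> {} \<Longrightarrow> A \<subseteq> B \<Longrightarrow> dist_set N x B \<le> dist_set N x A"
  unfolding dist_set_def by (intro Min_antimono) auto

lemma dist_set_affine:
  assumes "finite A" "A \<noteq> {}" "0 < b"
  shows "dist_set N (a + b *\<^sub>R x) ((\<lambda>y. a + b *\<^sub>R y) ` A) = b * dist_set N x A"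
proof -
  have eq: "N (a + b *\<^sub>R x - (a + b *\<^sub>R y)) = b * N (x - y)" for y
    using assms by (simp add: N_scaleR flip: scaleR_diff_right)
  obtain y where y: "y \<in> A" "dist_set N x A = N (x - y)"
    using dist_set_attained assms by metis
  show ?thesis
  proof (rule antisym)
    show "dist_set N (a + b *\<^sub>R x) ((\<lambda>y. a + b *\<^sub>R y) ` A) \<le> b * dist_set N x A"
      unfolding y(2) eq[symmetric] using assms y by (intro dist_set_le) auto
    show "b * dist_set N x A \<le> dist_set N (a + b *\<^sub>R x) ((\<lambda>y. a + b *\<^sub>R y) ` A)"
    proof (rule dist_set_greatest)
      fix c assume "c \<in> (\<lambda>y. a + b *\<^sub>R y) ` A"
      then obtain y where y: "y \<in> A" and c: "c = a + b *\<^sub>R y" by blast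
      show "b * dist_set N x A \<le> N (a + b *\<^sub>R x - c)"
        unfolding c eq using assms y by (intro mult_left_mono dist_set_le) auto
    qed (use assms in auto)
  qed
qed

lemma dist_set_measurable [measurable]:
  assumes "finite A" shows "(\<lambda>x. dist_set N x A) \<in> borel_measurable borel"
  unfolding dist_set_def using assms by (intro borel_measurable_Min) auto

section \<open>The unit cube as a probability space\<close>

lemma unit_cube_borel [measurable]: "unit_cube \<in> sets (borel :: (real^'d) measure)"
proof -
  have "unit_cube = (\<Inter>i. {x::real^'d. 0 < x $ i} \<inter> {x. x $ i \<le> 1})"
    by (auto simp: unit_cube_def)
  also have "\<dots> \<in> sets borel"
  proof (rule sets.countable_INT'')
    fix i :: 'd
    have "open {x::real^'d. 0 < x $ i}" "closed {x::real^'d. x $ i \<le> 1}"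
      by (auto intro: open_halfspace_component_gt_cart closed_halfspace_component_le_cart)
    then show "{x::real^'d. 0 < x $ i} \<inter> {x. x $ i \<le> 1} \<in> sets borel"
      by (intro sets.Int borel_open borel_closed)
  qed auto
  finally show ?thesis .
qed

lemma space_U [simp]: "space U = unit_cube"
  by (simp add: unit_lebesgue_def space_restrict_space)

lemma borel_measurable_U: "f \<in> borel_measurable borel \<Longrightarrow> f \<in> borel_measurable U"
  unfolding unit_lebesgue_def by (intro measurable_restrict_space1) simp

lemma borel_U: "(\<lambda>x. x) \<in> U \<rightarrow>\<^sub>M borel"
  unfolding unit_lebesgue_def by (intro measurable_restrict_space1) simp

lemma nn_integral_U:
  "(\<integral>\<^sup>+x. f x \<partial>U) = (\<integral>\<^sup>+x. f x * indicator unit_cube x \<partial>lborel)"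
  unfolding unit_lebesgue_def by (intro nn_integral_restrict_space) simp

lemma emeasure_U_space: "emeasure U unit_cube = 1"
proof -
  have 1: "emeasure lborel (box (0::real^'d) 1) = 1"
    by (subst emeasure_lborel_box) (auto simp: Basis_vec_def inner_axis intro!: prod.neutral)
  have 2: "emeasure lborel (cbox (0::real^'d) 1) = 1"
    by (subst emeasure_lborel_cbox) (auto simp: Basis_vec_def inner_axis intro!: prod.neutral)
  have "emeasure lborel (box (0::real^'d) 1) \<le> emeasure lborel (unit_cube :: (real^'d) set)"
    by (intro emeasure_mono) (auto simp: unit_cube_def mem_box_cart less_imp_le)
  moreover have "emeasure lborel (unit_cube :: (real^'d) set) \<le> emeasure lborel (cbox (0::real^'d) 1)"
    by (intro emeasure_mono) (auto simp: unit_cube_def mem_box_cart less_imp_le)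
  ultimately have "emeasure lborel (unit_cube :: (real^'d) set) = 1" using 1 2 by simp
  then show ?thesis unfolding unit_lebesgue_def by (simp add: emeasure_restrict_space)
qed

lemma prob_space_U: "prob_space U"
  by (intro prob_spaceI) (simp add: emeasure_U_space)

text \<open>A codebook is a null set, so its distance function is positive almost everywhere, and
  real powers and logarithms may replace their extended versions under the integral.\<close>

lemma AE_U_not_in: "finite A \<Longrightarrow> AE x in U. x \<notin> A"
proof -
  assume "finite A"
  then have "AE x in lborel. x \<notin> A" by (intro AE_not_in finite_imp_null_set_lborel)
  then show ?thesis unfolding unit_lebesgue_def
    by (subst AE_restrict_space_iff) auto
qed

lemma AE_U_cube: "AE x in U. x \<in> unit_cube"
  using AE_space[of U] by simp

lemma N_le_cube: obtains R where "0 < R" "\<And>x. x \<in> unit_cube \<Longrightarrow> N x \<le> R"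
proof -
  obtain K where K: "0 < K" "\<And>x. N x \<le> K * norm x" by (rule N_le_norm) blast
  show ?thesis
  proof
    show "0 < K * real CARD('d)" using K d_pos by simp
    fix x :: "real^'d" assume x: "x \<in> unit_cube"
    have "norm x \<le> (\<Sum>i\<in>UNIV. \<bar>x $ i\<bar>)" by (rule norm_le_l1_cart)
    also have "\<dots> \<le> (\<Sum>i\<in>(UNIV::'d set). 1)"
      using x by (intro sum_mono) (auto simp: unit_cube_def abs_le_iff less_imp_le intro: order_trans[of _ 0])
    finally have "norm x \<le> real CARD('d)" by simp
    then show "N x \<le> K * real CARD('d)" using K(2)[of x] K(1)
      by (meson mult_left_mono less_imp_le order_trans)
  qed
qed

lemma dist_set_bounded:
  assumes "finite A" "A \<noteq> {}"
  obtains T where "0 < T" "\<And>x. x \<in> unit_cube \<Longrightarrow> dist_set N x A \<le> T"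
proof -
  obtain R where R: "0 < R" "\<And>x. x \<in> unit_cube \<Longrightarrow> N x \<le> R" by (rule N_le_cube) blast
  obtain a where a: "a \<in> A" using assms by auto
  show ?thesis
  proof
    show "0 < R + N a" using R by (simp add: add_pos_nonneg)
    fix x :: "real^'d" assume "x \<in> unit_cube"
    then have "N (x - a) \<le> R + N a"
      using R(2)[of x] N_triangle[of x "-a"] N_minus[of 0 a] by simp
    then show "dist_set N x A \<le> R + N a" using dist_set_le[OF assms(1) a, of x] by simp
  qed
qed

section \<open>Subcubes and the regular grid\<close>

definition cell :: "real^'d \<Rightarrow> real \<Rightarrow> (real^'d) set" where
  "cell a b = (\<lambda>y. a + b *\<^sub>R y) ` unit_cube"

lemma mem_cell: "0 < b \<Longrightarrow> x \<in> cell a b \<longleftrightarrow> (\<forall>j. a $ j < x $ j \<and> x $ j \<le> a $ j + b)"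
proof
  assume b: "0 < b" and x: "\<forall>j. a $ j < x $ j \<and> x $ j \<le> a $ j + b"
  have "x = a + b *\<^sub>R ((1 / b) *\<^sub>R (x - a))" using b by simp
  moreover have "(1 / b) *\<^sub>R (x - a) \<in> unit_cube"
    using x b by (auto simp: unit_cube_def field_simps)
  ultimately show "x \<in> cell a b" unfolding cell_def by blast
next
  assume b: "0 < b" and "x \<in> cell a b"
  then obtain y where y: "x = a + b *\<^sub>R y" "\<And>j. 0 < y $ j" "\<And>j. y $ j \<le> 1"
    by (auto simp: cell_def unit_cube_def)
  then show "\<forall>j. a $ j < x $ j \<and> x $ j \<le> a $ j + b"
    using b by (simp add: mult_left_le)
qed

lemma cell_affine_iff: "0 < b \<Longrightarrow> a + b *\<^sub>R y \<in> cell a b \<longleftrightarrow> y \<in> unit_cube"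
  by (auto simp: cell_def)

lemma cell_borel [measurable]:
  assumes "0 < b" shows "cell a b \<in> sets borel"
proof -
  have "cell a b = (\<lambda>x. (1 / b) *\<^sub>R (x - a)) -` unit_cube \<inter> space borel"
    using assms by (auto simp: mem_cell unit_cube_def field_simps)
  also have "\<dots> \<in> sets borel" by (rule measurable_sets[OF _ unit_cube_borel]) measurable
  finally show ?thesis .
qed

lemma nn_integral_affine:
  assumes [measurable]: "f \<in> borel_measurable borel" and b: "0 < b"
  shows "(\<integral>\<^sup>+x. f x \<partial>lborel) = ennreal (b ^ CARD('d)) * (\<integral>\<^sup>+y. f (a + b *\<^sub>R y) \<partial>(lborel :: (real^'d) measure))"
proof -
  have L: "lborel = density (distr lborel borel (\<lambda>x::real^'d. a + b *\<^sub>R x)) (\<lambda>_. ennreal (b ^ CARD('d)))"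
    using lborel_affine[of b a] b by simp
  have "(\<integral>\<^sup>+x. f x \<partial>lborel) = (\<integral>\<^sup>+x. f x \<partial>density (distr lborel borel (\<lambda>x::real^'d. a + b *\<^sub>R x)) (\<lambda>_. ennreal (b ^ CARD('d))))"
    by (rule arg_cong[OF L, of "\<lambda>M. integral\<^sup>N M f"])
  also have "\<dots> = ennreal (b ^ CARD('d)) * (\<integral>\<^sup>+y. f (a + b *\<^sub>R y) \<partial>lborel)"
    by (subst nn_integral_density) (auto simp: nn_integral_distr nn_integral_cmult)
  finally show ?thesis .
qed

lemma integral_affine:
  fixes f :: "real^'d \<Rightarrow> real"
  assumes [measurable]: "f \<in> borel_measurable borel" and b: "0 < b"
  shows "(\<integral>x. f x \<partial>lborel) = b ^ CARD('d) * (\<integral>y. f (a + b *\<^sub>R y) \<partial>lborel)"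
    and "integrable lborel f \<longleftrightarrow> integrable lborel (\<lambda>y. f (a + b *\<^sub>R y))"
proof -
  have L: "lborel = density (distr lborel borel (\<lambda>x::real^'d. a + b *\<^sub>R x)) (\<lambda>_. ennreal (b ^ CARD('d)))"
    using lborel_affine[of b a] b by simp
  have "(\<integral>x. f x \<partial>lborel) = (\<integral>x. f x \<partial>density (distr lborel borel (\<lambda>x::real^'d. a + b *\<^sub>R x)) (\<lambda>_. ennreal (b ^ CARD('d))))"
    by (rule arg_cong[OF L, of "\<lambda>M. integral\<^sup>L M f"])
  also have "\<dots> = (\<integral>y. b ^ CARD('d) * f (a + b *\<^sub>R y) \<partial>lborel)"
    using b by (subst integral_density) (auto simp: integral_distr)
  finally show "(\<integral>x. f x \<partial>lborel) = b ^ CARD('d) * (\<integral>y. f (a + b *\<^sub>R y) \<partial>lborel)" by simp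
  have "integrable lborel f \<longleftrightarrow> integrable (density (distr lborel borel (\<lambda>x::real^'d. a + b *\<^sub>R x)) (\<lambda>_. ennreal (b ^ CARD('d)))) f"
    by (rule arg_cong[OF L, of "\<lambda>M. integrable M f"])
  also have "\<dots> \<longleftrightarrow> integrable lborel (\<lambda>y. b ^ CARD('d) * f (a + b *\<^sub>R y))"
    using b by (subst integrable_density) (auto simp: integrable_distr_eq)
  finally show "integrable lborel f \<longleftrightarrow> integrable lborel (\<lambda>y. f (a + b *\<^sub>R y))"
    using b by simp
qed

lemma cell_integral:
  fixes f :: "real^'d \<Rightarrow> real"
  assumes [measurable]: "f \<in> borel_measurable borel" and b: "0 < b" and sub: "cell a b \<subseteq> unit_cube"
  shows "(\<integral>x. indicator (cell a b) x * f x \<partial>U) = b ^ CARD('d) * (\<integral>y. f (a + b *\<^sub>R y) \<partial>U)"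
    and "integrable U (\<lambda>x. indicator (cell a b) x * f x) \<longleftrightarrow> integrable U (\<lambda>y. f (a + b *\<^sub>R y))"
proof -
  note [measurable] = cell_borel[OF b]
  have ind: "indicator unit_cube x * (indicator (cell a b) x * f x) = indicator (cell a b) x * f x" for x
    using sub by (auto simp: indicator_def)
  have ind2: "indicator (cell a b) (a + b *\<^sub>R y) = (indicator unit_cube y :: real)" for y
    using b by (simp add: indicator_def cell_affine_iff)
  show "(\<integral>x. indicator (cell a b) x * f x \<partial>U) = b ^ CARD('d) * (\<integral>y. f (a + b *\<^sub>R y) \<partial>U)"
    unfolding unit_lebesgue_def
    by (subst (1 2) integral_restrict_space; simp add: ind; subst integral_affine[OF _ b, of _ a]; simp add: ind2)
  show "integrable U (\<lambda>x. indicator (cell a b) x * f x) \<longleftrightarrow> integrable U (\<lambda>y. f (a + b *\<^sub>R y))"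
    unfolding unit_lebesgue_def
    by (subst (1 2) integrable_restrict_space; simp add: ind; subst integral_affine[OF _ b, of _ a]; simp add: ind2)
qed

definition indices :: "nat \<Rightarrow> ('d \<Rightarrow> nat) set" where
  "indices m = {i. \<forall>j. i j < m}"

definition corner :: "nat \<Rightarrow> ('d \<Rightarrow> nat) \<Rightarrow> real^'d" where
  "corner m i = (\<chi> j. real (i j) / real m)"

text \<open>Cells are half-open like the cube, with sides \<open>(k/m, (k+1)/m]\<close>, hence the
  ceiling and the shift by 1. On the cube the ceiling is at least 1, so truncated subtraction is
  exact.\<close>

definition index_of :: "nat \<Rightarrow> real^'d \<Rightarrow> ('d \<Rightarrow> nat)" where
  "index_of m x = (\<lambda>j. nat \<lceil>real m * x $ j\<rceil> - 1)"

lemma indices_PiE: "indices m = PiE UNIV (\<lambda>_. {..<m})"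
  by (auto simp: indices_def PiE_def)

lemma finite_indices [simp]: "finite (indices m)"
  unfolding indices_PiE by (rule finite_PiE) auto

lemma card_indices: "card (indices m) = m ^ CARD('d)"
  unfolding indices_PiE by (subst card_PiE) auto

lemma indices_nonempty: "0 < m \<Longrightarrow> indices m \<noteq> {}"
  by (auto simp: indices_def)

lemma index_of_eq:
  assumes "0 < m" "x \<in> unit_cube"
  shows "index_of m x \<in> indices m" and "x \<in> cell (corner m i) (1 / m) \<longleftrightarrow> index_of m x = i"
proof -
  have pos: "0 < real m * x $ j" "real m * x $ j \<le> m" for j
    using assms by (auto simp: unit_cube_def mult_left_le)
  have ceil: "1 \<le> \<lceil>real m * x $ j\<rceil>" "\<lceil>real m * x $ j\<rceil> \<le> int m" for j
    using pos[of j] by (auto simp: ceiling_le_iff)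
  have lt: "nat \<lceil>real m * x $ j\<rceil> - 1 < m" for j using ceil[of j] by linarith
  then show "index_of m x \<in> indices m"
    by (auto simp: indices_def index_of_def)
  have "(corner m i $ j < x $ j \<and> x $ j \<le> corner m i $ j + 1 / m) \<longleftrightarrow> nat \<lceil>real m * x $ j\<rceil> - 1 = i j" for j
  proof -
    have "(corner m i $ j < x $ j \<and> x $ j \<le> corner m i $ j + 1 / m) \<longleftrightarrow>
        real (i j) < real m * x $ j \<and> real m * x $ j \<le> real (i j) + 1"
      using assms by (auto simp: corner_def field_simps)
    also have "\<dots> \<longleftrightarrow> \<lceil>real m * x $ j\<rceil> = int (i j) + 1"
      by (auto simp: ceiling_eq_iff)
    also have "\<dots> \<longleftrightarrow> nat \<lceil>real m * x $ j\<rceil> - 1 = i j" using ceil[of j] by linarith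
    finally show ?thesis .
  qed
  then show "x \<in> cell (corner m i) (1 / m) \<longleftrightarrow> index_of m x = i"
    using assms by (auto simp: mem_cell index_of_def fun_eq_iff)
qed

lemma cell_corner_subset:
  assumes "0 < m" "i \<in> indices m"
  shows "cell (corner m i) (1 / m) \<subseteq> unit_cube"
proof
  fix x assume "x \<in> cell (corner m i) (1 / m)"
  then have x: "corner m i $ j < x $ j" "x $ j \<le> corner m i $ j + 1 / m" for j
    using assms by (auto simp: mem_cell)
  have "0 \<le> corner m i $ j" "corner m i $ j + 1 / m \<le> 1" for j
  proof -
    have "i j + 1 \<le> m" using assms by (auto simp: indices_def Suc_le_eq)
    then have "real (i j) + 1 \<le> real m" by linarith
    then show "0 \<le> corner m i $ j" "corner m i $ j + 1 / m \<le> 1"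
      using assms by (auto simp: corner_def field_simps)
  qed
  then show "x \<in> unit_cube" unfolding unit_cube_def
    using x le_less_trans order_trans by blast
qed

lemma sum_indicator_cells:
  assumes "0 < m" "x \<in> unit_cube"
  shows "(\<Sum>i\<in>indices m. indicator (cell (corner m i) (1 / m)) x * F i) = (F (index_of m x) :: real)"
proof -
  have "(\<Sum>i\<in>indices m. indicator (cell (corner m i) (1 / m)) x * F i)
      = (\<Sum>i\<in>indices m. if index_of m x = i then F i else 0)"
    using index_of_eq(2)[OF assms] by (intro sum.cong) (auto simp: indicator_def)
  also have "\<dots> = F (index_of m x)"
    using index_of_eq(1)[OF assms] by simp
  finally show ?thesis .
qed

text \<open>Each point of the cube lies in a copy of the cube scaled by 1/m and based at a grid
  corner, and N is bounded on the cube.\<close>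

lemma grid_cover:
  obtains R where "0 < R"
    "\<And>m x. 0 < m \<Longrightarrow> x \<in> unit_cube \<Longrightarrow> dist_set N x (corner m ` indices m) \<le> R / real m"
proof -
  obtain R where R: "0 < R" "\<And>x. x \<in> unit_cube \<Longrightarrow> N x \<le> R" by (rule N_le_cube) blast
  show ?thesis
  proof
    fix m :: nat and x assume m: "0 < m" and x: "x \<in> (unit_cube :: (real^'d) set)"
    define i where "i = index_of m x"
    have i: "i \<in> indices m" "x \<in> cell (corner m i) (1 / m)"
      using index_of_eq[OF m x] by (auto simp: i_def)
    then obtain y where y: "y \<in> unit_cube" "x = corner m i + (1 / m) *\<^sub>R y" by (auto simp: cell_def)
    have "dist_set N x (corner m ` indices m) \<le> N (x - corner m i)"
      using i by (intro dist_set_le) auto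
    also have "\<dots> = N y / m" using y m by (simp add: N_scaleR)
    also have "\<dots> \<le> R / m" using R y m by (intro divide_right_mono) auto
    finally show "dist_set N x (corner m ` indices m) \<le> R / real m" .
  qed (rule R)
qed

lemma finite_dense_set:
  assumes \<rho>: "0 < \<rho>"
  obtains F where "finite F" "F \<noteq> {}" "\<And>x. x \<in> unit_cube \<Longrightarrow> dist_set N x F < \<rho>"
proof -
  obtain R where R: "0 < R" "\<And>m x. 0 < m \<Longrightarrow> x \<in> unit_cube \<Longrightarrow> dist_set N x (corner m ` indices m) \<le> R / real m"
    by (rule grid_cover) blast
  obtain m where m: "R / \<rho> < real m" using reals_Archimedean2 by blast
  have "0 < R / \<rho>" using R \<rho> by simp
  then have m0: "0 < m" using m by (cases "m = 0") auto
  then have "R / real m < \<rho>" using m \<rho> by (simp add: field_simps)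
  then show ?thesis using R(2)[OF m0] m0
    by (intro that[of "corner m ` indices m"]) (auto simp: indices_nonempty intro: le_less_trans)
qed

section \<open>Negative moments of the distance, uniformly in the codebook\<close>

lemma N_powr_integrable_ball:
  assumes p: "- real CARD('d) < p" "p < 0"
  obtains I where "0 \<le> I"
    "(\<integral>\<^sup>+z. indicator {z. N z < 1} z * ennreal (N z powr p) \<partial>lborel) \<le> ennreal I"
proof -
  obtain k where k: "0 < k" "\<And>x. k * norm x \<le> N x" by (rule norm_le_N) blast
  define v where "v = unit_ball_vol (real CARD('d)) * (1 / k) ^ CARD('d)"
  have v: "0 \<le> v" using k by (simp add: v_def)
  have meas [measurable]: "{z. N z < t} \<in> sets borel" for t by measurable
  have vol: "emeasure lborel {z. N z < t} \<le> ennreal (v * t ^ CARD('d))" if "0 < t" for t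
  proof -
    have "emeasure lborel {z. N z < t} \<le> emeasure lborel (ball (0::real^'d) (t / k))"
    proof (rule emeasure_mono)
      show "{z. N z < t} \<subseteq> ball 0 (t / k)"
      proof
        fix z assume "z \<in> {z. N z < t}"
        then have "k * norm z < t" using k(2)[of z] by simp
        then show "z \<in> ball 0 (t / k)" using k(1) by (simp add: field_simps)
      qed
    qed simp
    also have "\<dots> = ennreal (v * t ^ CARD('d))"
      using k that by (subst emeasure_ball) (auto simp: v_def power_divide divide_simps)
    finally show ?thesis .
  qed
  \<comment> \<open>Ratio of the geometric series over the shells 2^-(j+1) \<le> N z < 2^-j: from
    one shell to the next the bound on the power grows by 2^(-p) and the bound on the volume shrinks
    by 2^(-d). Their product is below 1 because p > -d.\<close>
  define q where "q = 2 powr (- p) * (1/2) ^ CARD('d)"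
  have q: "0 \<le> q" "q < 1"
  proof -
    have "q = 2 powr (- p - real CARD('d))"
      by (simp add: q_def powr_diff powr_realpow power_one_over)
    also have "\<dots> < 1" using p by (simp add: powr_less_one)
    finally show "q < 1" .
  qed (simp add: q_def)
  define K where "K = 2 powr (- p) * v"
  have K: "0 \<le> K" using v by (simp add: K_def)
  have pt: "indicator {z. N z < 1} z * ennreal (N z powr p)
      \<le> (\<Sum>j. ennreal ((2 powr (-p)) ^ Suc j) * indicator {z. N z < (1/2) ^ j} z)" for z
  proof (cases "0 < N z \<and> N z < 1")
    case True
    obtain j0 where "(1/2) ^ j0 < N z" using True real_arch_pow_inv[of "N z" "1/2"] by auto
    define j1 where "j1 = (LEAST j. (1/2) ^ j \<le> N z)"
    have j1: "(1/2) ^ j1 \<le> N z" unfolding j1_def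
      using \<open>(1/2) ^ j0 < N z\<close> by (intro LeastI[of "\<lambda>j. (1/2) ^ j \<le> N z" j0] less_imp_le)
    have "j1 \<noteq> 0" using j1 True by (auto intro!: gr0I)
    then obtain j where j: "j1 = Suc j" using not0_implies_Suc by blast
    have lt: "N z < (1/2) ^ j"
      using not_less_Least[of j "\<lambda>j. (1/2) ^ j \<le> N z"] j unfolding j1_def by auto
    have "N z powr p \<le> ((1/2) ^ Suc j) powr p"
      using j1 j p by (intro powr_mono2') auto
    also have "\<dots> = (2 powr (-p)) ^ Suc j"
    proof -
      have "((1/2::real) ^ n) powr p = ((1/2) powr p) ^ n" for n
        by (induction n) (auto simp: powr_divide)
      then show ?thesis by (simp add: powr_divide powr_minus_divide)
    qed
    finally have le: "N z powr p \<le> (2 powr (-p)) ^ Suc j" .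
    have "indicator {z. N z < 1} z * ennreal (N z powr p)
        \<le> ennreal ((2 powr (-p)) ^ Suc j) * indicator {z. N z < (1/2) ^ j} z"
      using lt True le by (auto intro: ennreal_leI)
    also have "\<dots> \<le> (\<Sum>j. ennreal ((2 powr (-p)) ^ Suc j) * indicator {z. N z < (1/2) ^ j} z)"
    proof -
      have "f j \<le> suminf f" for f :: "nat \<Rightarrow> ennreal"
        using sum_le_suminf[of f "{j}"] by simp
      then show ?thesis .
    qed
    finally show ?thesis .
  next
    case False
    then have "N z = 0 \<or> \<not> N z < 1" using N_nonneg[of z] by linarith
    then have "indicator {z. N z < 1} z * ennreal (N z powr p) = 0"
      by (elim disjE) (simp_all add: indicator_def)
    then show ?thesis by (simp only: zero_le)
  qed
  have "(\<integral>\<^sup>+z. indicator {z. N z < 1} z * ennreal (N z powr p) \<partial>lborel)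
      \<le> (\<integral>\<^sup>+z. (\<Sum>j. ennreal ((2 powr (-p)) ^ Suc j) * indicator {z. N z < (1/2) ^ j} z) \<partial>lborel)"
    by (intro nn_integral_mono pt)
  also have "\<dots> = (\<Sum>j. ennreal ((2 powr (-p)) ^ Suc j) * emeasure lborel {z. N z < (1/2) ^ j})"
    by (subst nn_integral_suminf) (auto simp: nn_integral_cmult_indicator)
  also have "\<dots> \<le> (\<Sum>j. ennreal (K * q ^ j))"
  proof (intro suminf_le)
    fix j
    have "ennreal ((2 powr (-p)) ^ Suc j) * emeasure lborel {z. N z < (1/2) ^ j}
        \<le> ennreal ((2 powr (-p)) ^ Suc j) * ennreal (v * ((1/2) ^ j) ^ CARD('d))"
      by (intro mult_left_mono vol) auto
    also have "\<dots> = ennreal (K * q ^ j)"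
      using v by (subst ennreal_mult[symmetric])
        (auto simp: K_def q_def power_mult_distrib power_mult[symmetric] mult_ac)
    finally show "ennreal ((2 powr (-p)) ^ Suc j) * emeasure lborel {z. N z < (1/2) ^ j} \<le> ennreal (K * q ^ j)" .
  qed auto
  also have "\<dots> = ennreal (\<Sum>j. K * q ^ j)"
    using q K by (intro suminf_ennreal2) (auto intro!: summable_mult summable_geometric)
  finally show ?thesis
    using q K by (intro that[of "\<Sum>j. K * q ^ j"]) (auto intro!: suminf_nonneg summable_mult summable_geometric)
qed

text \<open>Where the distance is below 1/\<tau>, its power is at most the sum of the truncated
  potentials of all code points, each with integral at most I/\<tau>^d; elsewhere it is at most 1.
  For \<tau> = n^(1/d) and card A \<le> \<theta> n the bound depends neither on A nor on n, which is
  the source of all uniformity in the codebook.\<close>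

lemma dist_powr_moment:
  assumes p: "- real CARD('d) < p" "p < 0"
  obtains I where "0 \<le> I"
    "\<And>A \<tau>. finite A \<Longrightarrow> A \<noteq> {} \<Longrightarrow> 0 < \<tau> \<Longrightarrow> integrable U (\<lambda>x. (\<tau> * dist_set N x A) powr p)"
    "\<And>A \<tau>. finite A \<Longrightarrow> A \<noteq> {} \<Longrightarrow> 0 < \<tau> \<Longrightarrow>
      (\<integral>x. (\<tau> * dist_set N x A) powr p \<partial>U) \<le> real (card A) / \<tau> ^ CARD('d) * I + 1"
proof -
  obtain I where I: "0 \<le> I"
    "(\<integral>\<^sup>+z. indicator {z. N z < 1} z * ennreal (N z powr p) \<partial>lborel) \<le> ennreal I"
    using N_powr_integrable_ball[OF p] by blast
  have bound: "(\<integral>\<^sup>+x. ennreal ((dist_set N x A / t) powr p) \<partial>U)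
      \<le> ennreal (real (card A) * t ^ CARD('d) * I + 1)"
    if A: "finite A" "A \<noteq> {}" and t: "0 < t" for A t
  proof -
    define F where "F z = indicator {z. N z < 1} z * ennreal (N z powr p)" for z
    have [measurable]: "F \<in> borel_measurable borel" unfolding F_def by measurable
    have [measurable]: "(\<lambda>x. F ((1/t) *\<^sub>R (x - a))) \<in> borel_measurable U" for a
      by (intro borel_measurable_U) measurable
    have pt: "ennreal ((dist_set N x A / t) powr p) \<le> (\<Sum>a\<in>A. F ((1/t) *\<^sub>R (x - a))) + 1" for x
    proof -
      obtain a where a: "a \<in> A" "dist_set N x A = N (x - a)" using dist_set_attained[OF A] .
      have eq: "dist_set N x A / t = N ((1/t) *\<^sub>R (x - a))" using t a by (simp add: N_scaleR)
      show ?thesis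
      proof (cases "dist_set N x A / t < 1")
        case True
        then have "ennreal ((dist_set N x A / t) powr p) = F ((1/t) *\<^sub>R (x - a))"
          unfolding F_def eq by simp
        also have "\<dots> \<le> (\<Sum>a\<in>A. F ((1/t) *\<^sub>R (x - a)))"
          using A a by (intro member_le_sum[of a A "\<lambda>a. F ((1/t) *\<^sub>R (x - a))"]) auto
        finally show ?thesis by (simp add: add_increasing2)
      next
        case False
        then have "(dist_set N x A / t) powr p \<le> 1 powr p" using p by (intro powr_mono2') auto
        then have "ennreal ((dist_set N x A / t) powr p) \<le> 1" by (simp add: ennreal_le_1)
        then show ?thesis by (simp add: add_increasing)
      qed
    qed
    have shift: "(\<integral>\<^sup>+x. F ((1/t) *\<^sub>R (x - a)) \<partial>lborel) \<le> ennreal (t ^ CARD('d)) * ennreal I" for a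
    proof -
      have "(\<integral>\<^sup>+x. F ((1/t) *\<^sub>R (x - a)) \<partial>lborel) = ennreal (t ^ CARD('d)) * (\<integral>\<^sup>+z. F z \<partial>lborel)"
        using t by (subst nn_integral_affine[of _ t a]) auto
      also have "\<dots> \<le> ennreal (t ^ CARD('d)) * ennreal I"
        using I unfolding F_def by (intro mult_left_mono) auto
      finally show ?thesis .
    qed
    have "(\<integral>\<^sup>+x. ennreal ((dist_set N x A / t) powr p) \<partial>U)
        \<le> (\<integral>\<^sup>+x. (\<Sum>a\<in>A. F ((1/t) *\<^sub>R (x - a))) + 1 \<partial>U)"
      by (intro nn_integral_mono pt)
    also have "\<dots> = (\<Sum>a\<in>A. \<integral>\<^sup>+x. F ((1/t) *\<^sub>R (x - a)) \<partial>U) + 1"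
      by (subst nn_integral_add) (auto simp: nn_integral_sum emeasure_U_space)
    also have "\<dots> \<le> (\<Sum>a\<in>A. ennreal (t ^ CARD('d) * I)) + 1"
    proof (intro add_right_mono sum_mono)
      fix a
      have "(\<integral>\<^sup>+x. F ((1/t) *\<^sub>R (x - a)) \<partial>U) \<le> (\<integral>\<^sup>+x. F ((1/t) *\<^sub>R (x - a)) \<partial>lborel)"
        unfolding nn_integral_U by (intro nn_integral_mono) (auto simp: indicator_def)
      also note shift
      finally show "(\<integral>\<^sup>+x. F ((1/t) *\<^sub>R (x - a)) \<partial>U) \<le> ennreal (t ^ CARD('d) * I)"
        using I t by (simp add: ennreal_mult)
    qed
    also have "\<dots> = ennreal (real (card A) * t ^ CARD('d) * I + 1)"
      using I t by (simp add: ennreal_of_nat_eq_real_of_nat ennreal_mult' ennreal_plus mult.assoc)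
    finally show ?thesis .
  qed
  have meas: "(\<lambda>x. (dist_set N x A / t) powr p) \<in> borel_measurable U" if "finite A" for A t
    using that by (intro borel_measurable_U) measurable
  have int: "integrable U (\<lambda>x. (dist_set N x A / t) powr p)"
    if "finite A" "A \<noteq> {}" "0 < t" for A t
    using bound[OF that] meas[OF that(1)]
    by (intro integrableI_nonneg) (auto intro: le_less_trans)
  have le: "(\<integral>x. (dist_set N x A / t) powr p \<partial>U) \<le> real (card A) * t ^ CARD('d) * I + 1"
    if A: "finite A" "A \<noteq> {}" "0 < t" for A t
  proof -
    have "(\<integral>\<^sup>+x. ennreal ((dist_set N x A / t) powr p) \<partial>U) = ennreal (\<integral>x. (dist_set N x A / t) powr p \<partial>U)"
      by (intro nn_integral_eq_integral int A) auto
    then have "ennreal (\<integral>x. (dist_set N x A / t) powr p \<partial>U) \<le> ennreal (real (card A) * t ^ CARD('d) * I + 1)"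
      using bound[OF A] by metis
    then show ?thesis
      using I(1) A(3) by (subst (asm) ennreal_le_iff) auto
  qed
  show ?thesis
  proof (rule that[OF I(1)])
    fix A :: "(real^'d) set" and \<tau> :: real assume A: "finite A" "A \<noteq> {}" "0 < \<tau>"
    have eq: "dist_set N x A / (1 / \<tau>) = \<tau> * dist_set N x A" for x by simp
    show "integrable U (\<lambda>x. (\<tau> * dist_set N x A) powr p)"
      using int[of A "1 / \<tau>"] A unfolding eq by simp
    show "(\<integral>x. (\<tau> * dist_set N x A) powr p \<partial>U) \<le> real (card A) / \<tau> ^ CARD('d) * I + 1"
      using le[of A "1 / \<tau>"] A unfolding eq by (simp add: power_one_over)
  qed
qed

section \<open>Weights and step functions on the grid\<close>

definition weight :: "real \<Rightarrow> (real^'d \<Rightarrow> real) \<Rightarrow> bool" where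
  "weight q f \<longleftrightarrow> f \<in> borel_measurable U \<and> (AE x in U. 0 \<le> f x) \<and> integrable U f \<and> integrable U (\<lambda>x. f x powr q)"

lemma AE_dist_pos: "finite A \<Longrightarrow> A \<noteq> {} \<Longrightarrow> AE x in U. 0 < dist_set N x A"
  using AE_U_not_in[of A] by (auto elim!: eventually_mono intro: dist_set_pos)

definition step :: "nat \<Rightarrow> (('d \<Rightarrow> nat) \<Rightarrow> real) \<Rightarrow> real^'d \<Rightarrow> real" where
  "step m G x = (\<Sum>i\<in>indices m. indicator (cell (corner m i) (1 / m)) x * G i)"

lemma step_eq: "0 < m \<Longrightarrow> x \<in> unit_cube \<Longrightarrow> step m G x = G (index_of m x)"
  unfolding step_def by (rule sum_indicator_cells)

lemma step_measurable: "0 < m \<Longrightarrow> step m G \<in> borel_measurable borel"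
  unfolding step_def by (intro borel_measurable_sum borel_measurable_times borel_measurable_indicator cell_borel) auto

lemma cells_disjoint:
  assumes "0 < m" "i \<in> indices m" "j \<in> indices m" "i \<noteq> j"
  shows "cell (corner m i) (1 / m) \<inter> cell (corner m j) (1 / m) = {}"
proof -
  have False if "x \<in> cell (corner m i) (1 / m)" "x \<in> cell (corner m j) (1 / m)" for x
  proof -
    have "x \<in> unit_cube" using that(1) cell_corner_subset[OF assms(1,2)] by blast
    then show False using that assms(4) index_of_eq(2)[OF assms(1), of x] by simp
  qed
  then show ?thesis by blast
qed

lemma sum_card_cells_le:
  assumes "0 < m" "finite A"
  shows "(\<Sum>i\<in>indices m. card (A \<inter> cell (corner m i) (1 / m))) \<le> card A"
proof -
  have dis: "\<forall>i\<in>indices m. \<forall>j\<in>indices m. i \<noteq> j \<longrightarrow>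
      A \<inter> cell (corner m i) (1 / m) \<inter> (A \<inter> cell (corner m j) (1 / m)) = {}"
  proof (intro ballI impI)
    fix i j assume "i \<in> indices m" "j \<in> indices m" "i \<noteq> j"
    from cells_disjoint[OF assms(1) this]
    show "A \<inter> cell (corner m i) (1 / m) \<inter> (A \<inter> cell (corner m j) (1 / m)) = {}" by blast
  qed
  have "(\<Sum>i\<in>indices m. card (A \<inter> cell (corner m i) (1 / m))) = card (\<Union>i\<in>indices m. A \<inter> cell (corner m i) (1 / m))"
    using assms by (intro card_UN_disjoint[symmetric] dis) auto
  also have "\<dots> \<le> card A" using assms by (intro card_mono) auto
  finally show ?thesis .
qed

section \<open>Orders up to minus the dimension\<close>

lemma N_epowr_measurable [measurable]: "(\<lambda>y. ennreal (N y) epowr r) \<in> borel_measurable borel"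
  by (subst epowr_ennreal) auto

text \<open>Self-similarity: halving the scale multiplies the integral by 2^(-d-r) \<ge> 1, so the
  half-size cube at the origin already carries at least the whole integral J, while the opposite
  half-size cube adds a positive amount. A finite J would then be smaller than itself.\<close>

lemma N_epowr_integral_infinite:
  assumes r: "r \<le> - real CARD('d)"
  shows "(\<integral>\<^sup>+y. ennreal (N y) epowr r * indicator unit_cube y \<partial>lborel) = \<infinity>"
proof (rule ccontr)
  let ?F = "\<lambda>y. ennreal (N y) epowr r"
  define J where "J = (\<integral>\<^sup>+y. ?F y * indicator unit_cube y \<partial>lborel)"
  assume "(\<integral>\<^sup>+y. ?F y * indicator unit_cube y \<partial>lborel) \<noteq> \<infinity>"
  then have J: "J \<noteq> \<infinity>" by (simp add: J_def)
  have r0: "r < 0" using r d_pos by linarith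
  have half: "(0::real) < 1/2" by simp
  let ?c1 = "cell 0 (1/2)"
  let ?c2 = "cell (\<chi> j. 1/2) (1/2)"
  note [measurable] = cell_borel[OF half]
  have c1: "y \<in> ?c1 \<longleftrightarrow> (\<forall>j. 0 < y $ j \<and> y $ j \<le> 1/2)"
    and c2: "y \<in> ?c2 \<longleftrightarrow> (\<forall>j. 1/2 < y $ j \<and> y $ j \<le> 1)" for y :: "real^'d"
    by (simp_all add: mem_cell[OF half])
  have cube: "y \<in> unit_cube" if "y \<in> ?c1 \<or> y \<in> ?c2" for y :: "real^'d"
  proof -
    have "0 < y $ j \<and> y $ j \<le> 1" for j
      using that
    proof
      assume "y \<in> ?c1"
      then have "0 < y $ j \<and> y $ j \<le> 1/2" using c1 by blast
      then show ?thesis by linarith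
    next
      assume "y \<in> ?c2"
      then have "1/2 < y $ j \<and> y $ j \<le> 1" using c2 by blast
      then show ?thesis by linarith
    qed
    then show ?thesis by (simp add: unit_cube_def)
  qed
  have sub: "indicator ?c1 y + indicator ?c2 y \<le> (indicator unit_cube y :: ennreal)" for y :: "real^'d"
  proof -
    have "\<not> (y \<in> ?c1 \<and> y \<in> ?c2)" using c1[of y] c2[of y] by (meson not_le)
    then show ?thesis using cube[of y] by (auto simp: indicator_def)
  qed
  have one: "J \<le> (\<integral>\<^sup>+y. ?F y * indicator ?c1 y \<partial>lborel)"
  proof -
    have F2: "?F (0 + (1/2) *\<^sub>R y) = ennreal ((1/2) powr r) * ?F y" for y
    proof (cases "N y = 0")
      case True
      then have "?F y = \<infinity>" "?F (0 + (1/2) *\<^sub>R y) = \<infinity>" using r0 by (auto simp: epowr_def)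
      then show ?thesis by (simp add: ennreal_mult_top)
    next
      case False
      then have y: "0 < N y" using N_nonneg[of y] by linarith
      then have "?F (0 + (1/2) *\<^sub>R y) = ennreal ((1/2 * N y) powr r)"
        using r0 by (simp add: N_scaleR epowr_ennreal_pos)
      also have "\<dots> = ennreal ((1/2) powr r) * ennreal (N y powr r)"
        unfolding powr_mult by (rule ennreal_mult) auto
      also have "ennreal (N y powr r) = ?F y" using r0 y by (simp add: epowr_ennreal_pos)
      finally show ?thesis .
    qed
    have "(\<integral>\<^sup>+y. ?F y * indicator ?c1 y \<partial>lborel)
        = ennreal ((1/2) ^ CARD('d)) * (\<integral>\<^sup>+y. ?F (0 + (1/2) *\<^sub>R y) * indicator ?c1 (0 + (1/2) *\<^sub>R y) \<partial>lborel)"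
      by (rule nn_integral_affine[OF _ half]) measurable
    also have "(\<integral>\<^sup>+y. ?F (0 + (1/2) *\<^sub>R y) * indicator ?c1 (0 + (1/2) *\<^sub>R y) \<partial>lborel)
        = (\<integral>\<^sup>+y. ennreal ((1/2) powr r) * (?F y * indicator unit_cube y) \<partial>lborel)"
      unfolding F2 by (intro nn_integral_cong) (simp only: indicator_def cell_affine_iff[OF half] mult.assoc)
    also have "\<dots> = ennreal ((1/2) powr r) * J"
      unfolding J_def by (rule nn_integral_cmult) measurable
    finally have eq: "(\<integral>\<^sup>+y. ?F y * indicator ?c1 y \<partial>lborel) = ennreal ((1/2) ^ CARD('d)) * (ennreal ((1/2) powr r) * J)" .
    have "1 \<le> (1/2) ^ CARD('d) * ((1/2) powr r :: real)"
    proof -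
      have "(1/2) ^ CARD('d) * ((1/2) powr r :: real) = (1/2) powr (real CARD('d) + r)"
        by (simp add: powr_add powr_realpow)
      also have "(1/2 :: real) powr 0 \<le> (1/2) powr (real CARD('d) + r)"
        using r by (intro powr_mono') auto
      finally show ?thesis using \<open>(1/2 :: real) powr 0 \<le> (1/2) powr (real CARD('d) + r)\<close> by simp
    qed
    then have "ennreal 1 * J \<le> ennreal ((1/2) ^ CARD('d) * ((1/2) powr r)) * J"
      by (intro mult_right_mono ennreal_leI) auto
    also have "\<dots> = ennreal ((1/2) ^ CARD('d)) * (ennreal ((1/2) powr r) * J)"
      by (simp add: ennreal_mult mult.assoc)
    finally show ?thesis unfolding eq by simp
  qed
  obtain R where R: "0 < R" "\<And>x. x \<in> unit_cube \<Longrightarrow> N x \<le> R" by (rule N_le_cube) blast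
  have two: "0 < (\<integral>\<^sup>+y. ?F y * indicator ?c2 y \<partial>lborel)"
  proof -
    have "(\<integral>\<^sup>+y. ennreal (R powr r) * indicator ?c2 y \<partial>lborel) \<le> (\<integral>\<^sup>+y. ?F y * indicator ?c2 y \<partial>lborel)"
    proof (intro nn_integral_mono)
      fix y :: "real^'d"
      show "ennreal (R powr r) * indicator ?c2 y \<le> ?F y * indicator ?c2 y"
      proof (cases "y \<in> ?c2")
        case True
        then have "N y \<le> R" using R(2) cube by blast
        then have "R powr r \<le> N y powr r" if "0 < N y" using r0 that by (intro powr_mono2') auto
        then have "ennreal (R powr r) \<le> ?F y"
          using r0 N_nonneg[of y] by (cases "N y = 0") (auto simp: epowr_def ennreal_leI)
        then show ?thesis by (simp add: mult_right_mono)
      qed simp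
    qed
    moreover have "(\<integral>\<^sup>+y. ennreal (R powr r) * indicator ?c2 y \<partial>lborel) = ennreal (R powr r) * emeasure lborel ?c2"
      by (rule nn_integral_cmult_indicator) simp
    moreover have "emeasure lborel ?c2 = ennreal ((1/2) ^ CARD('d))"
    proof -
      have "emeasure lborel ?c2 = (\<integral>\<^sup>+y. indicator ?c2 y \<partial>lborel)" by simp
      also have "\<dots> = ennreal ((1/2) ^ CARD('d)) * (\<integral>\<^sup>+y. indicator ?c2 ((\<chi> j. 1/2) + (1/2) *\<^sub>R y) \<partial>(lborel :: (real^'d) measure))"
        by (rule nn_integral_affine[OF _ half]) measurable
      also have "(\<integral>\<^sup>+y. indicator ?c2 ((\<chi> j. 1/2) + (1/2) *\<^sub>R y) \<partial>(lborel :: (real^'d) measure)) = (\<integral>\<^sup>+y. indicator unit_cube y \<partial>(lborel :: (real^'d) measure))"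
      proof -
        have "(\<lambda>y. indicator ?c2 ((\<chi> j. 1/2) + (1/2) *\<^sub>R y) :: ennreal) = indicator unit_cube"
          by (rule ext) (simp only: indicator_def cell_affine_iff[OF half])
        then show ?thesis by (rule arg_cong[where f = "integral\<^sup>N lborel"])
      qed
      also have "\<dots> = (\<integral>\<^sup>+y. 1 \<partial>U)" unfolding nn_integral_U by simp
      also have "\<dots> = 1" by (simp add: emeasure_U_space)
      finally show ?thesis by simp
    qed
    ultimately have le: "ennreal (R powr r) * ennreal ((1/2) ^ CARD('d)) \<le> (\<integral>\<^sup>+y. ?F y * indicator ?c2 y \<partial>lborel)" by simp
    have "0 < ennreal (R powr r) * ennreal ((1/2) ^ CARD('d))"
      using R by (simp flip: ennreal_mult)
    then show ?thesis using le by (rule less_le_trans)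
  qed
  have "J + (\<integral>\<^sup>+y. ?F y * indicator ?c2 y \<partial>lborel)
      \<le> (\<integral>\<^sup>+y. ?F y * indicator ?c1 y \<partial>lborel) + (\<integral>\<^sup>+y. ?F y * indicator ?c2 y \<partial>lborel)"
    using one by (rule add_right_mono)
  also have "\<dots> = (\<integral>\<^sup>+y. ?F y * indicator ?c1 y + ?F y * indicator ?c2 y \<partial>lborel)"
    by (rule nn_integral_add[symmetric]) measurable
  also have "\<dots> \<le> J"
    unfolding J_def by (intro nn_integral_mono) (simp add: mult_left_mono[OF sub] flip: distrib_left)
  finally have "J + (\<integral>\<^sup>+y. ?F y * indicator ?c2 y \<partial>lborel) \<le> J + 0" by simp
  then show False using two J by (simp add: ennreal_add_left_cancel_le)
qed

text \<open>Averaging over the position of a one-point codebook shows that its \<open>r\<close>-th moment is unbounded.\<close>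

lemma quant_error_zero:
  assumes r: "r \<le> - real CARD('d)" and n: "0 < n"
    and h: "h \<in> borel_measurable U" and mass: "(\<integral>\<^sup>+x. ennreal (h x) \<partial>U) = 1"
  shows "quant_error N n r (density U (\<lambda>x. ennreal (h x))) = 0"
proof -
  interpret U: prob_space U by (rule prob_space_U)
  interpret P: pair_sigma_finite U "lborel :: (real^'d) measure" ..
  note [measurable] = h
  let ?F = "\<lambda>y. ennreal (N y) epowr r"
  let ?\<nu> = "density U (\<lambda>x. ennreal (h x))"
  have r0: "r < 0" using r d_pos by linarith
  \<comment> \<open>This is \<open>(0,2]^d\<close>, which contains the translate of the unit cube by
    any point of the cube; so averaging over positions in Q meets a full cube next to the
    singularity at each x.\<close>
  define Q where "Q = cell (0::real^'d) 2"
  have [measurable]: "Q \<in> sets borel" unfolding Q_def by (rule cell_borel) simp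
  define G where "G a = (\<integral>\<^sup>+x. ?F (a - x) * ennreal (h x) \<partial>U)" for a
  have Qfin: "emeasure lborel Q < \<infinity>"
  proof -
    have "emeasure lborel Q \<le> emeasure lborel (cbox 0 (\<chi> j. 2) :: (real^'d) set)"
      by (intro emeasure_mono) (auto simp: Q_def mem_cell mem_box_cart less_imp_le)
    then show ?thesis by (rule le_less_trans) (rule emeasure_lborel_cbox_finite)
  qed
  have F1 [measurable]: "(\<lambda>x. ?F (a - x)) \<in> borel_measurable U" for a
    by (rule borel_measurable_U, rule measurable_compose[OF _ N_epowr_measurable]) simp
  have "(\<lambda>z. snd z - fst z) \<in> borel_measurable (U \<Otimes>\<^sub>M lborel)"
    using measurable_compose[OF measurable_fst borel_U, of "lborel :: (real^'d) measure"]
    by (intro borel_measurable_diff) auto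
  then have F2 [measurable]: "(\<lambda>z. ?F (snd z - fst z)) \<in> borel_measurable (U \<Otimes>\<^sub>M lborel)"
    by (rule measurable_compose[OF _ N_epowr_measurable])
  have inf: "(\<integral>\<^sup>+a. G a * indicator Q a \<partial>lborel) = \<infinity>"
  proof -
    have "(\<integral>\<^sup>+a. G a * indicator Q a \<partial>lborel)
        = (\<integral>\<^sup>+a. (\<integral>\<^sup>+x. ?F (a - x) * ennreal (h x) * indicator Q a \<partial>U) \<partial>lborel)"
      unfolding G_def by (intro nn_integral_cong nn_integral_multc[symmetric]) measurable
    also have "\<dots> = (\<integral>\<^sup>+x. (\<integral>\<^sup>+a. ?F (a - x) * ennreal (h x) * indicator Q a \<partial>lborel) \<partial>U)"
    proof (rule P.Fubini')
      show "(\<lambda>(x, a). ?F (a - x) * ennreal (h x) * indicator Q a) \<in> borel_measurable (U \<Otimes>\<^sub>M lborel)"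
        unfolding case_prod_beta by measurable
    qed
    also have "\<dots> \<ge> (\<integral>\<^sup>+x. ennreal (h x) * \<infinity> \<partial>U)"
    proof (rule nn_integral_mono)
      fix x :: "real^'d" assume "x \<in> space U"
      then have x: "x \<in> unit_cube" by simp
      have "\<infinity> = (\<integral>\<^sup>+y. ?F y * indicator unit_cube y \<partial>lborel)"
        by (rule N_epowr_integral_infinite[OF r, symmetric])
      also have "\<dots> \<le> (\<integral>\<^sup>+y. ?F (x + 1 *\<^sub>R y - x) * indicator Q (x + 1 *\<^sub>R y) \<partial>lborel)"
      proof (intro nn_integral_mono)
        fix y :: "real^'d"
        have "y \<in> unit_cube \<Longrightarrow> x + y \<in> Q"
          using x by (auto simp: Q_def mem_cell unit_cube_def) (smt (verit))+
        then show "?F y * indicator unit_cube y \<le> ?F (x + 1 *\<^sub>R y - x) * indicator Q (x + 1 *\<^sub>R y)"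
          by (auto simp: indicator_def)
      qed
      also have "\<dots> = (\<integral>\<^sup>+a. ?F (a - x) * indicator Q a \<partial>lborel)"
      proof -
        have "(\<lambda>a. a - x) \<in> borel_measurable borel" by simp
        then have "(\<lambda>a. ?F (a - x)) \<in> borel_measurable borel"
          by (rule measurable_compose[OF _ N_epowr_measurable])
        moreover have "(indicator Q :: _ \<Rightarrow> ennreal) \<in> borel_measurable borel"
          by (rule borel_measurable_indicator) fact
        ultimately have [measurable]: "(\<lambda>a. ?F (a - x) * indicator Q a) \<in> borel_measurable borel"
          by (rule borel_measurable_times_ennreal)
        show ?thesis using nn_integral_affine[of "\<lambda>a. ?F (a - x) * indicator Q a" 1 x] by simp
      qed
      finally have top: "(\<integral>\<^sup>+a. ?F (a - x) * indicator Q a \<partial>lborel) = \<infinity>" by (simp add: top_unique)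
      have "(\<integral>\<^sup>+a. ?F (a - x) * ennreal (h x) * indicator Q a \<partial>lborel)
          = (\<integral>\<^sup>+a. ennreal (h x) * (?F (a - x) * indicator Q a) \<partial>lborel)"
        by (intro nn_integral_cong) (simp only: mult_ac)
      also have "\<dots> = ennreal (h x) * (\<integral>\<^sup>+a. ?F (a - x) * indicator Q a \<partial>lborel)"
        by (rule nn_integral_cmult) measurable
      finally show "ennreal (h x) * \<infinity> \<le> (\<integral>\<^sup>+a. ?F (a - x) * ennreal (h x) * indicator Q a \<partial>lborel)"
        using top by simp
    qed
    also have "(\<integral>\<^sup>+x. ennreal (h x) * \<infinity> \<partial>U) = \<infinity>"
      using mass by (subst nn_integral_multc) auto
    finally show ?thesis by (simp add: top_unique)
  qed
  have unb: "\<exists>a. ennreal B < G a" for B :: real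
  proof (rule ccontr)
    assume "\<not> (\<exists>a. ennreal B < G a)"
    then have "G a \<le> ennreal B" for a by (simp add: not_less)
    then have "(\<integral>\<^sup>+a. G a * indicator Q a \<partial>lborel) \<le> (\<integral>\<^sup>+a. ennreal B * indicator Q a \<partial>lborel)"
      by (intro nn_integral_mono mult_right_mono) auto
    also have "\<dots> = ennreal B * emeasure lborel Q" by (rule nn_integral_cmult_indicator) simp
    also have "\<dots> < \<infinity>" using Qfin by (simp add: ennreal_mult_less_top)
    finally show False using inf by simp
  qed
  have G: "(\<integral>\<^sup>+x. ennreal (dist_set N x {a}) epowr r \<partial>?\<nu>) = G a" for a
  proof -
    have "dist_set N x {a} = N (a - x)" for x by (simp add: dist_set_def N_minus)
    then show ?thesis unfolding G_def
      by (simp only:) (subst nn_integral_density; auto intro!: nn_integral_cong simp: mult.commute)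
  qed
  have le: "quant_error N n r ?\<nu> \<le> ennreal e" if e: "0 < e" for e
  proof -
    \<comment> \<open>For negative order a large moment means a small error, so a single well-placed
      point is enough.\<close>
    obtain a where a: "ennreal (e powr r) < G a" using unb by blast
    have "quant_error N n r ?\<nu> \<le> (\<integral>\<^sup>+x. ennreal (dist_set N x {a}) epowr r \<partial>?\<nu>) epowr (1 / r)"
      using r0 n unfolding quant_error_def by (auto intro!: INF_lower simp: codebooks_def)
    also have "\<dots> \<le> ennreal (e powr r) epowr (1 / r)"
      unfolding G using r0 a by (intro epowr_antimono) auto
    also have "\<dots> = ennreal e" using r0 e by (simp add: epowr_ennreal_pos powr_powr)
    finally show ?thesis .
  qed
  have "quant_error N n r ?\<nu> \<le> 0"
  proof (rule ennreal_le_epsilon)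
    fix e :: real assume "0 < e"
    then show "quant_error N n r ?\<nu> \<le> 0 + ennreal e" using le[of e] by simp
  qed
  then show ?thesis by simp
qed

section \<open>The critical order\<close>

lemma Lnorm_finite_iff:
  "0 < s \<Longrightarrow> Lnorm (ereal s) h < \<infinity> \<longleftrightarrow> (\<integral>\<^sup>+x. ennreal (\<bar>h x\<bar> powr s) \<partial>U) < \<infinity>"
  using epowr_finite_iff[of "1 / s"] by (simp add: Lnorm_def)

lemma integrable_powr_iff:
  assumes "h \<in> borel_measurable U" "\<And>x. x \<in> unit_cube \<Longrightarrow> 0 \<le> h x"
  shows "integrable U (\<lambda>x. h x powr s) \<longleftrightarrow> (\<integral>\<^sup>+x. ennreal (\<bar>h x\<bar> powr s) \<partial>U) < \<infinity>"
proof -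
  note [measurable] = assms(1)
  have "(\<integral>\<^sup>+x. ennreal (\<bar>h x\<bar> powr s) \<partial>U) = (\<integral>\<^sup>+x. ennreal (norm (h x powr s)) \<partial>U)"
    using assms(2) by (intro nn_integral_cong) simp
  then show ?thesis unfolding integrable_iff_bounded by simp
qed

context
  fixes h :: "real^'d \<Rightarrow> real"
  assumes h: "h \<in> borel_measurable U" "\<And>x. x \<in> unit_cube \<Longrightarrow> 0 \<le> h x"
    and mass: "(\<integral>\<^sup>+x. ennreal (h x) \<partial>U) = 1"
begin

lemma Lnorm_1: "Lnorm (ereal 1) h = 1"
proof -
  have "(\<integral>\<^sup>+x. ennreal (\<bar>h x\<bar> powr 1) \<partial>U) = (\<integral>\<^sup>+x. ennreal (h x) \<partial>U)"
    using h(2) by (intro nn_integral_cong) simp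
  then show ?thesis using mass by (simp add: Lnorm_def epowr_def)
qed

lemma integrability_sup_ge_1: "1 \<le> integrability_sup h"
proof -
  have "ereal 1 \<in> {ereal s |s. 0 < s \<and> Lnorm (ereal s) h < \<infinity>}" using Lnorm_1 by force
  then have "ereal 1 \<le> integrability_sup h" unfolding integrability_sup_def by (rule Sup_upper)
  then show ?thesis by (simp add: one_ereal_def)
qed

lemma integrability_sup_cases:
  obtains (real) s where "1 \<le> s" "integrability_sup h = ereal s" "critical_order h = ereal (real CARD('d) / s - real CARD('d))"
  | (infinite) "integrability_sup h = \<infinity>" "critical_order h = ereal (- real CARD('d))"
proof (cases "integrability_sup h")
  case (real s)
  then have "1 \<le> s" using integrability_sup_ge_1 by (simp add: one_ereal_def)
  then show ?thesis using real by (intro that(1)) (auto simp: critical_order_def)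
next
  case PInf
  then show ?thesis by (intro that(2)) (auto simp: critical_order_def)
next
  case MInf
  then show ?thesis using integrability_sup_ge_1 by simp
qed

text \<open>For r > 0 the first moment is admissible. For r \<le> 0 the exponent d/(d+r) lies
  strictly below the supremum of exponents with finite norm, so some q beyond it has a finite norm
  as well.\<close>

lemma above_critical_order:
  assumes "critical_order h < ereal r"
  obtains q where "- real CARD('d) < r" "admissible (real CARD('d)) r q" "integrable U (\<lambda>x. h x powr q)"
proof -
  let ?d = "real CARD('d)"
  have *: "- ?d < r \<and> ereal (?d / (?d + r)) < integrability_sup h"
  proof (cases rule: integrability_sup_cases)
    case (real s)
    then have *: "?d / s < ?d + r" using assms by simp
    have "0 < ?d / s" using real by simp
    then have "0 < ?d + r" using * by linarith
    then show ?thesis using real * by (simp add: field_simps)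
  next
    case infinite
    then show ?thesis using assms by simp
  qed
  have int1: "integrable U (\<lambda>x. h x powr 1)"
    using Lnorm_1 Lnorm_finite_iff[of 1 h] integrable_powr_iff[OF h, of 1] by simp
  show ?thesis
  proof (cases "0 < r")
    case True
    then show ?thesis using int1 * by (intro that[of 1]) (auto simp: admissible_def)
  next
    case False
    obtain q where q: "?d / (?d + r) < q" "0 < q" "Lnorm (ereal q) h < \<infinity>"
      using conjunct2[OF *] unfolding integrability_sup_def less_Sup_iff by auto
    have "1 \<le> ?d / (?d + r)" using False * by (simp add: field_simps)
    then have "admissible ?d r q" using q by (simp add: admissible_def)
    moreover have "integrable U (\<lambda>x. h x powr q)"
      using q Lnorm_finite_iff[of q h] integrable_powr_iff[OF h, of q] by simp
    ultimately show ?thesis using * by (intro that) auto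
  qed
qed

text \<open>Here d/(d+r) is at least the supremum s: either it lies beyond all finite norms, or it
  equals s and the norm is infinite by assumption. Order 0 is excluded because it would force s = 1,
  while the norm of order 1 of a probability density is 1.\<close>

lemma below_critical_order:
  assumes "ereal r < critical_order h \<or> (ereal r = critical_order h \<and> Lnorm (integrability_sup h) h = \<infinity>)"
    and gt: "- real CARD('d) < r"
  shows "r < 0 \<and> Lnorm (ereal (real CARD('d) / (real CARD('d) + r))) h = \<infinity>"
proof (cases rule: integrability_sup_cases)
  case (real s)
  let ?d = "real CARD('d)"
  have ds: "?d / s \<le> ?d" using real(1) by (simp add: field_simps mult_left_le)
  have le: "r \<le> ?d / s - ?d" using assms(1) real by auto
  have r0: "r < 0"
  proof (rule ccontr)
    assume "\<not> r < 0"
    then have eq: "r = ?d / s - ?d" "?d / s = ?d" using le ds by auto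
    then have "s = 1" using real(1) by (simp add: field_simps)
    then have "Lnorm (integrability_sup h) h = 1" using real Lnorm_1 by simp
    then show False using assms(1) real eq by simp
  qed
  have sle: "s \<le> ?d / (?d + r)" using le gt real(1) by (simp add: field_simps)
  have "Lnorm (ereal (?d / (?d + r))) h = \<infinity>"
  proof (cases "ereal r < critical_order h")
    case True
    then have "r < ?d / s - ?d" using real by simp
    then have "s < ?d / (?d + r)" using gt real(1) by (simp add: field_simps)
    then have "\<not> ereal (?d / (?d + r)) \<le> integrability_sup h" using real by simp
    then have "ereal (?d / (?d + r)) \<notin> {ereal s |s. 0 < s \<and> Lnorm (ereal s) h < \<infinity>}"
      using Sup_upper[of "ereal (?d / (?d + r))" "{ereal s |s. 0 < s \<and> Lnorm (ereal s) h < \<infinity>}"]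
      unfolding integrability_sup_def by metis
    then have "\<not> Lnorm (ereal (?d / (?d + r))) h < \<infinity>" using gt by auto
    then show ?thesis by (simp add: not_less top_unique)
  next
    case False
    then have "r = ?d / s - ?d" "Lnorm (ereal s) h = \<infinity>" using assms(1) real by auto
    moreover have "?d / (?d + (?d / s - ?d)) = s" using real(1) by simp
    ultimately show ?thesis by simp
  qed
  then show ?thesis using r0 by blast
next
  case infinite
  then show ?thesis using assms by auto
qed

end

end

section \<open>The uniform distribution\<close>

locale quantization = normed_cube N for N :: "real ^ 'd \<Rightarrow> real" +
  fixes r :: real
  assumes r_gt: "- real CARD('d) < r"
begin

lemma ex_admissible: obtains q where "admissible (real CARD('d)) r q"
  by (rule that[of "max 1 (real CARD('d) / (real CARD('d) + r) + 1)"]) (auto simp: admissible_def)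

text \<open>Distances to A are bounded on the cube, so the moment inequality with \<eta> = 1
  provides an integrable majorant.\<close>

lemma phi_dist_integrable:
  assumes A: "finite A" "A \<noteq> {}" and \<tau>: "0 < \<tau>"
    and q: "admissible (real CARD('d)) r q"
    and w: "weight q f"
  shows "integrable U (\<lambda>x. phi r (\<tau> * dist_set N x A) * f x)"
proof -
  have f: "f \<in> borel_measurable U" "AE x in U. 0 \<le> f x" "integrable U f" "integrable U (\<lambda>x. f x powr q)"
    using w by (auto simp: weight_def)
  obtain p where p: "- real CARD('d) < p" "p < 0" "\<And>T. 0 < T \<Longrightarrow> \<exists>K\<ge>0. \<forall>t>0. t \<le> T \<longrightarrow>
      (\<forall>y\<ge>0. \<bar>phi r t\<bar> * y \<le> 1 * t powr p + K * (y + y powr q))"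
    using phi_mult_bound[OF d_pos r_gt q] zero_less_one by meson
  obtain T where T: "0 < T" "\<And>x. x \<in> unit_cube \<Longrightarrow> dist_set N x A \<le> T"
    by (rule dist_set_bounded[OF A]) blast
  obtain K where K: "K \<ge> 0" "\<And>t y. 0 < t \<Longrightarrow> t \<le> \<tau> * T \<Longrightarrow> 0 \<le> y \<Longrightarrow>
      \<bar>phi r t\<bar> * y \<le> t powr p + K * (y + y powr q)"
    using p(3)[of "\<tau> * T"] \<tau> T by fastforce
  have I: "integrable U (\<lambda>x. (\<tau> * dist_set N x A) powr p)"
    by (rule dist_powr_moment[OF p(1,2)]) (use A \<tau> in blast)
  note f(1)[measurable]
  have [measurable]: "(\<lambda>x. dist_set N x A) \<in> borel_measurable U"
    using A by (intro borel_measurable_U) measurable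
  show ?thesis
  proof (rule Bochner_Integration.integrable_bound)
    show "integrable U (\<lambda>x. (\<tau> * dist_set N x A) powr p + K * (f x + f x powr q))"
      using I f by (intro Bochner_Integration.integrable_add integrable_mult_right)
    show "AE x in U. norm (phi r (\<tau> * dist_set N x A) * f x)
        \<le> norm ((\<tau> * dist_set N x A) powr p + K * (f x + f x powr q))"
      using AE_dist_pos[OF A] f(2) AE_U_cube
    proof eventually_elim
      case (elim x)
      then have "\<bar>phi r (\<tau> * dist_set N x A)\<bar> * f x
          \<le> (\<tau> * dist_set N x A) powr p + K * (f x + f x powr q)"
        using \<tau> T by (intro K) auto
      then show ?case using elim by (simp add: abs_mult)
    qed
  qed measurable
qed

lemma phi_dist_integrable_bounded:
  assumes A: "finite A" "A \<noteq> {}" and \<tau>: "0 < \<tau>"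
    and f: "f \<in> borel_measurable U" "AE x in U. 0 \<le> f x" "AE x in U. f x \<le> M"
  shows "integrable U (\<lambda>x. phi r (\<tau> * dist_set N x A) * f x)"
proof -
  interpret U: prob_space U by (rule prob_space_U)
  obtain q where q: "admissible (real CARD('d)) r q" using ex_admissible .
  have "integrable U f"
    using f by (intro U.integrable_const_bound[of _ M]) (auto elim: eventually_elim2)
  moreover have "integrable U (\<lambda>x. f x powr q)"
  proof (rule U.integrable_const_bound)
    show "AE x in U. norm (f x powr q) \<le> M powr q"
      using f(2,3) by eventually_elim (use q in \<open>auto intro!: powr_mono2 simp: admissible_def\<close>)
  qed (use f(1) in measurable)
  ultimately show ?thesis using f(1,2) by (intro phi_dist_integrable[OF A \<tau> q]) (auto simp: weight_def)
qed

lemma phi_dist_integrable_1: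
  assumes "finite A" "A \<noteq> {}" "0 < \<tau>"
  shows "integrable U (\<lambda>x. phi r (\<tau> * dist_set N x A))"
  using phi_dist_integrable_bounded[OF assms, of "\<lambda>_. 1" 1] by simp

text \<open>Guarantees that the infimum of the normalised costs comes from a positive constant: for
  r \<le> 0 it could otherwise be minus infinity, and for r > 0 it could be -1/r, the cost of
  distance 0. The proof integrates the tangent inequality in t^p and inserts the moment bound, which
  at scale card^(1/d) is I + 1.\<close>

lemma uniform_lower_bound:
  obtains C0 where "0 < C0" "\<And>A. finite A \<Longrightarrow> A \<noteq> {} \<Longrightarrow>
    phi r C0 \<le> (\<integral>x. phi r (real (card A) powr (1 / CARD('d)) * dist_set N x A) \<partial>U)"
proof -
  interpret U: prob_space U by (rule prob_space_U)
  \<comment> \<open>The midpoint between -d and min r 0, so that the p-th moment is controlled and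
    the tangent inequality applies.\<close>
  define p where "p = (min r 0 - real CARD('d)) / 2"
  have p: "- real CARD('d) < p" "p < 0" "p < r"
    using r_gt d_pos unfolding p_def by (auto simp: min_def)
  obtain I where I: "0 \<le> I"
    "\<And>A \<tau>. finite A \<Longrightarrow> A \<noteq> {} \<Longrightarrow> 0 < \<tau> \<Longrightarrow> integrable U (\<lambda>x. (\<tau> * dist_set N x A) powr p)"
    "\<And>A \<tau>. finite A \<Longrightarrow> A \<noteq> {} \<Longrightarrow> 0 < \<tau> \<Longrightarrow>
      (\<integral>x. (\<tau> * dist_set N x A) powr p \<partial>U) \<le> real (card A) / \<tau> ^ CARD('d) * I + 1"
    by (rule dist_powr_moment[OF p(1,2)]) blast
  \<comment> \<open>Chosen so that c^p is the moment bound; the correction term of the tangent is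
    then a product of two nonpositive factors.\<close>
  define c where "c = (I + 1) powr (1 / p)"
  have c: "0 < c" "c powr p = I + 1" using I p by (auto simp: c_def powr_powr)
  show ?thesis
  proof (rule that[OF c(1)])
    fix A :: "(real^'d) set" assume A: "finite A" "A \<noteq> {}"
    define \<tau> where "\<tau> = real (card A) powr (1 / CARD('d))"
    have cA: "0 < card A" using A by (simp add: card_gt_0_iff)
    then have \<tau>: "0 < \<tau>" by (simp add: \<tau>_def)
    have "\<tau> ^ CARD('d) = card A"
      using cA by (simp add: \<tau>_def powr_power)
    then have one: "real (card A) / \<tau> ^ CARD('d) = 1" using cA by simp
    have int: "integrable U (\<lambda>x. (\<tau> * dist_set N x A) powr p)"
      and le: "(\<integral>x. (\<tau> * dist_set N x A) powr p \<partial>U) \<le> I + 1"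
      using I(2,3)[OF A \<tau>] unfolding one by auto
    have "phi r c \<le> phi r c + c powr (r - p) / p * ((\<integral>x. (\<tau> * dist_set N x A) powr p \<partial>U) - c powr p)"
    proof -
      have "0 \<le> c powr (r - p) / p * ((\<integral>x. (\<tau> * dist_set N x A) powr p \<partial>U) - c powr p)"
        using le c p by (intro mult_nonpos_nonpos) (auto simp: divide_nonneg_neg)
      then show ?thesis by simp
    qed
    also have "\<dots> = (\<integral>x. phi r c + c powr (r - p) / p * ((\<tau> * dist_set N x A) powr p - c powr p) \<partial>U)"
      using int by (subst Bochner_Integration.integral_add) (auto simp: Bochner_Integration.integral_diff U.prob_space[unfolded space_U])
    also have "\<dots> \<le> (\<integral>x. phi r (\<tau> * dist_set N x A) \<partial>U)"
    proof (rule integral_mono_AE)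
      show "AE x in U. phi r c + c powr (r - p) / p * ((\<tau> * dist_set N x A) powr p - c powr p)
          \<le> phi r (\<tau> * dist_set N x A)"
        using AE_dist_pos[OF A] by eventually_elim (use p c \<tau> in \<open>intro phi_tangent; simp\<close>)
    qed (use int phi_dist_integrable_1[OF A \<tau>] in auto)
    finally show "phi r c \<le> (\<integral>x. phi r (real (card A) powr (1 / CARD('d)) * dist_set N x A) \<partial>U)"
      unfolding \<tau>_def .
  qed
qed

text \<open>The constant \<open>C\<close> obtained here is the quantization coefficient of the uniform distribution.\<close>

lemma ex_constant:
  obtains C where "0 < C"
    "\<And>A. finite A \<Longrightarrow> A \<noteq> {} \<Longrightarrow>
      phi r C \<le> (\<integral>x. phi r (real (card A) powr (1 / CARD('d)) * dist_set N x A) \<partial>U)"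
    "\<And>e. 0 < e \<Longrightarrow> \<exists>A. finite A \<and> A \<noteq> {} \<and>
      (\<integral>x. phi r (real (card A) powr (1 / CARD('d)) * dist_set N x A) \<partial>U) < phi r C + e"
proof -
  interpret U: prob_space U by (rule prob_space_U)
  define M where "M A = (\<integral>x. phi r (real (card A) powr (1 / CARD('d)) * dist_set N x A) \<partial>U)" for A
  define S where "S = M ` {A. finite A \<and> A \<noteq> {}}"
  obtain C0 where C0: "0 < C0" "\<And>A. finite A \<Longrightarrow> A \<noteq> {} \<Longrightarrow> phi r C0 \<le> M A"
    using uniform_lower_bound unfolding M_def by metis
  have bdd: "bdd_below S" unfolding S_def using C0 by (intro bdd_belowI[of _ "phi r C0"]) auto
  have ne: "S \<noteq> {}" unfolding S_def by (auto intro!: exI[of _ "{0}"])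
  have A1: "finite {0::real^'d}" "{0::real^'d} \<noteq> {}" by auto
  obtain T where T: "0 < T" "\<And>x. x \<in> unit_cube \<Longrightarrow> dist_set N x {0} \<le> T"
    using dist_set_bounded[OF A1] by metis
  have "M {0} \<le> (\<integral>x. phi r T \<partial>U)" unfolding M_def
  proof (rule integral_mono_AE)
    show "AE x in U. phi r (real (card {0::real^'d}) powr (1 / CARD('d)) * dist_set N x {0}) \<le> phi r T"
      using AE_dist_pos[OF A1] AE_U_cube by eventually_elim (use T in \<open>auto intro!: phi_mono\<close>)
  qed (use phi_dist_integrable_1[OF A1, of 1] in auto)
  then have "M {0} \<le> phi r T" by (simp add: U.prob_space[unfolded space_U])
  moreover have "Inf S \<le> M {0}" using bdd by (intro cInf_lower) (auto simp: S_def)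
  ultimately have up: "Inf S \<le> phi r T" by simp
  have low: "phi r C0 \<le> Inf S" using ne C0 by (intro cInf_greatest) (auto simp: S_def)
  \<comment> \<open>\<open>phi r\<close> need not map onto the whole real line, so C is located by
    the intermediate value theorem between C0 and the value T coming from the one-point
    codebook.\<close>
  have "C0 \<le> T" using up low C0 T by (meson order_trans phi_le_iff)
  moreover have "continuous_on {C0..T} (phi r)"
    using C0(1) by (intro continuous_at_imp_continuous_on ballI phi_isCont) auto
  ultimately obtain C where C: "C0 \<le> C" "C \<le> T" "phi r C = Inf S"
    using IVT'[of "phi r" C0 "Inf S" T] up low by blast
  show ?thesis
  proof (rule that[of C])
    show "0 < C" using C C0 by simp
    show "phi r C \<le> (\<integral>x. phi r (real (card A) powr (1 / CARD('d)) * dist_set N x A) \<partial>U)"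
      if "finite A" "A \<noteq> {}" for A
      using that bdd unfolding C(3) M_def[symmetric] by (intro cInf_lower) (auto simp: S_def)
    fix e :: real assume "0 < e"
    then have "Inf S < phi r C + e" using C by simp
    then obtain s where "s \<in> S" "s < phi r C + e" using cInf_lessD[OF ne] by blast
    then show "\<exists>A. finite A \<and> A \<noteq> {} \<and>
      (\<integral>x. phi r (real (card A) powr (1 / CARD('d)) * dist_set N x A) \<partial>U) < phi r C + e"
      unfolding S_def M_def by blast
  qed
qed

section \<open>Costs of codebooks and their behaviour on cells\<close>

definition cost :: "real \<Rightarrow> (real^'d \<Rightarrow> real) \<Rightarrow> (real^'d) set \<Rightarrow> real" where
  "cost \<tau> f A = (\<integral>x. phi r (\<tau> * dist_set N x A) * f x \<partial>U)"

lemma integral_phi_scale: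
  assumes A: "finite A" "A \<noteq> {}" and "0 < \<mu>" "0 < \<tau>"
  shows "(\<integral>x. phi r (\<mu> * \<tau> * dist_set N x A) \<partial>U)
    = \<mu> powr r * (\<integral>x. phi r (\<tau> * dist_set N x A) \<partial>U) + phi r \<mu>"
proof -
  interpret U: prob_space U by (rule prob_space_U)
  have m [measurable]: "(\<lambda>x. dist_set N x A) \<in> borel_measurable U"
    using A by (intro borel_measurable_U) measurable
  have "(\<integral>x. phi r (\<mu> * \<tau> * dist_set N x A) \<partial>U)
      = (\<integral>x. \<mu> powr r * phi r (\<tau> * dist_set N x A) + phi r \<mu> \<partial>U)"
  proof (rule integral_cong_AE)
    show "AE x in U. phi r (\<mu> * \<tau> * dist_set N x A) = \<mu> powr r * phi r (\<tau> * dist_set N x A) + phi r \<mu>"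
      using AE_dist_pos[OF A] by eventually_elim (use assms phi_scale in \<open>simp add: mult.assoc\<close>)
  qed measurable
  also have "\<dots> = \<mu> powr r * (\<integral>x. phi r (\<tau> * dist_set N x A) \<partial>U) + phi r \<mu>"
    using phi_dist_integrable_1[OF A \<open>0 < \<tau>\<close>]
    by (subst Bochner_Integration.integral_add) (auto simp: U.prob_space[unfolded space_U])
  finally show ?thesis .
qed

lemma cost_mono:
  assumes "finite B" "A \<noteq> {}" "A \<subseteq> B" "0 < \<tau>" "AE x in U. 0 \<le> f x"
    and "integrable U (\<lambda>x. phi r (\<tau> * dist_set N x A) * f x)"
    and "integrable U (\<lambda>x. phi r (\<tau> * dist_set N x B) * f x)"
  shows "cost \<tau> f B \<le> cost \<tau> f A"
  unfolding cost_def
proof (rule integral_mono_AE)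
  have "AE x in U. 0 < dist_set N x B" using assms by (intro AE_dist_pos) auto
  then show "AE x in U. phi r (\<tau> * dist_set N x B) * f x \<le> phi r (\<tau> * dist_set N x A) * f x"
    using assms(5)
  proof eventually_elim
    case (elim x)
    then show ?case using assms dist_set_antimono[of B A x]
      by (intro mult_right_mono phi_mono mult_left_mono) auto
  qed
qed (use assms in auto)

lemma phi_cell_integrable:
  assumes "finite A" "A \<noteq> {}" "0 < \<tau>" "0 < b"
  shows "integrable U (\<lambda>x. indicator (cell a b) x * phi r (\<tau> * dist_set N x A))"
proof -
  have "integrable U (\<lambda>x. phi r (\<tau> * dist_set N x A) * indicator (cell a b) x)"
    using assms cell_borel[OF assms(4), of a]
    by (intro phi_dist_integrable_bounded[where M = 1])
       (auto intro!: borel_measurable_U simp: indicator_def)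
  then show ?thesis by (simp add: mult.commute)
qed

lemma integral_phi_cell:
  assumes "finite B" "B \<noteq> {}" "0 < \<tau>" "0 < b" "cell a b \<subseteq> unit_cube"
  shows "(\<integral>x. indicator (cell a b) x * phi r (\<tau> * dist_set N x ((\<lambda>y. a + b *\<^sub>R y) ` B)) \<partial>U)
    = b ^ CARD('d) * (\<integral>y. phi r (\<tau> * b * dist_set N y B) \<partial>U)"
proof -
  have "(\<lambda>x. phi r (\<tau> * dist_set N x ((\<lambda>y. a + b *\<^sub>R y) ` B))) \<in> borel_measurable borel"
    using assms by (intro measurable_compose[OF _ phi_measurable] borel_measurable_times dist_set_measurable) auto
  from cell_integral(1)[OF this assms(4,5)] show ?thesis
    using assms by (simp add: dist_set_affine mult.assoc)
qed

text \<open>Ignoring the code points placed in other cells can only overestimate distances; on each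
  cell, self-similarity then reduces the cost to one on the unit cube.\<close>

lemma cost_cells_le:
  assumes m: "0 < m" and \<tau>: "0 < \<tau>" and G: "\<And>i. i \<in> indices m \<Longrightarrow> 0 \<le> G i"
    and B: "\<And>i. i \<in> indices m \<Longrightarrow> finite (B i)" "\<And>i. i \<in> indices m \<Longrightarrow> B i \<noteq> {}"
  defines "A \<equiv> (\<Union>i\<in>indices m. (\<lambda>y. corner m i + (1 / m) *\<^sub>R y) ` B i)"
  shows "finite A" "A \<noteq> {}" "card A \<le> (\<Sum>i\<in>indices m. card (B i))"
    "cost \<tau> (step m G) A
      \<le> (\<Sum>i\<in>indices m. (1 / m) ^ CARD('d) * G i * (\<integral>y. phi r (\<tau> * (1 / m) * dist_set N y (B i)) \<partial>U))"
proof -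
  show A: "finite A" "A \<noteq> {}" unfolding A_def using B indices_nonempty[OF m] by auto
  have "card A \<le> (\<Sum>i\<in>indices m. card ((\<lambda>y. corner m i + (1 / m) *\<^sub>R y) ` B i))"
    unfolding A_def by (intro card_UN_le) auto
  also have "\<dots> \<le> (\<Sum>i\<in>indices m. card (B i))"
    using B by (intro sum_mono card_image_le) auto
  finally show "card A \<le> (\<Sum>i\<in>indices m. card (B i))" .
  let ?c = "\<lambda>i. cell (corner m i) (1 / m)"
  let ?B = "\<lambda>i. (\<lambda>y. corner m i + (1 / m) *\<^sub>R y) ` B i"
  have "cost \<tau> (step m G) A = (\<integral>x. (\<Sum>i\<in>indices m. G i * (indicator (?c i) x * phi r (\<tau> * dist_set N x A))) \<partial>U)"
    unfolding cost_def step_def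
    by (intro Bochner_Integration.integral_cong refl, subst sum_distrib_left, intro sum.cong refl)
       (simp only: mult_ac)
  also have "\<dots> = (\<Sum>i\<in>indices m. G i * (\<integral>x. indicator (?c i) x * phi r (\<tau> * dist_set N x A) \<partial>U))"
  proof (subst Bochner_Integration.integral_sum)
    show "integrable U (\<lambda>x. G i * (indicator (?c i) x * phi r (\<tau> * dist_set N x A)))" for i
      using m by (intro integrable_mult_right phi_cell_integrable A \<tau>) auto
  qed (simp only: integral_mult_right_zero)
  also have "\<dots> \<le> (\<Sum>i\<in>indices m. G i * ((1 / m) ^ CARD('d) * (\<integral>y. phi r (\<tau> * (1 / m) * dist_set N y (B i)) \<partial>U)))"
  proof (intro sum_mono mult_left_mono G)
    fix i assume i: "i \<in> indices m"
    have Bi: "finite (?B i)" "?B i \<noteq> {}" using B[OF i] by auto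
    have "(\<integral>x. indicator (?c i) x * phi r (\<tau> * dist_set N x A) \<partial>U)
        \<le> (\<integral>x. indicator (?c i) x * phi r (\<tau> * dist_set N x (?B i)) \<partial>U)"
    proof (rule integral_mono_AE)
      show "AE x in U. indicator (?c i) x * phi r (\<tau> * dist_set N x A)
          \<le> indicator (?c i) x * phi r (\<tau> * dist_set N x (?B i))"
        using AE_dist_pos[OF A]
      proof eventually_elim
        case (elim x)
        have "dist_set N x A \<le> dist_set N x (?B i)"
          using A Bi i by (intro dist_set_antimono) (auto simp: A_def)
        then show ?case using elim \<tau> by (intro mult_left_mono phi_mono) auto
      qed
    qed (use phi_cell_integrable A Bi \<tau> m in auto)
    also have "\<dots> = (1 / m) ^ CARD('d) * (\<integral>y. phi r (\<tau> * (1 / m) * dist_set N y (B i)) \<partial>U)"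
      using B i \<tau> m by (intro integral_phi_cell cell_corner_subset) auto
    finally show "(\<integral>x. indicator (?c i) x * phi r (\<tau> * dist_set N x A) \<partial>U)
        \<le> (1 / m) ^ CARD('d) * (\<integral>y. phi r (\<tau> * (1 / m) * dist_set N y (B i)) \<partial>U)" .
  qed
  finally show "cost \<tau> (step m G) A
      \<le> (\<Sum>i\<in>indices m. (1 / m) ^ CARD('d) * G i * (\<integral>y. phi r (\<tau> * (1 / m) * dist_set N y (B i)) \<partial>U))"
    by (simp add: mult_ac)
qed

section \<open>From errors of codebooks to costs\<close>

definition codebook_error :: "(real^'d) measure \<Rightarrow> (real^'d) set \<Rightarrow> ennreal" where
  "codebook_error \<nu> A =
    (if r = 0 then eexp (ext_integral \<nu> (\<lambda>x. eln (dist_set N x A)))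
     else (\<integral>\<^sup>+x. ennreal (dist_set N x A) epowr r \<partial>\<nu>) epowr (1 / r))"

lemma quant_error_eq: "quant_error N n r \<nu> = (INF A\<in>codebooks n. codebook_error \<nu> A)"
  by (simp add: quant_error_def codebook_error_def)

lemma codebooks_iff: "A \<in> codebooks n \<longleftrightarrow> finite A \<and> A \<noteq> {} \<and> card A \<le> n"
  by (auto simp: codebooks_def Suc_le_eq card_gt_0_iff)

lemma dist_epowr_measurable:
  assumes "finite A" "A \<noteq> {}"
  shows "(\<lambda>x. ennreal (dist_set N x A) epowr r) \<in> borel_measurable U"
proof -
  have [measurable]: "(\<lambda>x. dist_set N x A) \<in> borel_measurable U"
    using assms by (intro borel_measurable_U) measurable
  show ?thesis
    using assms by (subst epowr_ennreal) (auto simp: dist_set_nonneg intro!: measurable_If)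
qed

lemma nn_integral_dist_epowr:
  assumes A: "finite A" "A \<noteq> {}" and "r \<noteq> 0"
    and h: "h \<in> borel_measurable U" "\<And>x. x \<in> unit_cube \<Longrightarrow> 0 \<le> h x"
  shows "(\<integral>\<^sup>+x. ennreal (dist_set N x A) epowr r \<partial>density U (\<lambda>x. ennreal (h x)))
    = (\<integral>\<^sup>+x. ennreal (dist_set N x A powr r * h x) \<partial>U)"
proof -
  have "(\<integral>\<^sup>+x. ennreal (dist_set N x A) epowr r \<partial>density U (\<lambda>x. ennreal (h x)))
      = (\<integral>\<^sup>+x. ennreal (h x) * (ennreal (dist_set N x A) epowr r) \<partial>U)"
    using h dist_epowr_measurable[OF A] by (intro nn_integral_density) auto
  also have "\<dots> = (\<integral>\<^sup>+x. ennreal (dist_set N x A powr r * h x) \<partial>U)"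
  proof (rule nn_integral_cong_AE)
    show "AE x in U. ennreal (h x) * (ennreal (dist_set N x A) epowr r) = ennreal (dist_set N x A powr r * h x)"
      using AE_dist_pos[OF A] AE_U_cube
      by eventually_elim (use assms in \<open>simp add: epowr_ennreal_pos ennreal_mult mult.commute\<close>)
  qed
  finally show ?thesis .
qed

lemma cost_powr:
  assumes r: "r \<noteq> 0" and pint: "integrable U (\<lambda>x. phi r (dist_set N x A) * f x)" and f: "integrable U f"
  shows "integrable U (\<lambda>x. dist_set N x A powr r * f x)"
    and "cost \<tau> f A = (\<tau> powr r * (\<integral>x. dist_set N x A powr r * f x \<partial>U) - (\<integral>x. f x \<partial>U)) / r"
proof -
  have "integrable U (\<lambda>x. r * (phi r (dist_set N x A) * f x) + f x)"
    using pint f by (intro Bochner_Integration.integrable_add integrable_mult_right)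
  moreover have "r * (phi r t * y) + y = t powr r * y" for t y
  proof -
    have "r * phi r t = t powr r - 1" using r by (simp add: phi_def)
    then have "r * (phi r t * y) = (t powr r - 1) * y" by (simp only: mult.assoc[symmetric])
    then show ?thesis by (simp add: left_diff_distrib)
  qed
  ultimately show int: "integrable U (\<lambda>x. dist_set N x A powr r * f x)" by simp
  have "cost \<tau> f A = (\<integral>x. \<tau> powr r / r * (dist_set N x A powr r * f x) - f x / r \<partial>U)"
    unfolding cost_def
    by (intro Bochner_Integration.integral_cong) (use r in \<open>auto simp: phi_def powr_mult field_simps\<close>)
  also have "\<dots> = (\<tau> powr r * (\<integral>x. dist_set N x A powr r * f x \<partial>U) - (\<integral>x. f x \<partial>U)) / r"
    using int f by (subst Bochner_Integration.integral_diff) (auto simp: diff_divide_distrib)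
  finally show "cost \<tau> f A = (\<tau> powr r * (\<integral>x. dist_set N x A powr r * f x \<partial>U) - (\<integral>x. f x \<partial>U)) / r" .
qed

text \<open>For r = 0 the number v is the geometric mean of the distance under the density h,
  otherwise its power mean of order r; unit mass of h makes the constants in \<open>phi\<close>
  match. With \<tau> = n^(1/d) a statement on rescaled errors becomes one on costs.\<close>

lemma codebook_error_cost:
  assumes A: "finite A" "A \<noteq> {}" and \<tau>: "0 < \<tau>"
    and q: "admissible (real CARD('d)) r q"
    and h: "h \<in> borel_measurable U" "\<And>x. x \<in> unit_cube \<Longrightarrow> 0 \<le> h x"
    and int: "integrable U h" "integrable U (\<lambda>x. h x powr q)" "(\<integral>x. h x \<partial>U) = 1"
  shows "\<exists>v>0. codebook_error (density U (\<lambda>x. ennreal (h x))) A = ennreal v \<and> phi r (\<tau> * v) = cost \<tau> h A"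
proof -
  note [measurable] = h(1)
  have [measurable]: "(\<lambda>x. dist_set N x A) \<in> borel_measurable U"
    using A by (intro borel_measurable_U) measurable
  have hnn: "AE x in U. 0 \<le> h x" using AE_U_cube by eventually_elim (rule h)
  have pint: "integrable U (\<lambda>x. phi r (t * dist_set N x A) * h x)" if "0 < t" for t
    using h(1) hnn int by (intro phi_dist_integrable[OF A that q]) (auto simp: weight_def)
  show ?thesis
  proof (cases "r = 0")
    case True
    have Lint: "integrable U (\<lambda>x. ln (dist_set N x A) * h x)"
      using pint[of 1] True by (simp add: phi_def)
    define L where "L = (\<integral>x. ln (dist_set N x A) * h x \<partial>U)"
    have nu_int: "integrable (density U (\<lambda>x. ennreal (h x))) (\<lambda>x. ln (dist_set N x A))"
      using Lint hnn by (subst integrable_real_density) (auto simp: mult.commute)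
    have "ext_integral (density U (\<lambda>x. ennreal (h x))) (\<lambda>x. eln (dist_set N x A))
        = ext_integral (density U (\<lambda>x. ennreal (h x))) (\<lambda>x. ereal (ln (dist_set N x A)))"
    proof (rule ext_integral_cong_AE)
      have "AE x in U. 0 < ennreal (h x) \<longrightarrow> eln (dist_set N x A) = ereal (ln (dist_set N x A))"
        using AE_dist_pos[OF A] by eventually_elim (simp add: eln_def)
      then show "AE x in density U (\<lambda>x. ennreal (h x)). eln (dist_set N x A) = ereal (ln (dist_set N x A))"
        by (subst AE_density) auto
    qed
    also have "\<dots> = ereal L"
      unfolding ext_integral_ereal[OF nu_int] L_def using hnn
      by (subst integral_real_density) (auto simp: mult.commute)
    finally have E: "codebook_error (density U (\<lambda>x. ennreal (h x))) A = ennreal (exp L)"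
      unfolding codebook_error_def using True by (simp add: eexp_def)
    have "cost \<tau> h A = (\<integral>x. ln \<tau> * h x + ln (dist_set N x A) * h x \<partial>U)"
      unfolding cost_def
    proof (rule integral_cong_AE)
      show "AE x in U. phi r (\<tau> * dist_set N x A) * h x = ln \<tau> * h x + ln (dist_set N x A) * h x"
        using AE_dist_pos[OF A] by eventually_elim (use True \<tau> in \<open>simp add: phi_def ln_mult algebra_simps\<close>)
    qed measurable
    also have "\<dots> = ln \<tau> + L"
      using Lint int by (subst Bochner_Integration.integral_add) (auto simp: L_def)
    also have "\<dots> = phi r (\<tau> * exp L)" using True \<tau> by (simp add: phi_def ln_mult)
    finally show ?thesis using E by (intro exI[of _ "exp L"]) auto
  next
    case False
    define X where "X = (\<integral>x. dist_set N x A powr r * h x \<partial>U)"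
    note cp = cost_powr[OF False pint[of 1, simplified] int(1)]
    have Xint: "integrable U (\<lambda>x. dist_set N x A powr r * h x)" by (rule cp(1))
    have nn: "AE x in U. 0 \<le> dist_set N x A powr r * h x" using hnn by eventually_elim simp
    \<comment> \<open>A positive finite moment keeps the extended power away from its special
      values. It is positive because the distance is positive off a null set and h has mass
      1.\<close>
    have X: "0 < X"
    proof -
      have "X \<noteq> 0"
      proof
        assume "X = 0"
        then have "AE x in U. dist_set N x A powr r * h x = 0"
          unfolding X_def using integral_nonneg_eq_0_iff_AE[OF Xint nn] by simp
        then have "AE x in U. h x = 0" using AE_dist_pos[OF A] by eventually_elim auto
        then have "(\<integral>x. h x \<partial>U) = 0" using integral_nonneg_eq_0_iff_AE[OF int(1) hnn] by simp
        then show False using int by simp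
      qed
      moreover have "0 \<le> X" unfolding X_def using nn by (rule integral_nonneg_AE)
      ultimately show ?thesis by simp
    qed
    have "(\<integral>\<^sup>+x. ennreal (dist_set N x A) epowr r \<partial>density U (\<lambda>x. ennreal (h x))) = ennreal X"
      unfolding X_def nn_integral_eq_integral[OF Xint nn, symmetric]
      using A False h by (intro nn_integral_dist_epowr) auto
    then have "codebook_error (density U (\<lambda>x. ennreal (h x))) A = ennreal X epowr (1 / r)"
      using False by (simp add: codebook_error_def)
    also have "\<dots> = ennreal (X powr (1 / r))" using X False by (simp add: epowr_ennreal_pos)
    finally have E: "codebook_error (density U (\<lambda>x. ennreal (h x))) A = ennreal (X powr (1 / r))" .
    have "cost \<tau> h A = (\<tau> powr r * X - 1) / r"
      using cp(2)[of \<tau>] int(3) by (simp add: X_def)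
    also have "\<dots> = phi r (\<tau> * X powr (1 / r))"
      using False X by (simp add: phi_def powr_mult powr_powr)
    finally show ?thesis using E X by (intro exI[of _ "X powr (1 / r)"]) auto
  qed
qed

end

locale quantization_const = quantization N r for N :: "real ^ 'd \<Rightarrow> real" and r +
  fixes C :: real
  assumes C_pos: "0 < C"
    and C_le: "\<And>A. finite A \<Longrightarrow> A \<noteq> {} \<Longrightarrow>
      phi r C \<le> (\<integral>x. phi r (real (card A) powr (1 / CARD('d)) * dist_set N x A) \<partial>unit_lebesgue)"
    and C_near: "\<And>e. 0 < e \<Longrightarrow> \<exists>A. finite A \<and> A \<noteq> {} \<and>
      (\<integral>x. phi r (real (card A) powr (1 / CARD('d)) * dist_set N x A) \<partial>unit_lebesgue) < phi r C + e"
begin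

text \<open>\<open>C_le\<close> speaks of the natural scale card^(1/d); the affine rule for
  rescaling carries it to any \<tau>.\<close>

lemma uniform_cost_ge:
  assumes A: "finite A" "A \<noteq> {}" and \<tau>: "0 < \<tau>"
  shows "phi r (C * (\<tau> / real (card A) powr (1 / CARD('d)))) \<le> (\<integral>x. phi r (\<tau> * dist_set N x A) \<partial>U)"
proof -
  define k where "k = real (card A) powr (1 / CARD('d))"
  have k: "0 < k" using A by (simp add: k_def card_gt_0_iff)
  have "phi r (C * (\<tau> / k)) = (\<tau> / k) powr r * phi r C + phi r (\<tau> / k)"
    using phi_scale[of "\<tau> / k" C r] k C_pos \<tau> by (simp add: mult.commute)
  also have "\<dots> \<le> (\<tau> / k) powr r * (\<integral>x. phi r (k * dist_set N x A) \<partial>U) + phi r (\<tau> / k)"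
    using C_le[OF A] by (intro add_right_mono mult_left_mono) (auto simp: k_def)
  also have "\<dots> = (\<integral>x. phi r (\<tau> / k * k * dist_set N x A) \<partial>U)"
    using A k \<tau> by (subst integral_phi_scale) auto
  finally show ?thesis using k by (simp add: k_def)
qed

text \<open>One near-optimal codebook B of c points serves all large k: the cube is split into m^d
  cells, m being the integer part of (k/c)^(1/d), and B is copied into each. This uses at most k
  points, and the scale is off by the factor \<open>\<mu> k\<close>, which tends to 1. So the
  infimum over all codebooks is also approached along every large size.\<close>

lemma uniform_near_optimal:
  assumes e: "0 < e"
  shows "\<forall>\<^sub>F k in sequentially. \<exists>A. finite A \<and> A \<noteq> {} \<and> card A \<le> k \<and>
    (\<integral>x. phi r (real k powr (1 / CARD('d)) * dist_set N x A) \<partial>U) \<le> phi r C + e"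
proof -
  interpret U: prob_space U by (rule prob_space_U)
  obtain B where B: "finite B" "B \<noteq> {}"
    "(\<integral>x. phi r (real (card B) powr (1 / CARD('d)) * dist_set N x B) \<partial>U) < phi r C + e"
    using C_near[OF e] by auto
  define c where "c = card B"
  have c: "0 < c" using B by (simp add: c_def card_gt_0_iff)
  define M where "M = (\<integral>x. phi r (real c powr (1 / CARD('d)) * dist_set N x B) \<partial>U)"
  have M: "M < phi r C + e" using B by (simp add: M_def c_def)
  define x where "x k = (real k / real c) powr (1 / CARD('d))" for k
  define m where "m k = nat \<lfloor>x k\<rfloor>" for k
  define \<mu> where "\<mu> k = x k / real (m k)" for k
  have xtop: "filterlim x at_top sequentially"
  proof -
    have "filterlim (\<lambda>k. 1 / real c * real k) at_top sequentially"
      using c by (intro filterlim_tendsto_pos_mult_at_top[OF tendsto_const] filterlim_real_sequentially) auto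
    then have "filterlim (\<lambda>k. real k / real c) at_top sequentially" by simp
    moreover have "filterlim (\<lambda>x. x powr (1 / CARD('d))) at_top (at_top :: real filter)"
      by (rule filterlim_powr_at_top) auto
    ultimately show ?thesis unfolding x_def by (rule filterlim_compose[rotated])
  qed
  have \<mu>lim: "\<mu> \<longlonglongrightarrow> 1"
    unfolding \<mu>_def m_def by (rule filterlim_compose[OF tendsto_div_floor xtop])
  have "(\<lambda>k. \<mu> k powr r * M + phi r (\<mu> k)) \<longlonglongrightarrow> 1 powr r * M + phi r 1"
    by (intro tendsto_intros \<mu>lim isCont_tendsto_compose[OF phi_isCont]) auto
  then have "\<forall>\<^sub>F k in sequentially. \<mu> k powr r * M + phi r (\<mu> k) < phi r C + e"
    using M by (intro order_tendstoD(2)) auto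
  moreover have "\<forall>\<^sub>F k in sequentially. 1 \<le> x k"
    using xtop by (simp add: filterlim_at_top)
  ultimately show ?thesis
  proof eventually_elim
    case (elim k)
    have m: "0 < m k" "real (m k) \<le> x k" using elim(2) by (auto simp: m_def)
    have k: "0 < k" using elim(2) by (cases "k = 0") (auto simp: x_def)
    have xk: "x k powr CARD('d) = real k / real c" using c k by (simp add: x_def powr_powr)
    define A where "A = (\<Union>i\<in>indices (m k). (\<lambda>y. corner (m k) i + (1 / m k) *\<^sub>R y) ` B)"
    let ?\<tau> = "real k powr (1 / CARD('d))"
    have A: "finite A" "A \<noteq> {}" "card A \<le> (\<Sum>i\<in>indices (m k). card B)"
      "cost ?\<tau> (step (m k) (\<lambda>_. 1)) A
        \<le> (\<Sum>i\<in>indices (m k). (1 / m k) ^ CARD('d) * 1 * (\<integral>y. phi r (?\<tau> * (1 / m k) * dist_set N y B) \<partial>U))"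
      unfolding A_def using cost_cells_le[of "m k" ?\<tau> "\<lambda>_. 1" "\<lambda>_. B"] m B k by auto
    have "real (card A) \<le> real (m k) ^ CARD('d) * real c"
      using A(3) by (simp add: card_indices c_def flip: of_nat_power of_nat_mult)
    also have "\<dots> \<le> x k powr CARD('d) * real c"
      using m c by (intro mult_right_mono) (auto simp: powr_realpow power_mono)
    also have "\<dots> = real k" using xk c by simp
    finally have "card A \<le> k" by simp
    moreover have "(\<integral>x. phi r (?\<tau> * dist_set N x A) \<partial>U) = cost ?\<tau> (step (m k) (\<lambda>_. 1)) A"
      unfolding cost_def using m by (intro Bochner_Integration.integral_cong) (auto simp: step_eq)
    moreover have "\<dots> \<le> (\<integral>y. phi r (?\<tau> * (1 / m k) * dist_set N y B) \<partial>U)"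
      using A(4) m by (simp add: card_indices power_one_over)
    moreover have "\<dots> = \<mu> k powr r * M + phi r (\<mu> k)"
    proof -
      have eq: "?\<tau> * (1 / m k) = \<mu> k * real c powr (1 / CARD('d))"
        using c by (simp add: \<mu>_def x_def powr_divide)
      have "0 < \<mu> k" using m elim(2) by (simp add: \<mu>_def)
      then show ?thesis unfolding eq M_def using B c by (intro integral_phi_scale) auto
    qed
    ultimately show ?case using A elim(1) by (intro exI[of _ A]) auto
  qed
qed

section \<open>Step functions\<close>

definition rate :: "nat \<Rightarrow> real" where
  "rate n = real n powr (1 / CARD('d))"

definition cexp :: real where
  "cexp = real CARD('d) / (real CARD('d) + r)"

text \<open>The optimal density of code points, proportional to the power d/(d+r) of the density and
  normalised to integral 1 over the cube.\<close>

definition share :: "nat \<Rightarrow> (('d \<Rightarrow> nat) \<Rightarrow> real) \<Rightarrow> ('d \<Rightarrow> nat) \<Rightarrow> real" where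
  "share m G i = G i powr cexp / (\<Sum>j\<in>indices m. (1 / m) ^ CARD('d) * G j powr cexp)"

text \<open>Where code points have local density n \<rho>, the cost of the uniform distribution at
  scale n^(1/d) is about \<open>phi r (C * \<rho> powr (-1/d))\<close>; here \<rho> is \<theta>
  times the optimal share.\<close>

definition step_value :: "real \<Rightarrow> nat \<Rightarrow> (('d \<Rightarrow> nat) \<Rightarrow> real) \<Rightarrow> real" where
  "step_value \<theta> m G =
    (\<Sum>i\<in>indices m. (1 / m) ^ CARD('d) * G i * phi r (C * (\<theta> * share m G i) powr (- 1 / CARD('d))))"

lemma cexp_pos: "0 < cexp"
  using r_gt by (simp add: cexp_def)

lemma rate_pos: "0 < n \<Longrightarrow> 0 < rate n"
  by (simp add: rate_def)

lemma rate_power: "0 < n \<Longrightarrow> rate n ^ CARD('d) = n"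
  by (simp add: rate_def powr_power)

lemma share_pos:
  assumes "0 < m" "\<And>i. i \<in> indices m \<Longrightarrow> 0 < G i" "i \<in> indices m"
  shows "0 < share m G i"
proof -
  have "0 < (\<Sum>j\<in>indices m. (1 / m) ^ CARD('d) * G j powr cexp)"
    using assms by (intro sum_pos mult_pos_pos) (force simp: indices_nonempty)+
  then show ?thesis using assms(2)[OF assms(3)] by (simp add: share_def)
qed

lemma sum_share:
  assumes "0 < m" "\<And>i. i \<in> indices m \<Longrightarrow> 0 < G i"
  shows "(\<Sum>i\<in>indices m. (1 / m) ^ CARD('d) * share m G i) = 1"
proof -
  have "0 < (\<Sum>j\<in>indices m. (1 / m) ^ CARD('d) * G j powr cexp)"
    using assms by (intro sum_pos mult_pos_pos) (force simp: indices_nonempty)+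
  then show ?thesis by (simp add: share_def flip: sum_divide_distrib)
qed

text \<open>Cell i receives the integer part of n \<theta> \<open>share m G i\<close> times its
  volume as its number of points, arranged nearly optimally for the uniform distribution. Rounding
  down keeps the total within \<theta> n.\<close>

lemma step_upper:
  fixes \<theta> e :: real
  assumes m: "0 < m" and G: "\<And>i. i \<in> indices m \<Longrightarrow> 0 < G i" and \<theta>: "0 < \<theta>" and e: "0 < e"
  shows "\<forall>\<^sub>F n in sequentially. \<exists>A. finite A \<and> A \<noteq> {} \<and> real (card A) \<le> \<theta> * n \<and>
    cost (rate n) (step m G) A \<le> step_value \<theta> m G + e"
proof -
  define w where "w = (1 / real m) ^ CARD('d)"
  have w: "0 < w" using m by (simp add: w_def)
  define \<nu> where "\<nu> i = (\<theta> * share m G i) powr (- 1 / CARD('d))" for i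
  have a: "0 < share m G i" if "i \<in> indices m" for i using share_pos m G that by blast
  have \<nu>: "0 < \<nu> i" if "i \<in> indices m" for i using a[OF that] \<theta> by (simp add: \<nu>_def)
  define X where "X = (\<Sum>i\<in>indices m. w * G i * \<nu> i powr r)"
  have X: "0 \<le> X" unfolding X_def using w G by (intro sum_nonneg) (simp add: less_imp_le)
  \<comment> \<open>In the limit the slack e' of the uniform codebooks enters the total cost with
    weight X.\<close>
  define e' where "e' = e / (2 * (X + 1))"
  have e': "0 < e'" "e' * X < e" using X e mult_nonneg_nonneg[of X e] by (auto simp: e'_def field_simps add_nonneg_pos)
  define b where "b i = \<theta> * share m G i * w" for i
  have b: "0 < b i" if "i \<in> indices m" for i using a[OF that] \<theta> w by (simp add: b_def)
  define M where "M i n = nat \<lfloor>b i * real n\<rfloor>" for i n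
  \<comment> \<open>Quotient of the scale in force on cell i, once blown up to the unit cube, and
    the scale natural for its number of points. Its limit \<open>\<nu> i\<close> is the local
    density to the power -1/d.\<close>
  define \<mu> where "\<mu> i n = rate n * (1 / m) / real (M i n) powr (1 / CARD('d))" for i n
  have bn: "filterlim (\<lambda>n. b i * real n) at_top sequentially" if "i \<in> indices m" for i
    using b[OF that] by (rule filterlim_tendsto_pos_mult_at_top[OF tendsto_const _ filterlim_real_sequentially])
  have Mtop: "filterlim (M i) at_top sequentially" if "i \<in> indices m" for i
    unfolding M_def
    by (rule filterlim_compose[OF filterlim_nat_sequentially filterlim_compose[OF filterlim_floor_sequentially bn[OF that]]])
  have \<mu>lim: "\<mu> i \<longlonglongrightarrow> \<nu> i" if i: "i \<in> indices m" for i
  proof -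
    have "(\<lambda>n. b i * real n / real (nat \<lfloor>b i * real n\<rfloor>)) \<longlonglongrightarrow> 1"
      by (rule filterlim_compose[OF tendsto_div_floor bn[OF i]])
    then have "(\<lambda>n. (1 / b i * (b i * real n / real (M i n))) powr (1 / CARD('d)) * (1 / m))
        \<longlonglongrightarrow> (1 / b i * 1) powr (1 / CARD('d)) * (1 / m)"
      unfolding M_def using b[OF i] by (intro tendsto_intros) auto
    moreover have "(1 / b i * (b i * real n / real (M i n))) powr (1 / CARD('d)) * (1 / m) = \<mu> i n" for n
      using b[OF i] by (simp add: \<mu>_def rate_def powr_divide)
    moreover have "(1 / b i * 1) powr (1 / CARD('d)) * (1 / m) = \<nu> i"
    proof -
      have "w powr (1 / CARD('d)) = 1 / m"
        using m by (simp add: w_def powr_powr flip: powr_realpow)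
      then show ?thesis using \<theta> a[OF i] w m
        by (simp add: b_def \<nu>_def powr_divide powr_mult powr_minus_divide)
    qed
    ultimately show ?thesis by simp
  qed
  define E where "E i n = \<mu> i n powr r * (phi r C + e') + phi r (\<mu> i n)" for i n
  have Elim: "E i \<longlonglongrightarrow> phi r (C * \<nu> i) + e' * \<nu> i powr r" if i: "i \<in> indices m" for i
  proof -
    have "E i \<longlonglongrightarrow> \<nu> i powr r * (phi r C + e') + phi r (\<nu> i)"
      unfolding E_def using \<nu>[OF i]
      by (intro tendsto_intros \<mu>lim[OF i] isCont_tendsto_compose[OF phi_isCont]) auto
    also have "\<nu> i powr r * (phi r C + e') + phi r (\<nu> i) = phi r (C * \<nu> i) + e' * \<nu> i powr r"
      using phi_scale[of "\<nu> i" C r] \<nu>[OF i] C_pos by (simp add: algebra_simps)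
    finally show ?thesis .
  qed
  have "(\<lambda>n. \<Sum>i\<in>indices m. w * G i * E i n)
      \<longlonglongrightarrow> (\<Sum>i\<in>indices m. w * G i * (phi r (C * \<nu> i) + e' * \<nu> i powr r))"
    by (intro tendsto_intros Elim)
  also have "(\<Sum>i\<in>indices m. w * G i * (phi r (C * \<nu> i) + e' * \<nu> i powr r))
      = step_value \<theta> m G + e' * X"
    by (simp add: step_value_def X_def w_def \<nu>_def sum_distrib_left sum.distrib distrib_left mult_ac)
  finally have "\<forall>\<^sub>F n in sequentially. (\<Sum>i\<in>indices m. w * G i * E i n) < step_value \<theta> m G + e"
    using e' by (intro order_tendstoD(2)) auto
  moreover have "\<forall>\<^sub>F n in sequentially. \<forall>i\<in>indices m. 1 \<le> M i n \<and>
      (\<exists>A. finite A \<and> A \<noteq> {} \<and> card A \<le> M i n \<and>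
        (\<integral>x. phi r (real (M i n) powr (1 / CARD('d)) * dist_set N x A) \<partial>U) \<le> phi r C + e')"
  proof (intro eventually_ball_finite ballI eventually_conj)
    fix i assume i: "i \<in> indices m"
    show "\<forall>\<^sub>F n in sequentially. 1 \<le> M i n"
      using Mtop[OF i] by (simp add: filterlim_at_top)
    show "\<forall>\<^sub>F n in sequentially. \<exists>A. finite A \<and> A \<noteq> {} \<and> card A \<le> M i n \<and>
        (\<integral>x. phi r (real (M i n) powr (1 / CARD('d)) * dist_set N x A) \<partial>U) \<le> phi r C + e'"
      using uniform_near_optimal[OF e'(1)] Mtop[OF i] by (rule eventually_compose_filterlim)
  qed simp
  ultimately show ?thesis using eventually_gt_at_top[of 0]
  proof eventually_elim
    case (elim n)
    obtain B where B: "\<And>i. i \<in> indices m \<Longrightarrow> finite (B i)" "\<And>i. i \<in> indices m \<Longrightarrow> B i \<noteq> {}"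
      "\<And>i. i \<in> indices m \<Longrightarrow> card (B i) \<le> M i n"
      "\<And>i. i \<in> indices m \<Longrightarrow> (\<integral>x. phi r (real (M i n) powr (1 / CARD('d)) * dist_set N x (B i)) \<partial>U) \<le> phi r C + e'"
      using elim(2) by metis
    define A where "A = (\<Union>i\<in>indices m. (\<lambda>y. corner m i + (1 / m) *\<^sub>R y) ` B i)"
    have A: "finite A" "A \<noteq> {}" "card A \<le> (\<Sum>i\<in>indices m. card (B i))"
      "cost (rate n) (step m G) A
        \<le> (\<Sum>i\<in>indices m. w * G i * (\<integral>y. phi r (rate n * (1 / m) * dist_set N y (B i)) \<partial>U))"
      unfolding A_def w_def using cost_cells_le[of m "rate n" G B] m rate_pos[OF elim(3)] G B
      by (auto simp: less_imp_le)
    have "real (card A) \<le> (\<Sum>i\<in>indices m. real (M i n))"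
      using order_trans[OF A(3) sum_mono[of "indices m" "\<lambda>i. card (B i)" "\<lambda>i. M i n", OF B(3)]]
      by (simp flip: of_nat_sum)
    also have "\<dots> \<le> (\<Sum>i\<in>indices m. \<theta> * n * (w * share m G i))"
    proof (intro sum_mono)
      fix i assume "i \<in> indices m"
      then have "0 \<le> b i * n" using b by (simp add: less_imp_le)
      then have "real (M i n) \<le> b i * n" unfolding M_def by simp
      then show "real (M i n) \<le> \<theta> * n * (w * share m G i)" by (simp add: b_def mult_ac)
    qed
    also have "\<dots> = \<theta> * n"
      using sum_share[OF m G] by (simp add: w_def flip: sum_distrib_left)
    finally have "real (card A) \<le> \<theta> * n" .
    moreover have "cost (rate n) (step m G) A \<le> (\<Sum>i\<in>indices m. w * G i * E i n)"
    proof (rule order_trans[OF A(4)], intro sum_mono mult_left_mono)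
      fix i assume i: "i \<in> indices m"
      have M: "0 < real (M i n) powr (1 / CARD('d))" using elim(2) i by force
      then have \<mu>: "0 < \<mu> i n" using rate_pos[OF elim(3)] m by (simp add: \<mu>_def)
      have eq: "rate n * (1 / m) = \<mu> i n * real (M i n) powr (1 / CARD('d))"
        using M by (simp add: \<mu>_def)
      have "(\<integral>y. phi r (rate n * (1 / m) * dist_set N y (B i)) \<partial>U)
          = \<mu> i n powr r * (\<integral>x. phi r (real (M i n) powr (1 / CARD('d)) * dist_set N x (B i)) \<partial>U) + phi r (\<mu> i n)"
        unfolding eq by (rule integral_phi_scale[OF B(1)[OF i] B(2)[OF i] \<mu> M])
      also have "\<dots> \<le> E i n"
        unfolding E_def using B(4)[OF i] by (intro add_right_mono mult_left_mono) auto
      finally show "(\<integral>y. phi r (rate n * (1 / m) * dist_set N y (B i)) \<partial>U) \<le> E i n" .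
      show "0 \<le> w * G i" using w G[OF i] by simp
    qed
    ultimately show ?case using A elim(1) by (intro exI[of _ A]) auto
  qed
qed

section \<open>Lower bound for step functions\<close>

text \<open>Points outside a cell do not matter for the inner part of the cell once the codebook is
  \<open>\<rho>\<close>-dense for a sufficiently small fixed \<open>\<rho>\<close>.\<close>

definition inner :: "nat \<Rightarrow> real \<Rightarrow> ('d \<Rightarrow> nat) \<Rightarrow> (real^'d) set" where
  "inner m b i = cell (corner m i + (\<chi> j. (1 - b) / (2 * real m))) (b / m)"

lemma inner_subset:
  assumes "0 < m" "0 < b" "b < 1"
  shows "inner m b i \<subseteq> cell (corner m i) (1 / m)"
proof
  fix x assume "x \<in> inner m b i"
  then have x: "corner m i $ j + (1 - b) / (2 * real m) < x $ j"
    "x $ j \<le> corner m i $ j + (1 - b) / (2 * real m) + b / m" for j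
    using assms by (auto simp: inner_def mem_cell)
  have "0 < (1 - b) / (2 * real m)" "(1 - b) / (2 * real m) + b / m < 1 / m"
    using assms by (auto simp: field_simps)
  then have "corner m i $ j < x $ j \<and> x $ j \<le> corner m i $ j + 1 / m" for j
    using x[of j] by linarith
  then show "x \<in> cell (corner m i) (1 / m)" using assms by (simp add: mem_cell)
qed

text \<open>In some coordinate, a point outside the cell differs from x by at least (1-b)/(2m), so
  its N-distance from x is at least k (1-b)/(2m). A nearest code point closer than that must lie in
  the same cell.\<close>

lemma inner_dist:
  assumes m: "0 < m" and b: "0 < b" "b < 1" and k: "0 < k" "\<And>x. k * norm x \<le> N x"
    and A: "finite A" "A \<noteq> {}" and x: "x \<in> inner m b i"
    and near: "dist_set N x A < k * ((1 - b) / (2 * real m))"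
  shows "A \<inter> cell (corner m i) (1 / m) \<noteq> {}"
    and "dist_set N x (A \<inter> cell (corner m i) (1 / m)) = dist_set N x A"
proof -
  obtain a where a: "a \<in> A" "dist_set N x A = N (x - a)" using dist_set_attained[OF A] .
  have xi: "corner m i $ j + (1 - b) / (2 * real m) < x $ j"
    "x $ j \<le> corner m i $ j + (1 - b) / (2 * real m) + b / m" for j
    using x m b by (auto simp: inner_def mem_cell)
  have "a \<in> cell (corner m i) (1 / m)"
  proof (rule ccontr)
    assume "a \<notin> cell (corner m i) (1 / m)"
    then obtain j where j: "a $ j \<le> corner m i $ j \<or> corner m i $ j + 1 / m < a $ j"
      using m by (auto simp: mem_cell not_less not_le)
    have "(1 - b) / (2 * real m) + b / m + (1 - b) / (2 * real m) = 1 / m" using m by (simp add: field_simps)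
    then have "(1 - b) / (2 * real m) \<le> \<bar>(x - a) $ j\<bar>" using j xi[of j] by auto
    also have "\<dots> \<le> norm (x - a)" by (rule component_le_norm_cart)
    finally have "k * ((1 - b) / (2 * real m)) \<le> k * norm (x - a)" using k by (intro mult_left_mono) auto
    also have "\<dots> \<le> N (x - a)" by (rule k)
    finally show False using near a by simp
  qed
  then have *: "a \<in> A \<inter> cell (corner m i) (1 / m)" using a by simp
  then show ne: "A \<inter> cell (corner m i) (1 / m) \<noteq> {}" by blast
  show "dist_set N x (A \<inter> cell (corner m i) (1 / m)) = dist_set N x A"
  proof (rule antisym)
    show "dist_set N x (A \<inter> cell (corner m i) (1 / m)) \<le> dist_set N x A"
      unfolding a(2) using A * by (intro dist_set_le) auto
    show "dist_set N x A \<le> dist_set N x (A \<inter> cell (corner m i) (1 / m))"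
      using A ne by (intro dist_set_antimono) auto
  qed
qed

text \<open>Blowing the inner cube up to the unit cube turns A into a codebook for the uniform
  distribution at scale \<tau> b/m. The infimum property of C allows code points outside the cube,
  so A may lie anywhere.\<close>

lemma inner_cost_ge:
  assumes m: "0 < m" and b: "0 < b" "b < 1" and i: "i \<in> indices m"
    and A: "finite A" "A \<noteq> {}" and \<tau>: "0 < \<tau>"
  shows "(b / m) ^ CARD('d) * phi r (C * (\<tau> * (b / m) / real (card A) powr (1 / CARD('d))))
    \<le> (\<integral>x. indicator (inner m b i) x * phi r (\<tau> * dist_set N x A) \<partial>U)"
proof -
  define c where "c = corner m i + (\<chi> j. (1 - b) / (2 * real m))"
  define B where "B = (\<lambda>x. (1 / (b / m)) *\<^sub>R (x - c)) ` A"
  have bm: "0 < b / m" using b m by simp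
  have B: "finite B" "B \<noteq> {}" "card B = card A"
    unfolding B_def using A bm by (auto intro!: card_image inj_onI)
  have AB: "A = (\<lambda>y. c + (b / m) *\<^sub>R y) ` B"
    unfolding B_def using bm by (auto simp: image_image)
  have sub: "cell c (b / m) \<subseteq> unit_cube"
    using inner_subset[OF m b, of i] cell_corner_subset[OF m i] by (auto simp: inner_def c_def)
  have "(\<integral>x. indicator (inner m b i) x * phi r (\<tau> * dist_set N x A) \<partial>U)
      = (b / m) ^ CARD('d) * (\<integral>y. phi r (\<tau> * (b / m) * dist_set N y B) \<partial>U)"
    unfolding inner_def c_def[symmetric]
    by (subst AB) (rule integral_phi_cell[OF B(1,2) \<tau> bm sub])
  moreover have "phi r (C * (\<tau> * (b / m) / real (card A) powr (1 / CARD('d))))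
      \<le> (\<integral>y. phi r (\<tau> * (b / m) * dist_set N y B) \<partial>U)"
    using uniform_cost_ge[OF B(1,2) mult_pos_pos[OF \<tau> bm]] unfolding B(3) .
  ultimately show ?thesis using bm by (simp add: mult_left_mono)
qed

definition multiplier :: "real \<Rightarrow> nat \<Rightarrow> (('d \<Rightarrow> nat) \<Rightarrow> real) \<Rightarrow> real" where
  "multiplier \<theta> m G = C powr r * \<theta> powr (- (r + real CARD('d)) / real CARD('d))
    * (\<Sum>j\<in>indices m. (1 / m) ^ CARD('d) * G j powr cexp) powr ((r + real CARD('d)) / real CARD('d)) / real CARD('d)"

lemma multiplier_nonneg: "0 \<le> multiplier \<theta> m G"
  by (simp add: multiplier_def)

text \<open>\<^const>\<open>multiplier\<close> is the Lagrange multiplier of the optimal allocation: at the optimal local density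
  \<open>\<rho> = \<theta> * share m G i\<close>, the derivative of \<open>G i * \<phi>(C \<rho>\<^bsup>-1/d\<^esup>)\<close> in \<open>\<rho>\<close> is its negative, for every cell \<open>i\<close>.\<close>

lemma inner_sum_ge:
  fixes \<theta> \<kappa> :: real
  assumes m: "0 < m" and G: "\<And>i. i \<in> indices m \<Longrightarrow> 0 < G i" and \<theta>: "0 < \<theta>"
    and b: "0 < b" "b < 1" and n: "0 < n" and A: "finite A"
    and ne: "\<And>i. i \<in> indices m \<Longrightarrow> A \<inter> cell (corner m i) (1 / m) \<noteq> {}"
    and cA: "real (card A) \<le> \<theta> * n + \<kappa>"
  shows "b ^ CARD('d) * step_value \<theta> m G - multiplier \<theta> m G * (\<kappa> / n + \<theta> * (1 - b ^ CARD('d)))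
    \<le> (\<Sum>i\<in>indices m. G i *
      (\<integral>x. indicator (inner m b i) x * phi r (rate n * dist_set N x (A \<inter> cell (corner m i) (1 / m))) \<partial>U))"
proof -
  let ?d = "real CARD('d)"
  let ?c = "\<lambda>i. cell (corner m i) (1 / m)"
  define \<tau> where "\<tau> = rate n"
  have \<tau>: "0 < \<tau>" "\<tau> ^ CARD('d) = n" using n rate_pos rate_power by (auto simp: \<tau>_def)
  let ?p = "\<lambda>i x. indicator (inner m b i) x * phi r (\<tau> * dist_set N x (A \<inter> ?c i))"
  define w where "w = (1 / real m) ^ CARD('d)"
  have w: "0 < w" using m by (simp add: w_def)
  have a: "0 < share m G i" if "i \<in> indices m" for i using share_pos m G that by blast
  define L where "L = step_value \<theta> m G"
  define S where "S = (\<Sum>j\<in>indices m. w * G j powr cexp)"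
  have S: "0 < S" unfolding S_def using w G indices_nonempty[OF m]
    by (intro sum_pos mult_pos_pos) force+
  \<comment> \<open>The common value of \<open>G i * c i powr (r + d)\<close> over all cells, which
    expresses stationarity of the optimal allocation.\<close>
  define \<Lambda> where "\<Lambda> = C powr (r + ?d) * \<theta> powr (- (r + ?d) / ?d) * S powr ((r + ?d) / ?d)"
  define Z where "Z = multiplier \<theta> m G"
  have Z: "0 \<le> Z" by (simp add: Z_def multiplier_nonneg)
  have Z_eq: "Z = \<Lambda> / ?d * C powr (- ?d)"
  proof -
    have "C powr r = C powr (r + ?d) * C powr (- ?d)" using C_pos by (simp flip: powr_add)
    then show ?thesis unfolding Z_def multiplier_def \<Lambda>_def S_def w_def by simp
  qed
  have bm: "0 < b / m" using b m by simp
  have Ai: "finite (A \<inter> ?c i)" "A \<inter> ?c i \<noteq> {}" if "i \<in> indices m" for i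
    using A ne[OF that] by auto
  define n' where "n' i = real (card (A \<inter> ?c i))" for i
  have n': "0 < n' i" if "i \<in> indices m" for i
    using Ai[OF that] by (simp add: n'_def card_gt_0_iff)
  \<comment> \<open>\<open>t i\<close> is C \<rho>^(-1/d) for the actual number \<open>n' i\<close>
    of code points relative to the volume of the inner cube, and \<open>c i\<close> is the same for
    the optimal density. Raised to the power -d, both become linear in the densities.\<close>
  define t where "t i = C * (\<tau> * (b / m) / n' i powr (1 / ?d))" for i
  define c where "c i = C * (\<theta> * share m G i) powr (- 1 / ?d)" for i
  have t: "0 < t i" "t i powr (- ?d) = C powr (- ?d) * (n' i / (n * b ^ CARD('d) * w))"
    if i: "i \<in> indices m" for i
  proof -
    show "0 < t i" unfolding t_def using n'[OF i] C_pos \<tau>(1) b(1) m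
      by (intro mult_pos_pos divide_pos_pos) auto
    have "(\<tau> * (b / m)) powr (- ?d) = 1 / (n * b ^ CARD('d) * w)"
    proof -
      have "(\<tau> * (b / m)) powr ?d = n * b ^ CARD('d) * w"
        using \<tau>(2) powr_realpow[OF mult_pos_pos[OF \<tau>(1) bm], of "CARD('d)"]
        by (simp only: power_mult_distrib power_divide w_def) simp
      then show ?thesis by (simp add: powr_minus_divide)
    qed
    moreover have "(n' i powr (1 / ?d)) powr (- ?d) = 1 / n' i"
      using n'[OF i] by (simp add: powr_powr powr_minus_divide)
    ultimately show "t i powr (- ?d) = C powr (- ?d) * (n' i / (n * b ^ CARD('d) * w))"
      using n'[OF i] C_pos \<tau>(1) bm
      unfolding t_def powr_mult powr_divide[of "\<tau> * (b / m)"] by simp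
  qed
  have c: "0 < c i" "c i powr (- ?d) = C powr (- ?d) * (\<theta> * share m G i)"
    "G i * c i powr (r + ?d) = \<Lambda>" if i: "i \<in> indices m" for i
  proof -
    show "0 < c i" using a[OF i] C_pos \<theta> by (simp add: c_def)
    show "c i powr (- ?d) = C powr (- ?d) * (\<theta> * share m G i)"
      using a[OF i] C_pos \<theta> by (simp add: c_def powr_mult powr_powr)
    have sh: "share m G i = G i powr cexp / S" by (simp add: share_def S_def w_def)
    have ce: "cexp * ((r + ?d) / ?d) = 1" using r_gt by (simp add: cexp_def add.commute)
    have "c i powr (r + ?d) = C powr (r + ?d) * (\<theta> * share m G i) powr (- (r + ?d) / ?d)"
    proof -
      have ex: "- 1 / ?d * (r + ?d) = - (r + ?d) / ?d" by (simp add: field_simps)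
      show ?thesis by (simp only: c_def powr_mult[of C] powr_powr ex)
    qed
    also have "\<dots> = C powr (r + ?d) * \<theta> powr (- (r + ?d) / ?d) * share m G i powr (- ((r + ?d) / ?d))"
      by (simp only: powr_mult minus_divide_left mult.assoc)
    also have "share m G i powr (- ((r + ?d) / ?d)) = S powr ((r + ?d) / ?d) / G i"
    proof -
      have "share m G i powr ((r + ?d) / ?d) = (G i powr cexp) powr ((r + ?d) / ?d) / S powr ((r + ?d) / ?d)"
        using S by (simp add: sh powr_divide)
      also have "(G i powr cexp) powr ((r + ?d) / ?d) = G i"
        unfolding powr_powr ce using G[OF i] by simp
      finally show ?thesis by (simp add: powr_minus_divide)
    qed
    finally show "G i * c i powr (r + ?d) = \<Lambda>" using G[OF i] by (simp add: \<Lambda>_def)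
  qed
  let ?bd = "b ^ CARD('d)"
  let ?tan = "\<lambda>i. phi r (c i) + c i powr (r + ?d) / (- ?d) * (t i powr (- ?d) - c i powr (- ?d))"
  have bd: "0 < ?bd" using b by simp
  \<comment> \<open>All tangents, weighted by \<open>G i\<close>, have the same slope, so the
    numbers of code points in the cells enter their sum only through the total, which is at most
    \<theta> n + \<kappa>. Since the multiplier is nonnegative, this total may be replaced by its
    bound.\<close>
  have "?bd * L - Z * (\<kappa> / n + \<theta> * (1 - ?bd))
      \<le> ?bd * L - Z * ((\<Sum>i\<in>indices m. n' i) / n - ?bd * \<theta>)"
  proof -
    have "(\<Sum>i\<in>indices m. n' i) \<le> real (card A)"
      using sum_card_cells_le[OF m A] by (simp add: n'_def flip: of_nat_sum)
    then have "(\<Sum>i\<in>indices m. n' i) / n \<le> (\<theta> * n + \<kappa>) / n"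
      using cA by (intro divide_right_mono) auto
    also have "\<dots> = \<theta> + \<kappa> / n" using n by (simp add: add_divide_distrib)
    finally have "(\<Sum>i\<in>indices m. n' i) / n - ?bd * \<theta> \<le> \<kappa> / n + \<theta> * (1 - ?bd)"
      by (simp add: algebra_simps)
    then show ?thesis using Z by (intro diff_left_mono mult_left_mono)
  qed
  also have "\<dots> = (\<Sum>i\<in>indices m. G i * (?bd * w * ?tan i))"
  proof -
    have "G i * (?bd * w * ?tan i)
        = ?bd * (w * G i * phi r (c i)) - Z * (n' i / n) + Z * (?bd * \<theta>) * (w * share m G i)"
      if i: "i \<in> indices m" for i
    proof -
      have "G i * (?bd * w * ?tan i)
        = ?bd * (w * G i * phi r (c i)) - ?bd * w * ((G i * c i powr (r + ?d)) / ?d) * (t i powr (- ?d) - c i powr (- ?d))"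
        by (simp add: field_simps)
      also have "\<dots> = ?bd * (w * G i * phi r (c i)) - ?bd * w * Z * (n' i / (n * ?bd * w) - \<theta> * share m G i)"
        unfolding c(2,3)[OF i] t(2)[OF i] Z_eq by (simp add: algebra_simps)
      also have "\<dots> = ?bd * (w * G i * phi r (c i)) - Z * (n' i / n) + Z * (?bd * \<theta>) * (w * share m G i)"
        using bd b(1) w n by (simp add: field_simps)
      finally show ?thesis .
    qed
    then have "(\<Sum>i\<in>indices m. G i * (?bd * w * ?tan i))
      = (\<Sum>i\<in>indices m. ?bd * (w * G i * phi r (c i)) - Z * (n' i / n) + Z * (?bd * \<theta>) * (w * share m G i))"
      by (intro sum.cong refl)
    also have "\<dots> = ?bd * L - Z * ((\<Sum>i\<in>indices m. n' i) / n) + Z * (?bd * \<theta>) * (\<Sum>i\<in>indices m. w * share m G i)"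
      unfolding L_def step_value_def c_def w_def
      by (simp only: sum.distrib sum_subtractf sum_distrib_left sum_divide_distrib)
    also have "(\<Sum>i\<in>indices m. w * share m G i) = 1"
      unfolding w_def by (rule sum_share[OF m G])
    finally show ?thesis by (simp add: algebra_simps)
  qed
  also have "\<dots> \<le> (\<Sum>i\<in>indices m. G i * (\<integral>x. ?p i x \<partial>U))"
  proof (intro sum_mono mult_left_mono)
    fix i assume i: "i \<in> indices m"
    have "?tan i \<le> phi r (t i)"
      using phi_tangent[of "- ?d" r "c i" "t i"] r_gt c(1)[OF i] t(1)[OF i] by simp
    then have "?bd * w * ?tan i \<le> ?bd * w * phi r (t i)"
      using bd w by (intro mult_left_mono) auto
    also have "\<dots> = (b / m) ^ CARD('d) * phi r (t i)" by (simp add: w_def power_divide)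
    also have "\<dots> \<le> (\<integral>x. ?p i x \<partial>U)"
      unfolding t_def n'_def by (rule inner_cost_ge[OF m b(1,2) i Ai[OF i] \<tau>(1)])
    finally show "?bd * w * ?tan i \<le> (\<integral>x. ?p i x \<partial>U)" .
  qed (use G in \<open>simp add: less_imp_le\<close>)
  finally show ?thesis unfolding L_def Z_def \<tau>_def .
qed

text \<open>Enlarging a codebook only lowers its cost, so the dense set F may be added before
  estimating. The inner cubes then give the Lagrange bound with \<kappa> = card F, and the rest of
  the cube, of volume 1 - b^d, contributes no less than a small negative amount.\<close>

lemma step_lower:
  fixes \<theta> e :: real
  assumes m: "0 < m" and G: "\<And>i. i \<in> indices m \<Longrightarrow> 0 < G i" and \<theta>: "0 < \<theta>" and e: "0 < e"
  shows "\<forall>\<^sub>F n in sequentially. \<forall>A. finite A \<longrightarrow> A \<noteq> {} \<longrightarrow> real (card A) \<le> \<theta> * n \<longrightarrow>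
    step_value \<theta> m G - e \<le> cost (rate n) (step m G) A"
proof -
  interpret U: prob_space U by (rule prob_space_U)
  let ?d = "real CARD('d)"
  define w where "w = (1 / real m) ^ CARD('d)"
  have w: "0 < w" using m by (simp add: w_def)
  define Gm where "Gm = Max (G ` indices m)"
  have Gm: "G i \<le> Gm" if "i \<in> indices m" for i unfolding Gm_def using that by simp
  have Gm0: "0 < Gm" using G Gm indices_nonempty[OF m] by (meson ex_in_conv less_le_trans)
  obtain q where q: "admissible ?d r q" using ex_admissible .
  then have q1: "1 \<le> q" by (simp add: admissible_def)
  obtain p where p: "- ?d < p" "p < 0" "\<And>\<eta>. 0 < \<eta> \<Longrightarrow> \<exists>K\<ge>0. \<forall>t>0. t \<le> 1 \<longrightarrow>
      (\<forall>y\<ge>0. \<bar>phi r t\<bar> * y \<le> \<eta> * t powr p + K * (y + y powr q))"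
    using phi_mult_bound[OF d_pos r_gt q] zero_less_one by meson
  obtain I where I: "0 \<le> I"
    "\<And>A \<tau>. finite A \<Longrightarrow> A \<noteq> {} \<Longrightarrow> 0 < \<tau> \<Longrightarrow> integrable U (\<lambda>x. (\<tau> * dist_set N x A) powr p)"
    "\<And>A \<tau>. finite A \<Longrightarrow> A \<noteq> {} \<Longrightarrow> 0 < \<tau> \<Longrightarrow>
      (\<integral>x. (\<tau> * dist_set N x A) powr p \<partial>U) \<le> real (card A) / \<tau> ^ CARD('d) * I + 1"
    by (rule dist_powr_moment[OF p(1,2)]) blast
  define L where "L = step_value \<theta> m G"
  define Z where "Z = multiplier \<theta> m G"
  have Z: "0 \<le> Z" by (simp add: Z_def multiplier_nonneg)
  define \<eta> where "\<eta> = e / (4 * ((\<theta> + 1) * I + 1))"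
  have den: "0 < (\<theta> + 1) * I + 1" using \<theta> I by (intro add_nonneg_pos) auto
  then have \<eta>: "0 < \<eta>" "\<eta> * ((\<theta> + 1) * I + 1) = e / 4"
  proof -
    have "e / (4 * x) * x = e / 4" if "0 < x" for x :: real using that by simp
    then show "\<eta> * ((\<theta> + 1) * I + 1) = e / 4" unfolding \<eta>_def using den by blast
  qed (use e in \<open>simp add: \<eta>_def\<close>)
  obtain K where K: "0 \<le> K" "\<forall>t>0. t \<le> 1 \<longrightarrow>
      (\<forall>y\<ge>0. \<bar>phi r t\<bar> * y \<le> \<eta> * t powr p + K * (y + y powr q))"
    using p(3)[OF \<eta>(1)] by auto
  define D where "D = Gm + Gm powr q"
  have D: "0 < D" using Gm0 by (simp add: D_def add_pos_nonneg)
  \<comment> \<open>The coefficient of 1 - b^d in the final estimate: it collects the factor b^d at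
    L, the share of the multiplier term lost to the shrinking of the cells, and the cost of the
    layer. This total, the moment term and the contribution of F are each held below e/4.\<close>
  define Y where "Y = \<bar>L\<bar> + Z * \<theta> + K * D"
  have Y: "0 \<le> Y" using Z \<theta> K D by (simp add: Y_def)
  obtain b where b: "0 < b" "b < 1" "Y * (1 - b ^ CARD('d)) \<le> e / 4"
  proof -
    have "0 < e / (4 * (Y + 1))" using e Y by simp
    from power_near_one[OF this, of "CARD('d)"] obtain b :: real
      where b: "0 < b" "b < 1" "1 - b ^ CARD('d) \<le> e / (4 * (Y + 1))" by auto
    have "Y * (1 - b ^ CARD('d)) \<le> Y * (e / (4 * (Y + 1)))" using Y b(3) by (intro mult_left_mono) auto
    also have "\<dots> \<le> e / 4" using Y e by (simp add: field_simps)
    finally show ?thesis using b that by blast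
  qed
  obtain k where k: "0 < k" "\<And>x. k * norm x \<le> N x" by (rule norm_le_N) blast
  have "0 < k * ((1 - b) / (2 * real m))" using k b m by simp
  \<comment> \<open>F depends on m and b but not on n, so its share card F / n of the code points
    vanishes.\<close>
  then obtain F :: "(real^'d) set" where F: "finite F" "F \<noteq> {}"
    "\<And>x. x \<in> unit_cube \<Longrightarrow> dist_set N x F < k * ((1 - b) / (2 * real m))"
    by (rule finite_dense_set) blast
  have "(\<lambda>n. Z * real (card F) * inverse (real n)) \<longlonglongrightarrow> Z * real (card F) * 0"
    by (intro tendsto_intros lim_inverse_n)
  then have ev: "\<forall>\<^sub>F n in sequentially. Z * real (card F) * inverse (real n) < e / 4"
    using e by (intro order_tendstoD(2)) auto
  show ?thesis using ev eventually_ge_at_top[of "card F"] eventually_gt_at_top[of 0]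
  proof eventually_elim
    case (elim n)
    define \<tau> where "\<tau> = rate n"
    have \<tau>: "0 < \<tau>" "\<tau> ^ CARD('d) = n" using elim rate_pos rate_power by (auto simp: \<tau>_def)
    show ?case
    proof (intro allI impI)
      fix A0 :: "(real^'d) set"
      assume A0: "finite A0" "A0 \<noteq> {}" and cA0: "real (card A0) \<le> \<theta> * n"
      define A where "A = A0 \<union> F"
      have A: "finite A" "A \<noteq> {}" using A0 F by (auto simp: A_def)
      have cA: "real (card A) \<le> \<theta> * n + card F"
        using card_Un_le[of A0 F] cA0 by (simp add: A_def)
      let ?c = "\<lambda>i. cell (corner m i) (1 / m)"
      let ?p = "\<lambda>i x. indicator (inner m b i) x * phi r (\<tau> * dist_set N x (A \<inter> ?c i))"
      have near: "dist_set N x A < k * ((1 - b) / (2 * real m))" if "x \<in> unit_cube" for x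
        using dist_set_antimono[of A F x] A F that by (force simp: A_def)
      have bm: "0 < b / m" using b m by simp
      have Ai: "finite (A \<inter> ?c i)" "A \<inter> ?c i \<noteq> {}" if i: "i \<in> indices m" for i
      proof -
        have "corner m i + (\<chi> j. (1 - b) / (2 * real m)) + (b / m) *\<^sub>R 1 \<in> inner m b i"
          unfolding inner_def cell_def by (intro imageI) (simp add: unit_cube_def)
        then obtain x where x: "x \<in> inner m b i" by blast
        then have "x \<in> unit_cube"
          using subsetD[OF inner_subset[OF m b(1,2), of i]] subsetD[OF cell_corner_subset[OF m i]] by simp
        then show "A \<inter> ?c i \<noteq> {}" by (rule inner_dist(1)[OF m b(1,2) k A x near])
      qed (use A in simp)
      define y where "y x = step m G x * indicator (- (\<Union>i\<in>indices m. inner m b i)) x" for x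
      have innerb [measurable]: "inner m b i \<in> sets borel" for i
        unfolding inner_def using bm by (rule cell_borel)
      have stepb [measurable]: "step m G \<in> borel_measurable borel" by (rule step_measurable[OF m])
      have step_bd: "0 < step m G x" "step m G x \<le> Gm" if "x \<in> unit_cube" for x
        using that G Gm index_of_eq(1)[OF m] by (auto simp: step_eq[OF m])
      have stepint: "integrable U (\<lambda>x. phi r (\<tau> * dist_set N x B) * step m G x)"
        if "finite B" "B \<noteq> {}" for B
        using that \<tau> step_bd AE_U_cube
        by (intro phi_dist_integrable_bounded[where M = Gm])
           (auto intro!: borel_measurable_U elim!: eventually_mono simp: less_imp_le)
      have "cost \<tau> (step m G) A \<le> cost \<tau> (step m G) A0"
        using A A0 \<tau> stepint step_bd AE_U_cube
        by (intro cost_mono) (auto simp: A_def elim!: eventually_mono intro: less_imp_le)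
      moreover
      let ?P = "\<lambda>x. \<Sum>i\<in>indices m. G i * ?p i x"
      have mom: "integrable U (\<lambda>x. (\<tau> * dist_set N x A) powr p)"
        "(\<integral>x. (\<tau> * dist_set N x A) powr p \<partial>U) \<le> (\<theta> + 1) * I + 1"
      proof -
        show "integrable U (\<lambda>x. (\<tau> * dist_set N x A) powr p)" by (rule I(2)[OF A \<tau>(1)])
        have "(\<integral>x. (\<tau> * dist_set N x A) powr p \<partial>U) \<le> real (card A) / n * I + 1"
          using I(3)[OF A \<tau>(1)] unfolding \<tau>(2) .
        also have "\<dots> \<le> (\<theta> + 1) * I + 1"
        proof -
          have "real (card A) \<le> (\<theta> + 1) * n" using cA elim(2) by (simp add: algebra_simps)
          then have "real (card A) / n \<le> \<theta> + 1" using elim(3) by (simp add: field_simps)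
          then show ?thesis using I by (intro add_right_mono mult_right_mono) auto
        qed
        finally show "(\<integral>x. (\<tau> * dist_set N x A) powr p \<partial>U) \<le> (\<theta> + 1) * I + 1" .
      qed
      have Pint: "integrable U (\<lambda>x. G i * ?p i x)"
        if "i \<in> indices m" for i
        unfolding inner_def by (intro integrable_mult_right phi_cell_integrable Ai[OF that] \<tau> bm)
      have y: "0 \<le> y x" "y x \<le> Gm" if "x \<in> unit_cube" for x
        using step_bd[OF that] Gm0 by (auto simp: y_def indicator_def less_imp_le)
      \<comment> \<open>The layer left by the inner cubes, where the nearest code point may belong
        to another cell. There the cost is only bounded from below, by the one-sided moment
        inequality.\<close>
      let ?O = "- (\<Union>i\<in>indices m. inner m b i)"
      let ?err = "\<lambda>x. \<eta> * (\<tau> * dist_set N x A) powr p + K * (D * indicator ?O x)"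
      have yD: "y x + y x powr q \<le> D * indicator ?O x" if "x \<in> unit_cube" for x
        using step_bd[OF that] q1 Gm0
        by (auto simp: y_def D_def indicator_def intro!: add_mono powr_mono2)
      have Obor [measurable]: "?O \<in> sets borel" by (intro borel_comp sets.finite_UN) auto
      have Oint: "integrable U (indicator ?O :: _ \<Rightarrow> real)"
        by (rule U.integrable_const_bound[of _ 1]) (auto intro!: borel_measurable_U)
      have volO: "(\<integral>x. indicator ?O x \<partial>U) = 1 - b ^ CARD('d)"
      proof -
        have ii: "integrable U (indicator (inner m b i) :: _ \<Rightarrow> real)" for i
          by (rule U.integrable_const_bound[of _ 1]) (auto intro!: borel_measurable_U)
        have vol_i: "(\<integral>x. indicator (inner m b i) x \<partial>U) = b ^ CARD('d) * w" if i: "i \<in> indices m" for i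
        proof -
          have "(\<integral>x. indicator (inner m b i) x * 1 \<partial>U) = (b / m) ^ CARD('d) * (\<integral>x. 1 \<partial>U)"
            unfolding inner_def using inner_subset[OF m b(1,2), of i] cell_corner_subset[OF m i]
            by (intro cell_integral bm) (auto simp: inner_def)
          then show ?thesis by (simp add: U.prob_space[unfolded space_U] w_def power_divide)
        qed
        have disj: "indicator ?O x = 1 - (\<Sum>i\<in>indices m. indicator (inner m b i) x :: real)" for x
        proof -
          have "(\<Sum>i\<in>indices m. indicator (inner m b i) x) = (indicator (\<Union>i\<in>indices m. inner m b i) x :: real)"
          proof (rule indicator_UN_disjoint[symmetric])
            show "disjoint_family_on (inner m b) (indices m)"
              unfolding disjoint_family_on_def
              using cells_disjoint[OF m] inner_subset[OF m b(1,2)] by blast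
          qed simp
          then show ?thesis by (simp add: indicator_def)
        qed
        have "(\<integral>x. indicator ?O x \<partial>U) = 1 - (\<Sum>i\<in>indices m. b ^ CARD('d) * w)"
          unfolding disj using ii vol_i
          by (subst Bochner_Integration.integral_diff) (auto simp: U.prob_space[unfolded space_U])
        then show ?thesis using m by (simp add: card_indices w_def power_one_over)
      qed
      have pt: "?P x - ?err x
          \<le> phi r (\<tau> * dist_set N x A) * step m G x"
        if x: "x \<in> unit_cube" and pos: "0 < dist_set N x A" for x
      proof (cases "x \<in> ?O")
        case True
        then have P0: "?P x = 0" by (intro sum.neutral) auto
        have "- (phi r (\<tau> * dist_set N x A) * y x) \<le> \<eta> * (\<tau> * dist_set N x A) powr p + K * (y x + y x powr q)"
          using \<tau> pos y[OF x] K(1) \<eta>(1) by (intro neg_phi_mult_bound[OF K(2)]) auto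
        also have "\<dots> \<le> ?err x"
          using yD[OF x] K by (intro add_left_mono mult_left_mono) auto
        finally show ?thesis using P0 True by (simp add: y_def)
      next
        case False
        then obtain i where i: "i \<in> indices m" "x \<in> inner m b i" by auto
        have xi: "x \<in> ?c i" using i inner_subset[OF m b(1,2), of i] by blast
        then have idx: "index_of m x = i" using index_of_eq(2)[OF m x] by simp
        have "?P x = (\<Sum>j\<in>indices m. if j = i then G i * phi r (\<tau> * dist_set N x (A \<inter> ?c i)) else 0)"
        proof (intro sum.cong refl)
          fix j assume "j \<in> indices m"
          have "x \<notin> inner m b j" if "j \<noteq> i"
            using that idx inner_subset[OF m b(1,2), of j] index_of_eq(2)[OF m x, of j] by auto
          then show "G j * ?p j x
              = (if j = i then G i * phi r (\<tau> * dist_set N x (A \<inter> ?c i)) else 0)"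
            using i by (simp add: indicator_def)
        qed
        also have "\<dots> = G i * phi r (\<tau> * dist_set N x (A \<inter> ?c i))" using i by simp
        also have "\<dots> = phi r (\<tau> * dist_set N x A) * step m G x"
          using inner_dist(2)[OF m b(1,2) k A i(2) near[OF x]] idx x m by (simp add: step_eq)
        finally have "?P x = phi r (\<tau> * dist_set N x A) * step m G x" .
        moreover have "0 \<le> ?err x"
          using \<eta> K D by (intro add_nonneg_nonneg mult_nonneg_nonneg) auto
        ultimately show ?thesis by linarith
      qed
      have "(\<integral>x. ?P x - ?err x \<partial>U) \<le> cost \<tau> (step m G) A"
        unfolding cost_def
      proof (rule integral_mono_AE)
        show "AE x in U. ?P x - ?err x
          \<le> phi r (\<tau> * dist_set N x A) * step m G x"
          using AE_dist_pos[OF A] AE_U_cube by eventually_elim (rule pt)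
        show "integrable U (\<lambda>x. ?P x - ?err x)"
          by (intro Bochner_Integration.integrable_diff Bochner_Integration.integrable_sum
              Bochner_Integration.integrable_add integrable_mult_right Pint mom Oint)
      qed (rule stepint[OF A])
      moreover have "(\<integral>x. ?P x - ?err x \<partial>U)
          = (\<Sum>i\<in>indices m. G i * (\<integral>x. ?p i x \<partial>U))
            - (\<eta> * (\<integral>x. (\<tau> * dist_set N x A) powr p \<partial>U) + K * (D * (1 - b ^ CARD('d))))"
      proof -
        have "(\<integral>x. ?P x \<partial>U) = (\<Sum>i\<in>indices m. G i * (\<integral>x. ?p i x \<partial>U))"
          by (subst Bochner_Integration.integral_sum[OF Pint]) (simp_all only: integral_mult_right_zero)
        moreover have "(\<integral>x. ?err x \<partial>U)
            = \<eta> * (\<integral>x. (\<tau> * dist_set N x A) powr p \<partial>U) + K * (D * (1 - b ^ CARD('d)))"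
          by (subst Bochner_Integration.integral_add)
             (simp_all only: integral_mult_right_zero volO integrable_mult_right mom(1) Oint)
        moreover have "(\<integral>x. ?P x - ?err x \<partial>U)
            = (\<integral>x. ?P x \<partial>U) - (\<integral>x. ?err x \<partial>U)"
          by (intro Bochner_Integration.integral_diff Bochner_Integration.integrable_sum
              Bochner_Integration.integrable_add integrable_mult_right Pint mom Oint)
        ultimately show ?thesis by simp
      qed
      moreover have "(\<Sum>i\<in>indices m. G i * (\<integral>x. ?p i x \<partial>U))
          \<ge> b ^ CARD('d) * L - Z * (real (card F) / n + \<theta> * (1 - b ^ CARD('d)))"
        unfolding L_def Z_def \<tau>_def by (rule inner_sum_ge[where G = G, OF m G \<theta> b(1,2) elim(3) A(1) Ai(2) cA])
      moreover have "\<eta> * (\<integral>x. (\<tau> * dist_set N x A) powr p \<partial>U) \<le> e / 4"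
        using mult_left_mono[OF mom(2), of \<eta>] \<eta> by simp
      moreover have "Z * (real (card F) / n) \<le> e / 4"
        using less_imp_le[OF elim(1)] unfolding divide_inverse mult.assoc .
      moreover have "Z * (real (card F) / n + \<theta> * (1 - b ^ CARD('d)))
          = Z * (real (card F) / n) + Z * (\<theta> * (1 - b ^ CARD('d)))"
        by (rule distrib_left)
      moreover have "L - \<bar>L\<bar> * (1 - b ^ CARD('d)) \<le> b ^ CARD('d) * L"
      proof -
        have "L * (1 - b ^ CARD('d)) \<le> \<bar>L\<bar> * (1 - b ^ CARD('d))"
          using b by (intro mult_right_mono) (auto intro: power_le_one)
        then show ?thesis by (simp add: algebra_simps)
      qed
      moreover have "\<bar>L\<bar> * (1 - b ^ CARD('d)) + Z * (\<theta> * (1 - b ^ CARD('d))) + K * (D * (1 - b ^ CARD('d))) \<le> e / 4"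
        using b(3) by (simp add: Y_def algebra_simps)
      ultimately show "step_value \<theta> m G - e \<le> cost (rate n) (step m G) A0"
        using e unfolding L_def[symmetric] \<tau>_def[symmetric] by linarith
    qed
  qed
qed

text \<open>Closed form of the integral of \<open>phi r (c * \<rho> powr (-1/d)) * f\<close> at the
  optimal \<rho>, proportional to f^cexp: for r \<noteq> 0 the quasi-norm of order d/(d+r) appears,
  for r = 0 an entropy. If f is a density of mass 1 for which these integrals converge, the value is
  \<open>phi r\<close> of c times \<open>Phi r f\<close>.\<close>

definition limit_value :: "real \<Rightarrow> (real^'d \<Rightarrow> real) \<Rightarrow> real" where
  "limit_value c f =
    (if r = 0
     then (\<integral>x. f x \<partial>U) * ln c
       + ((\<integral>x. f x \<partial>U) * ln (\<integral>x. f x \<partial>U) - (\<integral>x. f x * ln (f x) \<partial>U)) / real CARD('d)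
     else (c powr r * (\<integral>x. f x powr cexp \<partial>U) powr (1 / cexp) - (\<integral>x. f x \<partial>U)) / r)"

text \<open>A budget of \<theta> n points measured at the scale n^(1/d) acts like n points with the
  constant multiplied by \<theta>^(-1/d).\<close>

definition scaled_const :: "real \<Rightarrow> real" where
  "scaled_const \<theta> = C * \<theta> powr (- 1 / CARD('d))"

lemma scaled_const_pos: "0 < \<theta> \<Longrightarrow> 0 < scaled_const \<theta>"
  using C_pos by (simp add: scaled_const_def)

text \<open>Stated for individual codebooks rather than for the infimum of their costs, so that a
  codebook found for one density can be reused for another.\<close>

definition quantized :: "(real^'d \<Rightarrow> real) \<Rightarrow> bool" where
  "quantized f \<longleftrightarrow> (\<forall>\<theta>::real. 0 < \<theta> \<longrightarrow> (\<forall>e>0. \<forall>\<^sub>F n in sequentially.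
    (\<exists>A. finite A \<and> A \<noteq> {} \<and> real (card A) \<le> \<theta> * n \<and> cost (rate n) f A \<le> limit_value (scaled_const \<theta>) f + e) \<and>
    (\<forall>A. finite A \<longrightarrow> A \<noteq> {} \<longrightarrow> real (card A) \<le> \<theta> * n \<longrightarrow> limit_value (scaled_const \<theta>) f - e \<le> cost (rate n) f A)))"

lemma integral_step:
  assumes m: "0 < m"
  shows "(\<integral>x. F (step m G x) \<partial>U) = (\<Sum>i\<in>indices m. (1 / m) ^ CARD('d) * F (G i))"
proof -
  interpret U: prob_space U by (rule prob_space_U)
  let ?c = "\<lambda>i. cell (corner m i) (1 / m)"
  have m': "0 < 1 / real m" using m by simp
  have int: "integrable U (indicator (?c i) :: _ \<Rightarrow> real)" for i
    using cell_borel[OF m', of "corner m i"] by (intro U.integrable_const_bound[of _ 1]) (auto intro!: borel_measurable_U)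
  have vol: "(\<integral>x. indicator (?c i) x \<partial>U) = (1 / m) ^ CARD('d)" if "i \<in> indices m" for i
    using cell_integral(1)[of "\<lambda>_. 1" "1 / m" "corner m i"] m' cell_corner_subset[OF m that]
    by (simp add: U.prob_space[unfolded space_U])
  have "(\<integral>x. F (step m G x) \<partial>U) = (\<integral>x. (\<Sum>i\<in>indices m. indicator (?c i) x * F (G i)) \<partial>U)"
    by (intro Bochner_Integration.integral_cong) (auto simp only: space_U step_eq[OF m] sum_indicator_cells[OF m])
  also have "\<dots> = (\<Sum>i\<in>indices m. (\<integral>x. indicator (?c i) x \<partial>U) * F (G i))"
    by (subst Bochner_Integration.integral_sum) (simp_all only: integrable_mult_left int integral_mult_left_zero)
  also have "\<dots> = (\<Sum>i\<in>indices m. (1 / m) ^ CARD('d) * F (G i))"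
    by (intro sum.cong refl) (simp only: vol)
  finally show ?thesis .
qed

text \<open>For r \<noteq> 0 the sum over cells collapses because G times share^(-r/d) is
  proportional to G^cexp, by 1 - cexp r/d = cexp. For r = 0 the exponent is 1 and the logarithm of
  the quotient splits.\<close>

lemma step_value_eq:
  assumes m: "0 < m" and G: "\<And>i. i \<in> indices m \<Longrightarrow> 0 < G i" and \<theta>: "0 < \<theta>"
  shows "step_value \<theta> m G = limit_value (scaled_const \<theta>) (step m G)"
proof -
  let ?d = "real CARD('d)"
  define w where "w = (1 / real m) ^ CARD('d)"
  have w: "0 < w" using m by (simp add: w_def)
  define c where "c = scaled_const \<theta>"
  have c: "0 < c" using scaled_const_pos[OF \<theta>] by (simp add: c_def)
  define S where "S = (\<Sum>i\<in>indices m. w * G i powr cexp)"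
  have S: "0 < S" unfolding S_def using w G indices_nonempty[OF m]
    by (intro sum_pos mult_pos_pos) force+
  have a: "0 < share m G i" if "i \<in> indices m" for i using share_pos m G that by blast
  have sh: "share m G i = G i powr cexp / S" for i by (simp add: share_def S_def w_def)
  have arg: "C * (\<theta> * share m G i) powr (- 1 / ?d) = c * share m G i powr (- 1 / ?d)" for i
    by (simp only: c_def scaled_const_def powr_mult mult.assoc)
  have int: "(\<integral>x. F (step m G x) \<partial>U) = (\<Sum>i\<in>indices m. w * F (G i))" for F :: "real \<Rightarrow> real"
    unfolding w_def by (rule integral_step[OF m])
  have H: "(\<integral>x. step m G x \<partial>U) = (\<Sum>i\<in>indices m. w * G i)" by (rule int[of "\<lambda>x. x"])
  have val: "step_value \<theta> m G = (\<Sum>i\<in>indices m. w * G i * phi r (c * share m G i powr (- 1 / ?d)))"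
    unfolding step_value_def arg w_def ..
  show ?thesis
  proof (cases "r = 0")
    case True
    then have ce: "cexp = 1" unfolding cexp_def by simp
    have SH: "S = (\<Sum>i\<in>indices m. w * G i)" unfolding S_def ce by (intro sum.cong refl) (simp add: abs_of_pos[OF G])
    have "w * G i * phi r (c * share m G i powr (- 1 / ?d))
        = w * G i * (ln c + ln S / ?d) - w * (G i * ln (G i)) / ?d" if i: "i \<in> indices m" for i
    proof -
      have "phi r (c * share m G i powr (- 1 / ?d)) = ln c + - 1 / ?d * ln (share m G i)"
        using True c a[OF i] by (simp add: phi_def ln_mult ln_powr)
      also have "ln (share m G i) = ln (G i) - ln S"
        using G[OF i] S by (simp add: sh ce ln_div)
      finally have P: "phi r (c * share m G i powr (- 1 / ?d)) = ln c + - 1 / ?d * (ln (G i) - ln S)" .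
      show ?thesis unfolding P by (simp add: field_simps)
    qed
    then have "step_value \<theta> m G = (\<Sum>i\<in>indices m. w * G i * (ln c + ln S / ?d) - w * (G i * ln (G i)) / ?d)"
      unfolding val by (intro sum.cong) auto
    also have "\<dots> = S * (ln c + ln S / ?d) - (\<Sum>i\<in>indices m. w * (G i * ln (G i))) / ?d"
      by (simp only: sum_subtractf SH sum_distrib_right sum_divide_distrib)
    also have "\<dots> = limit_value c (step m G)"
    proof -
      have lv: "limit_value c (step m G) = S * ln c + (S * ln S - (\<Sum>i\<in>indices m. w * (G i * ln (G i)))) / ?d"
        unfolding limit_value_def H int[of "\<lambda>x. x * ln x"] SH[symmetric] using True by simp
      show ?thesis unfolding lv by (simp add: distrib_left diff_divide_distrib)
    qed
    finally show ?thesis by (simp add: c_def)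
  next
    case False
    have "w * G i * phi r (c * share m G i powr (- 1 / ?d))
        = (c powr r * S powr (r / ?d) * (w * G i powr cexp) - w * G i) / r" if i: "i \<in> indices m" for i
    proof -
      have "share m G i powr (- 1 / ?d * r) = G i powr (cexp * (- 1 / ?d * r)) * S powr (r / ?d)"
        using S by (simp add: sh powr_divide powr_powr powr_minus_divide)
      moreover have "G i * G i powr (cexp * (- 1 / ?d * r)) = G i powr cexp"
      proof -
        have "1 + cexp * (- 1 / ?d * r) = cexp"
          using r_gt by (simp add: cexp_def field_simps)
        moreover have "G i * G i powr (cexp * (- 1 / ?d * r)) = G i powr (1 + cexp * (- 1 / ?d * r))"
          using G[OF i] by (subst powr_add) simp
        ultimately show ?thesis by simp
      qed
      moreover have "phi r (c * share m G i powr (- 1 / ?d)) = (c powr r * share m G i powr (- 1 / ?d * r) - 1) / r"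
        using False by (simp only: phi_def powr_mult powr_powr if_False)
      ultimately have "w * G i * phi r (c * share m G i powr (- 1 / ?d))
          = w * G i * ((c powr r * (G i powr (cexp * (- 1 / ?d * r)) * S powr (r / ?d)) - 1) / r)"
        by (simp only:)
      also have "\<dots> = (c powr r * S powr (r / ?d) * (w * (G i * G i powr (cexp * (- 1 / ?d * r)))) - w * G i) / r"
      proof -
        have "u * g * ((v * (x * y) - 1) / r) = (v * y * (u * (g * x)) - u * g) / r" for u g v x y :: real
          by (simp add: algebra_simps)
        then show ?thesis .
      qed
      finally show ?thesis
        by (simp only: \<open>G i * G i powr (cexp * (- 1 / ?d * r)) = G i powr cexp\<close>)
    qed
    then have "step_value \<theta> m G
        = (\<Sum>i\<in>indices m. (c powr r * S powr (r / ?d) * (w * G i powr cexp) - w * G i) / r)"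
      unfolding val by (intro sum.cong) auto
    also have "\<dots> = (c powr r * S powr (r / ?d) * S - (\<Sum>i\<in>indices m. w * G i)) / r"
    proof -
      have S2: "(\<Sum>i\<in>indices m. v * (w * G i powr cexp)) = v * S" for v
        unfolding S_def by (rule sum_distrib_left[symmetric])
      show ?thesis by (simp only: S2 sum_subtractf flip: sum_divide_distrib)
    qed
    also have "c powr r * S powr (r / ?d) * S = c powr r * S powr (1 / cexp)"
    proof -
      have "1 / cexp = r / ?d + 1" using r_gt by (simp add: cexp_def field_simps)
      then show ?thesis using S by (simp add: powr_add)
    qed
    finally show ?thesis
      using False by (simp add: limit_value_def H int[of "\<lambda>x. x powr cexp"] S_def c_def)
  qed
qed

lemma quantized_step:
  assumes m: "0 < m" and G: "\<And>i. i \<in> indices m \<Longrightarrow> 0 < G i"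
  shows "quantized (step m G)"
proof -
  have "\<forall>\<^sub>F n in sequentially.
    (\<exists>A. finite A \<and> A \<noteq> {} \<and> real (card A) \<le> \<theta> * n \<and> cost (rate n) (step m G) A \<le> step_value \<theta> m G + e) \<and>
    (\<forall>A. finite A \<longrightarrow> A \<noteq> {} \<longrightarrow> real (card A) \<le> \<theta> * n \<longrightarrow> step_value \<theta> m G - e \<le> cost (rate n) (step m G) A)"
    if "0 < \<theta>" "0 < e" for \<theta> e :: real
    using step_upper[of m G \<theta> e] step_lower[of m G \<theta> e] m G that by (intro eventually_conj) auto
  then show ?thesis
    unfolding quantized_def using step_value_eq[of m G] m G by simp
qed

section \<open>General densities\<close>

text \<open>About (\<delta> n)^(1/d) subdivisions per axis give distances of order n^(-1/d). Joined
  to a codebook, such a grid confines the rescaled distances to an interval (0, T] independent of n,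
  where the two-sided moment inequality is available.\<close>

lemma fine_grid:
  fixes \<delta> :: real
  assumes \<delta>: "0 < \<delta>"
  obtains T where "0 < T" "\<forall>\<^sub>F n in sequentially. \<exists>B. finite B \<and> B \<noteq> {} \<and> real (card B) \<le> \<delta> * n \<and>
    (\<forall>x\<in>unit_cube. rate n * dist_set N x B \<le> T)"
proof -
  let ?d = "real CARD('d)"
  obtain R where R: "0 < R" "\<And>m x. 0 < m \<Longrightarrow> x \<in> unit_cube \<Longrightarrow> dist_set N x (corner m ` indices m) \<le> R / real m"
    by (rule grid_cover) blast
  \<comment> \<open>The factor 2 pays for rounding: the integer part of x is at least x/2 once x
    \<ge> 1.\<close>
  define T where "T = 2 * R / \<delta> powr (1 / ?d)"
  have T: "0 < T" using R \<delta> by (simp add: T_def)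
  define x where "x n = (\<delta> * real n) powr (1 / ?d)" for n
  have "filterlim (\<lambda>n. \<delta> * real n) at_top sequentially"
    using \<delta> by (rule filterlim_tendsto_pos_mult_at_top[OF tendsto_const _ filterlim_real_sequentially])
  then have "filterlim x at_top sequentially"
    unfolding x_def by (rule filterlim_compose[rotated]) (rule filterlim_powr_at_top, simp)
  then have "\<forall>\<^sub>F n in sequentially. 1 \<le> x n" by (simp add: filterlim_at_top)
  then have "\<forall>\<^sub>F n in sequentially. \<exists>B. finite B \<and> B \<noteq> {} \<and> real (card B) \<le> \<delta> * n \<and>
    (\<forall>x\<in>unit_cube. rate n * dist_set N x B \<le> T)"
  proof eventually_elim
    case (elim n)
    define m where "m = nat \<lfloor>x n\<rfloor>"
    have m: "0 < m" "real m \<le> x n" "x n \<le> 2 * real m" 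
    proof -
      show m1: "0 < m" "real m \<le> x n" using elim unfolding m_def by linarith+
      have "x n < real m + 1" using elim unfolding m_def by linarith
      then show "x n \<le> 2 * real m" using m1(1) by linarith
    qed
    have n: "0 < n" using elim by (cases "n = 0") (auto simp: x_def)
    have "real (card (corner m ` indices m)) \<le> real m ^ CARD('d)"
      using card_image_le[of "indices m" "corner m"] by (simp add: card_indices flip: of_nat_power)
    also have "\<dots> \<le> x n ^ CARD('d)" using m by (intro power_mono) auto
    also have "\<dots> = \<delta> * n" using n \<delta> by (simp add: x_def powr_power)
    finally have card: "real (card (corner m ` indices m)) \<le> \<delta> * n" .
    have "rate n * dist_set N z (corner m ` indices m) \<le> T" if "z \<in> unit_cube" for z
    proof -
      have "rate n * dist_set N z (corner m ` indices m) \<le> rate n * (R / m)"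
        using R(2)[OF m(1) that] rate_pos[OF n] by (intro mult_left_mono) auto
      also have "rate n * (R / m) = x n / \<delta> powr (1 / ?d) * (R / m)"
        using \<delta> by (simp add: rate_def x_def powr_mult)
      also have "x n / \<delta> powr (1 / ?d) * (R / m) \<le> 2 * real m / \<delta> powr (1 / ?d) * (R / m)"
        using m R \<delta> by (intro mult_right_mono divide_right_mono) auto
      also have "\<dots> = T" using m by (simp add: T_def)
      finally show ?thesis .
    qed
    then show ?case using card indices_nonempty[OF m(1)]
      by (intro exI[of _ "corner m ` indices m"]) auto
  qed
  then show ?thesis using T that by blast
qed

text \<open>The difference of the costs is at most the integral of |phi| |f - g|. The moment
  inequality splits this into \<eta> times a moment that is bounded for all codebooks of at most
  (\<theta> + \<delta>) n points, and K times the distance of f and g. Here \<eta> is fixed before K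
  and \<zeta>, and one grid B serves all A, f and g.\<close>

lemma cost_perturb:
  fixes \<delta> e \<theta> :: real
  assumes q: "admissible (real CARD('d)) r q" and \<delta>: "0 < \<delta>" and e: "0 < e" and \<theta>: "0 < \<theta>"
  obtains \<zeta> where "0 < \<zeta>" "\<forall>\<^sub>F n in sequentially. \<exists>B. finite B \<and> B \<noteq> {} \<and> real (card B) \<le> \<delta> * n \<and>
    (\<forall>A f g. finite A \<longrightarrow> real (card A) \<le> \<theta> * n \<longrightarrow>
      weight q f \<longrightarrow> weight q g \<longrightarrow> integrable U (\<lambda>x. \<bar>f x - g x\<bar> powr q) \<longrightarrow>
      (\<integral>x. \<bar>f x - g x\<bar> + \<bar>f x - g x\<bar> powr q \<partial>U) \<le> \<zeta> \<longrightarrow>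
      \<bar>cost (rate n) f (A \<union> B) - cost (rate n) g (A \<union> B)\<bar> \<le> e)"
proof -
  let ?d = "real CARD('d)"
  obtain T where T: "0 < T" "\<forall>\<^sub>F n in sequentially. \<exists>B. finite B \<and> B \<noteq> {} \<and> real (card B) \<le> \<delta> * n \<and>
    (\<forall>x\<in>unit_cube. rate n * dist_set N x B \<le> T)"
    using fine_grid[OF \<delta>] by blast
  obtain p where p: "- ?d < p" "p < 0" "\<And>\<eta>. 0 < \<eta> \<Longrightarrow> \<exists>K\<ge>0. \<forall>t>0. t \<le> T \<longrightarrow>
      (\<forall>y\<ge>0. \<bar>phi r t\<bar> * y \<le> \<eta> * t powr p + K * (y + y powr q))"
    using phi_mult_bound[OF d_pos r_gt q] T(1) by meson
  obtain I where I: "0 \<le> I"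
    "\<And>A \<tau>. finite A \<Longrightarrow> A \<noteq> {} \<Longrightarrow> 0 < \<tau> \<Longrightarrow> integrable U (\<lambda>x. (\<tau> * dist_set N x A) powr p)"
    "\<And>A \<tau>. finite A \<Longrightarrow> A \<noteq> {} \<Longrightarrow> 0 < \<tau> \<Longrightarrow>
      (\<integral>x. (\<tau> * dist_set N x A) powr p \<partial>U) \<le> real (card A) / \<tau> ^ CARD('d) * I + 1"
    by (rule dist_powr_moment[OF p(1,2)]) blast
  define Y where "Y = (\<theta> + \<delta>) * I + 1"
  have Y: "0 < Y" using \<theta> \<delta> I by (simp add: Y_def add_nonneg_pos)
  define \<eta> where "\<eta> = e / (2 * Y)"
  have \<eta>: "0 < \<eta>" "\<eta> * Y = e / 2" using e Y by (auto simp: \<eta>_def)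
  obtain K where K: "0 \<le> K" "\<And>t y. 0 < t \<Longrightarrow> t \<le> T \<Longrightarrow> 0 \<le> y \<Longrightarrow>
      \<bar>phi r t\<bar> * y \<le> \<eta> * t powr p + K * (y + y powr q)"
    using p(3)[OF \<eta>(1)] by auto
  define \<zeta> where "\<zeta> = e / (2 * (K + 1))"
  have \<zeta>: "0 < \<zeta>" "K * \<zeta> \<le> e / 2" using e K by (auto simp: \<zeta>_def field_simps add_nonneg_pos)
  show ?thesis
  proof (rule that[OF \<zeta>(1)])
    show "\<forall>\<^sub>F n in sequentially. \<exists>B. finite B \<and> B \<noteq> {} \<and> real (card B) \<le> \<delta> * n \<and>
    (\<forall>A f g. finite A \<longrightarrow> real (card A) \<le> \<theta> * n \<longrightarrow>
      weight q f \<longrightarrow> weight q g \<longrightarrow> integrable U (\<lambda>x. \<bar>f x - g x\<bar> powr q) \<longrightarrow>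
      (\<integral>x. \<bar>f x - g x\<bar> + \<bar>f x - g x\<bar> powr q \<partial>U) \<le> \<zeta> \<longrightarrow>
      \<bar>cost (rate n) f (A \<union> B) - cost (rate n) g (A \<union> B)\<bar> \<le> e)"
      using T(2) eventually_gt_at_top[of 0]
    proof eventually_elim
      case (elim n)
      then obtain B where B: "finite B" "B \<noteq> {}" "real (card B) \<le> \<delta> * n"
        "\<And>x. x \<in> unit_cube \<Longrightarrow> rate n * dist_set N x B \<le> T" by blast
      have n: "0 < n" by (rule elim(2))
      show ?case
      proof (rule exI[of _ B], intro conjI B(1-3) allI impI)
        fix A :: "(real^'d) set" and f g :: "real^'d \<Rightarrow> real"
        assume A0: "finite A" "real (card A) \<le> \<theta> * n"
          and f: "weight q f" and g: "weight q g"
          and fg: "integrable U (\<lambda>x. \<bar>f x - g x\<bar> powr q)"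
            "(\<integral>x. \<bar>f x - g x\<bar> + \<bar>f x - g x\<bar> powr q \<partial>U) \<le> \<zeta>"
        define A' where "A' = A \<union> B"
        have A': "finite A'" "A' \<noteq> {}" using A0 B by (auto simp: A'_def)
        have cA': "real (card A') \<le> (\<theta> + \<delta>) * n"
          using card_Un_le[of A B] A0 B by (simp add: A'_def algebra_simps)
        define \<tau> where "\<tau> = rate n"
        have \<tau>: "0 < \<tau>" "\<tau> ^ CARD('d) = n" using n rate_pos rate_power by (auto simp: \<tau>_def)
        have le: "\<tau> * dist_set N x A' \<le> T" if "x \<in> unit_cube" for x
        proof -
          have "\<tau> * dist_set N x A' \<le> \<tau> * dist_set N x B"
            using A' B \<tau> by (intro mult_left_mono dist_set_antimono) (auto simp: A'_def)
          also have "\<dots> \<le> T" using B(4)[OF that] by (simp add: \<tau>_def)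
          finally show ?thesis .
        qed
        have mom_int: "integrable U (\<lambda>x. (\<tau> * dist_set N x A') powr p)" by (rule I(2)[OF A' \<tau>(1)])
        have mom: "(\<integral>x. (\<tau> * dist_set N x A') powr p \<partial>U) \<le> Y"
        proof -
          have "(\<integral>x. (\<tau> * dist_set N x A') powr p \<partial>U) \<le> real (card A') / n * I + 1"
            using I(3)[OF A' \<tau>(1)] unfolding \<tau>(2) .
          also have "\<dots> \<le> Y"
          proof -
            have "real (card A') / n \<le> \<theta> + \<delta>" using cA' n by (simp add: field_simps)
            then show ?thesis unfolding Y_def using I by (intro add_right_mono mult_right_mono) auto
          qed
          finally show ?thesis .
        qed
        have if': "integrable U (\<lambda>x. phi r (\<tau> * dist_set N x A') * f x)"
          by (rule phi_dist_integrable[OF A' \<tau>(1) q f])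
        have ig': "integrable U (\<lambda>x. phi r (\<tau> * dist_set N x A') * g x)"
          by (rule phi_dist_integrable[OF A' \<tau>(1) q g])
        let ?y = "\<lambda>x. \<bar>f x - g x\<bar>"
        have iy: "integrable U (\<lambda>x. ?y x + ?y x powr q)"
          using f g fg unfolding weight_def by (intro Bochner_Integration.integrable_add integrable_abs Bochner_Integration.integrable_diff) auto
        have "\<bar>cost \<tau> f A' - cost \<tau> g A'\<bar>
            = \<bar>\<integral>x. phi r (\<tau> * dist_set N x A') * f x - phi r (\<tau> * dist_set N x A') * g x \<partial>U\<bar>"
          unfolding cost_def by (subst Bochner_Integration.integral_diff[OF if' ig']) simp
        also have "\<dots> \<le> (\<integral>x. \<bar>phi r (\<tau> * dist_set N x A') * f x - phi r (\<tau> * dist_set N x A') * g x\<bar> \<partial>U)"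
          by (rule integral_abs_bound)
        also have "\<dots> \<le> (\<integral>x. \<eta> * (\<tau> * dist_set N x A') powr p + K * (?y x + ?y x powr q) \<partial>U)"
        proof (rule integral_mono_AE)
          show "AE x in U. \<bar>phi r (\<tau> * dist_set N x A') * f x - phi r (\<tau> * dist_set N x A') * g x\<bar>
              \<le> \<eta> * (\<tau> * dist_set N x A') powr p + K * (?y x + ?y x powr q)"
            using AE_dist_pos[OF A'] AE_U_cube
          proof eventually_elim
            case (elim x)
            have "\<bar>phi r (\<tau> * dist_set N x A') * f x - phi r (\<tau> * dist_set N x A') * g x\<bar>
                = \<bar>phi r (\<tau> * dist_set N x A')\<bar> * ?y x"
              by (simp only: abs_mult flip: right_diff_distrib)
            also have "\<dots> \<le> \<eta> * (\<tau> * dist_set N x A') powr p + K * (?y x + ?y x powr q)"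
              using elim \<tau> by (intro K(2) le mult_pos_pos) auto
            finally show ?case .
          qed
          show "integrable U (\<lambda>x. \<bar>phi r (\<tau> * dist_set N x A') * f x - phi r (\<tau> * dist_set N x A') * g x\<bar>)"
            by (intro integrable_abs Bochner_Integration.integrable_diff if' ig')
          show "integrable U (\<lambda>x. \<eta> * (\<tau> * dist_set N x A') powr p + K * (?y x + ?y x powr q))"
            by (intro Bochner_Integration.integrable_add[OF integrable_mult_right[OF mom_int] integrable_mult_right[OF iy]])
        qed
        also have "\<dots> = \<eta> * (\<integral>x. (\<tau> * dist_set N x A') powr p \<partial>U) + K * (\<integral>x. ?y x + ?y x powr q \<partial>U)"
          by (subst Bochner_Integration.integral_add[OF integrable_mult_right[OF mom_int] integrable_mult_right[OF iy]])
             (simp only: integral_mult_right_zero)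
        also have "\<dots> \<le> \<eta> * Y + K * \<zeta>"
          using mom fg(2) \<eta> K by (intro add_mono mult_left_mono) auto
        also have "\<dots> \<le> e" using \<eta> \<zeta> by simp
        finally show "\<bar>cost (rate n) f (A \<union> B) - cost (rate n) g (A \<union> B)\<bar> \<le> e"
          by (simp add: \<tau>_def A'_def)
      qed
    qed
  qed
qed

section \<open>Continuity of the limiting cost and passage to limits of densities\<close>

lemma cexp_less:
  assumes "admissible (real CARD('d)) r q" shows "cexp \<le> 1 \<or> cexp < q"
  using assms r_gt unfolding admissible_def cexp_def by (cases "r \<le> 0") (auto simp: field_simps)

lemma powr_cexp_le:
  assumes "admissible (real CARD('d)) r q" "0 \<le> y" "y \<le> w"
  shows "y powr cexp \<le> 1 + w + w powr q"
proof -
  have "y powr cexp \<le> w powr cexp" using assms cexp_pos by (intro powr_mono2) auto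
  also have "\<dots> \<le> 1 + w + w powr q"
  proof (cases "w \<le> 1")
    case True
    then have "w powr cexp \<le> 1" using assms cexp_pos by (intro powr_le1) auto
    then show ?thesis using assms by (simp add: add_increasing2)
  next
    case False
    from cexp_less[OF assms(1)] show ?thesis
    proof
      assume "cexp \<le> 1"
      then have "w powr cexp \<le> w powr 1" using False by (intro powr_mono) auto
      then show ?thesis using False assms by (simp add: add_increasing2)
    next
      assume "cexp < q"
      then have "w powr cexp \<le> w powr q" using False by (intro powr_mono) auto
      then show ?thesis using False assms by (simp add: add_increasing)
    qed
  qed
  finally show ?thesis .
qed

lemma abs_mult_ln_le_powr:
  fixes y w :: real
  assumes "1 < q" "0 \<le> y" "y \<le> w"
  shows "\<bar>y * ln y\<bar> \<le> 2 + w powr q / (q - 1)"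
proof (cases "y \<le> 1")
  case True
  have "\<bar>y * ln y\<bar> \<le> 2 * y powr (1/2)" using assms True by (intro abs_mult_ln_le) auto
  also have "\<dots> \<le> 2" using True assms by (simp add: powr_le1)
  also have "\<dots> \<le> 2 + w powr q / (q - 1)" using assms by simp
  finally show ?thesis .
next
  case False
  then have "ln y \<le> y powr (q - 1) / (q - 1)" using assms by (intro ln_powr_bound) auto
  then have "y * ln y \<le> y * (y powr (q - 1) / (q - 1))" using False by (intro mult_left_mono) auto
  also have "\<dots> = y powr q / (q - 1)" using False by (simp add: powr_diff)
  also have "\<dots> \<le> w powr q / (q - 1)" using assms by (intro divide_right_mono powr_mono2) auto
  finally show ?thesis using False by simp
qed

lemma integrable_powr_mono:
  fixes f W :: "real^'d \<Rightarrow> real"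
  assumes "f \<in> borel_measurable U" "AE x in U. 0 \<le> f x \<and> f x \<le> W x" "0 \<le> q" "integrable U (\<lambda>x. W x powr q)"
  shows "integrable U (\<lambda>x. f x powr q)"
proof (rule Bochner_Integration.integrable_bound[OF assms(4)])
  show "AE x in U. norm (f x powr q) \<le> norm (W x powr q)"
    using assms(2) by eventually_elim (use assms(3) in \<open>auto simp: powr_mono2\<close>)
qed (use assms(1) in measurable)

text \<open>Dominated convergence in each integral of the functional: admissibility of q lets W and
  W^q majorise f^cexp and, for r = 0, f ln f. Positive mass of the limit makes the logarithm of the
  masses converge when r = 0.\<close>

lemma limit_value_tendsto:
  assumes q: "admissible (real CARD('d)) r q"
    and W: "integrable U W" "integrable U (\<lambda>x. W x powr q)"
    and g: "\<And>k. g k \<in> borel_measurable U" "\<And>k. AE x in U. 0 \<le> g k x \<and> g k x \<le> W x"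
    and h: "h \<in> borel_measurable U" "0 < (\<integral>x. h x \<partial>U)"
    and lim: "AE x in U. (\<lambda>k. g k x) \<longlonglongrightarrow> h x"
  shows "(\<lambda>k. limit_value c (g k)) \<longlonglongrightarrow> limit_value c h"
proof -
  interpret U: prob_space U by (rule prob_space_U)
  note [measurable] = g(1) h(1)
  have allg: "AE x in U. \<forall>k. 0 \<le> g k x \<and> g k x \<le> W x"
    using g(2) by (subst AE_all_countable) blast
  have H: "(\<lambda>k. \<integral>x. g k x \<partial>U) \<longlonglongrightarrow> (\<integral>x. h x \<partial>U)"
  proof (rule integral_dominated_convergence[OF _ _ W(1) lim])
    show "AE x in U. norm (g k x) \<le> W x" for k using g(2)[of k] by eventually_elim auto
  qed measurable
  show ?thesis
  proof (cases "r = 0")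
    case True
    then have q1: "1 < q" using q d_pos by (simp add: admissible_def)
    have E: "(\<lambda>k. \<integral>x. g k x * ln (g k x) \<partial>U) \<longlonglongrightarrow> (\<integral>x. h x * ln (h x) \<partial>U)"
    proof (rule integral_dominated_convergence[where w = "\<lambda>x. 2 + W x powr q / (q - 1)"])
      show "integrable U (\<lambda>x. 2 + W x powr q / (q - 1))" using W by auto
      show "AE x in U. (\<lambda>k. g k x * ln (g k x)) \<longlonglongrightarrow> h x * ln (h x)"
        using lim allg
        by eventually_elim (intro tendsto_mult_ln, auto)
      show "AE x in U. norm (g k x * ln (g k x)) \<le> 2 + W x powr q / (q - 1)" for k
        using g(2)[of k] by eventually_elim (use abs_mult_ln_le_powr[OF q1] in auto)
    qed measurable
    show ?thesis unfolding limit_value_def using True h(2)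
      by (auto intro!: tendsto_intros H E)
  next
    case False
    have S: "(\<lambda>k. \<integral>x. g k x powr cexp \<partial>U) \<longlonglongrightarrow> (\<integral>x. h x powr cexp \<partial>U)"
    proof (rule integral_dominated_convergence[where w = "\<lambda>x. 1 + W x + W x powr q"])
      show "integrable U (\<lambda>x. 1 + W x + W x powr q)" using W by auto
      show "AE x in U. (\<lambda>k. g k x powr cexp) \<longlonglongrightarrow> h x powr cexp"
        using lim allg
        by eventually_elim (intro tendsto_powr', use cexp_pos in auto)
      show "AE x in U. norm (g k x powr cexp) \<le> 1 + W x + W x powr q" for k
        using g(2)[of k] by eventually_elim (use powr_cexp_le[OF q] in auto)
    qed measurable
    have "(\<lambda>k. (\<integral>x. g k x powr cexp \<partial>U) powr (1 / cexp)) \<longlonglongrightarrow> (\<integral>x. h x powr cexp \<partial>U) powr (1 / cexp)"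
      using cexp_pos by (intro tendsto_powr'[OF S tendsto_const]) auto
    then show ?thesis unfolding limit_value_def using False
      by (auto intro!: tendsto_intros H)
  qed
qed

lemma limit_value_scaled_isCont:
  assumes "0 < \<theta>"
  shows "isCont (\<lambda>\<theta>. limit_value (scaled_const \<theta>) f) \<theta>"
  unfolding limit_value_def scaled_const_def using assms C_pos
  by (cases "r = 0") (auto intro!: continuous_intros)

text \<open>A codebook good for an approximation with budget (\<theta> - \<delta>) n, joined with a
  grid of \<delta> n points, is good for h. Conversely, a codebook for h joined with the grid is
  tested against an approximation with budget (\<theta> + \<delta>) n. Continuity of the limiting
  cost in \<theta> absorbs both changes of budget.\<close>

lemma quantized_limit:
  assumes q: "admissible (real CARD('d)) r q"
    and W: "integrable U W" "integrable U (\<lambda>x. W x powr q)"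
    and g: "\<And>k. g k \<in> borel_measurable U" "\<And>k. AE x in U. 0 \<le> g k x \<and> g k x \<le> W x"
    and h: "h \<in> borel_measurable U" "AE x in U. 0 \<le> h x \<and> h x \<le> W x" "0 < (\<integral>x. h x \<partial>U)"
    and lim: "AE x in U. (\<lambda>k. g k x) \<longlonglongrightarrow> h x"
    and quant: "\<And>k. quantized (g k)"
  shows "quantized h"
proof -
  interpret U: prob_space U by (rule prob_space_U)
  note [measurable] = g(1) h(1)
  have q1: "1 \<le> q" using q by (simp add: admissible_def)
  have wt: "weight q f"
    if "f \<in> borel_measurable U" "AE x in U. 0 \<le> f x \<and> f x \<le> W x" for f
    unfolding weight_def
  proof (intro conjI that(1))
    show "integrable U f"
    proof (rule Bochner_Integration.integrable_bound[OF W(1) that(1)])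
      show "AE x in U. norm (f x) \<le> norm (W x)" using that(2) by eventually_elim auto
    qed
    show "integrable U (\<lambda>x. f x powr q)" using integrable_powr_mono[OF that _ W(2)] q1 by simp
    show "AE x in U. 0 \<le> f x" using that(2) by eventually_elim auto
  qed
  have diff: "integrable U (\<lambda>x. \<bar>h x - g k x\<bar> powr q)" for k
  proof (rule integrable_powr_mono[OF _ _ _ W(2)])
    show "AE x in U. 0 \<le> \<bar>h x - g k x\<bar> \<and> \<bar>h x - g k x\<bar> \<le> W x"
      using g(2)[of k] h(2) by eventually_elim auto
  qed (use q1 in auto)
  have err: "(\<lambda>k. \<integral>x. \<bar>h x - g k x\<bar> + \<bar>h x - g k x\<bar> powr q \<partial>U) \<longlonglongrightarrow> (\<integral>x. 0 \<partial>U)"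
  proof (rule integral_dominated_convergence[where w = "\<lambda>x. W x + W x powr q"])
    show "integrable U (\<lambda>x. W x + W x powr q)" using W by auto
    show "AE x in U. (\<lambda>k. \<bar>h x - g k x\<bar> + \<bar>h x - g k x\<bar> powr q) \<longlonglongrightarrow> 0"
      using lim
    proof eventually_elim
      case (elim x)
      have "(\<lambda>k. \<bar>h x - g k x\<bar>) \<longlonglongrightarrow> \<bar>h x - h x\<bar>" by (intro tendsto_intros elim)
      then have *: "(\<lambda>k. \<bar>h x - g k x\<bar>) \<longlonglongrightarrow> 0" by simp
      have "(\<lambda>k. \<bar>h x - g k x\<bar> + \<bar>h x - g k x\<bar> powr q) \<longlonglongrightarrow> 0 + 0 powr q"
        using q1 by (intro tendsto_add * tendsto_powr'[OF * tendsto_const]) auto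
      then show ?case by simp
    qed
    show "AE x in U. norm (\<bar>h x - g k x\<bar> + \<bar>h x - g k x\<bar> powr q) \<le> W x + W x powr q" for k
      using g(2)[of k] h(2)
    proof eventually_elim
      case (elim x)
      then have "\<bar>h x - g k x\<bar> \<le> W x" by auto
      then have "\<bar>h x - g k x\<bar> powr q \<le> W x powr q" using q1 by (intro powr_mono2) auto
      then show ?case using \<open>\<bar>h x - g k x\<bar> \<le> W x\<close> by simp
    qed
  qed measurable
  have near: "\<exists>\<delta>>0. \<delta> < \<theta> \<and> (\<forall>\<theta>'. \<bar>\<theta>' - \<theta>\<bar> \<le> \<delta> \<longrightarrow>
      \<bar>limit_value (scaled_const \<theta>') h - limit_value (scaled_const \<theta>) h\<bar> < e)"
    if \<theta>: "0 < \<theta>" and e: "0 < e" for \<theta> e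
  proof -
    obtain \<delta> where \<delta>: "0 < \<delta>" "\<And>\<theta>'. dist \<theta>' \<theta> < \<delta> \<Longrightarrow>
        dist (limit_value (scaled_const \<theta>') h) (limit_value (scaled_const \<theta>) h) < e"
      using limit_value_scaled_isCont[OF \<theta>, of h] e unfolding continuous_at_eps_delta by blast
    then show ?thesis using \<theta>
      by (intro exI[of _ "min \<delta> \<theta> / 2"]) (auto simp: dist_real_def)
  qed
  have approx: "\<exists>k. \<bar>limit_value (scaled_const \<theta>) (g k) - limit_value (scaled_const \<theta>) h\<bar> < e \<and>
      (\<integral>x. \<bar>h x - g k x\<bar> + \<bar>h x - g k x\<bar> powr q \<partial>U) < \<zeta>" if "0 < e" "0 < \<zeta>" for \<theta> e \<zeta>
  proof -
    have "\<forall>\<^sub>F k in sequentially. dist (limit_value (scaled_const \<theta>) (g k)) (limit_value (scaled_const \<theta>) h) < e"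
      using limit_value_tendsto[OF q W g h(1,3) lim] that(1) by (rule tendstoD)
    moreover have "\<forall>\<^sub>F k in sequentially. (\<integral>x. \<bar>h x - g k x\<bar> + \<bar>h x - g k x\<bar> powr q \<partial>U) < \<zeta>"
      using err that(2) by (intro order_tendstoD(2)[OF err]) simp
    ultimately have "\<forall>\<^sub>F k in sequentially. dist (limit_value (scaled_const \<theta>) (g k)) (limit_value (scaled_const \<theta>) h) < e
        \<and> (\<integral>x. \<bar>h x - g k x\<bar> + \<bar>h x - g k x\<bar> powr q \<partial>U) < \<zeta>" by (rule eventually_conj)
    then show ?thesis by (auto simp: dist_real_def dest: eventually_happens)
  qed
  show ?thesis unfolding quantized_def
  proof (intro allI impI)
    fix \<theta> e :: real assume \<theta>: "0 < \<theta>" and e: "0 < e"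
    let ?L = "\<lambda>\<theta>. limit_value (scaled_const \<theta>)"
    \<comment> \<open>The error e has four parts: change of budget, exchange of densities in the
      cost, exchange of densities in the limiting cost, and the slack in quantizing the
      approximation.\<close>
    obtain \<delta> where \<delta>: "0 < \<delta>" "\<delta> < \<theta>" "\<And>\<theta>'. \<bar>\<theta>' - \<theta>\<bar> \<le> \<delta> \<Longrightarrow> \<bar>?L \<theta>' h - ?L \<theta> h\<bar> < e / 4"
      using near[OF \<theta>, of "e / 4"] e by auto
    obtain \<zeta> where \<zeta>: "0 < \<zeta>" "\<forall>\<^sub>F n in sequentially. \<exists>B. finite B \<and> B \<noteq> {} \<and> real (card B) \<le> \<delta> * n \<and>
    (\<forall>A f g. finite A \<longrightarrow> real (card A) \<le> \<theta> * n \<longrightarrow>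
      weight q f \<longrightarrow> weight q g \<longrightarrow> integrable U (\<lambda>x. \<bar>f x - g x\<bar> powr q) \<longrightarrow>
      (\<integral>x. \<bar>f x - g x\<bar> + \<bar>f x - g x\<bar> powr q \<partial>U) \<le> \<zeta> \<longrightarrow>
      \<bar>cost (rate n) f (A \<union> B) - cost (rate n) g (A \<union> B)\<bar> \<le> e / 4)"
      using cost_perturb[OF q \<delta>(1) _ \<theta>, of "e / 4"] e by auto
    have d1: "\<bar>?L (\<theta> + \<delta>) h - ?L \<theta> h\<bar> < e / 4" and d2: "\<bar>?L (\<theta> - \<delta>) h - ?L \<theta> h\<bar> < e / 4"
      by (rule \<delta>(3); use \<delta>(1) in simp)+
    obtain k1 where k1: "\<bar>?L (\<theta> + \<delta>) (g k1) - ?L (\<theta> + \<delta>) h\<bar> < e / 4"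
      "(\<integral>x. \<bar>h x - g k1 x\<bar> + \<bar>h x - g k1 x\<bar> powr q \<partial>U) < \<zeta>"
      using approx[of "e / 4" \<zeta> "\<theta> + \<delta>"] e \<zeta>(1) by auto
    obtain k2 where k2: "\<bar>?L (\<theta> - \<delta>) (g k2) - ?L (\<theta> - \<delta>) h\<bar> < e / 4"
      "(\<integral>x. \<bar>h x - g k2 x\<bar> + \<bar>h x - g k2 x\<bar> powr q \<partial>U) < \<zeta>"
      using approx[of "e / 4" \<zeta> "\<theta> - \<delta>"] e \<zeta>(1) by auto
    have ev: "\<forall>\<^sub>F n in sequentially.
        (\<exists>A. finite A \<and> A \<noteq> {} \<and> real (card A) \<le> \<theta> * n \<and> cost (rate n) (g k) A \<le> ?L \<theta> (g k) + e) \<and>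
        (\<forall>A. finite A \<longrightarrow> A \<noteq> {} \<longrightarrow> real (card A) \<le> \<theta> * n \<longrightarrow> ?L \<theta> (g k) - e \<le> cost (rate n) (g k) A)"
      if "0 < \<theta>" "0 < e" for \<theta> e :: real and k
      using quant[of k] that unfolding quantized_def by blast
    have lo: "\<forall>\<^sub>F n in sequentially. \<forall>A. finite A \<longrightarrow> A \<noteq> {} \<longrightarrow> real (card A) \<le> (\<theta> + \<delta>) * n \<longrightarrow>
        ?L (\<theta> + \<delta>) (g k1) - e / 4 \<le> cost (rate n) (g k1) A"
      by (rule eventually_mono[OF ev[of "\<theta> + \<delta>" "e / 4" k1]]) (use \<theta> \<delta> e in auto)
    have up: "\<forall>\<^sub>F n in sequentially. \<exists>A. finite A \<and> A \<noteq> {} \<and> real (card A) \<le> (\<theta> - \<delta>) * n \<and>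
        cost (rate n) (g k2) A \<le> ?L (\<theta> - \<delta>) (g k2) + e / 4"
      by (rule eventually_mono[OF ev[of "\<theta> - \<delta>" "e / 4" k2]]) (use \<theta> \<delta> e in auto)
    show "\<forall>\<^sub>F n in sequentially.
      (\<exists>A. finite A \<and> A \<noteq> {} \<and> real (card A) \<le> \<theta> * n \<and> cost (rate n) h A \<le> ?L \<theta> h + e) \<and>
      (\<forall>A. finite A \<longrightarrow> A \<noteq> {} \<longrightarrow> real (card A) \<le> \<theta> * n \<longrightarrow> ?L \<theta> h - e \<le> cost (rate n) h A)"
      using \<zeta>(2) lo up eventually_gt_at_top[of 0]
    proof eventually_elim
      case (elim n)
      have n: "0 < rate n" using elim(4) by (rule rate_pos)
      obtain B where B: "finite B" "B \<noteq> {}" "real (card B) \<le> \<delta> * n"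
        and pert: "\<And>A k. finite A \<Longrightarrow> real (card A) \<le> \<theta> * n \<Longrightarrow>
          (\<integral>x. \<bar>h x - g k x\<bar> + \<bar>h x - g k x\<bar> powr q \<partial>U) < \<zeta> \<Longrightarrow>
          \<bar>cost (rate n) h (A \<union> B) - cost (rate n) (g k) (A \<union> B)\<bar> \<le> e / 4"
        using elim(1) wt[OF h(1,2)] wt[OF g(1,2)] diff by (meson less_imp_le)
      have mono: "cost (rate n) f (A \<union> B) \<le> cost (rate n) f A"
        if "finite A" "A \<noteq> {}" "f \<in> borel_measurable U" "AE x in U. 0 \<le> f x \<and> f x \<le> W x" for f A
        using that B n
        by (intro cost_mono phi_dist_integrable[OF _ _ n q wt[OF that(3,4)]]) (auto elim: eventually_mono)
      show ?case
      proof (intro conjI allI impI)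
        obtain A where A: "finite A" "A \<noteq> {}" "real (card A) \<le> (\<theta> - \<delta>) * n"
          "cost (rate n) (g k2) A \<le> ?L (\<theta> - \<delta>) (g k2) + e / 4" using elim(3) by blast
        have cA: "real (card A) \<le> \<theta> * n"
          using A(3) \<delta> by (simp add: algebra_simps) (smt (verit) mult_nonneg_nonneg of_nat_0_le_iff)
        have "real (card (A \<union> B)) \<le> \<theta> * n"
          using card_Un_le[of A B] A(3) B(3) by (simp add: algebra_simps)
        moreover have "cost (rate n) h (A \<union> B) \<le> ?L \<theta> h + e"
          using pert[OF A(1) cA k2(2)] mono[OF A(1,2) g(1,2), of k2] A(4) k2(1) d2 by linarith
        ultimately show "\<exists>A. finite A \<and> A \<noteq> {} \<and> real (card A) \<le> \<theta> * n \<and> cost (rate n) h A \<le> ?L \<theta> h + e"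
          using A B by (intro exI[of _ "A \<union> B"]) auto
      next
        fix A :: "(real^'d) set" assume A: "finite A" "A \<noteq> {}" "real (card A) \<le> \<theta> * n"
        have "real (card (A \<union> B)) \<le> (\<theta> + \<delta>) * n"
          using card_Un_le[of A B] A(3) B(3) by (simp add: algebra_simps)
        then have "?L (\<theta> + \<delta>) (g k1) - e / 4 \<le> cost (rate n) (g k1) (A \<union> B)"
          using elim(2) A B by simp
        then show "?L \<theta> h - e \<le> cost (rate n) h A"
          using pert[OF A(1,3) k1(2)] mono[OF A(1,2) h(1,2)] k1(1) d1 by linarith
      qed
    qed
  qed
qed

section \<open>Bounded densities and their truncation limits\<close>

lemma corner_in_unit: "0 < m \<Longrightarrow> i \<in> indices m \<Longrightarrow> corner m i \<in> cbox 0 1"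
  by (auto simp: mem_box_cart corner_def indices_def less_imp_le)

text \<open>A measurable function is almost everywhere a limit of continuous ones, and a continuous
  function on the closed cube is uniformly close to its value at the corner of the cell. Clipping
  makes the resulting step functions positive and uniformly bounded.\<close>

lemma quantized_bounded:
  assumes h: "h \<in> borel_measurable U" and bd: "\<And>x. x \<in> unit_cube \<Longrightarrow> 0 \<le> h x \<and> h x \<le> M"
    and pos: "0 < (\<integral>x. h x \<partial>U)"
  shows "quantized h"
proof -
  interpret U: prob_space U by (rule prob_space_U)
  have "(\<lambda>x. indicator unit_cube x *\<^sub>R h x) \<in> borel_measurable lborel"
    using h unfolding unit_lebesgue_def by (subst (asm) borel_measurable_restrict_space_iff) auto
  then have "(\<lambda>x. indicator unit_cube x *\<^sub>R h x) \<in> borel_measurable lebesgue"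
    by (rule measurable_completion)
  then have "(\<lambda>x. indicator unit_cube x *\<^sub>R h x) measurable_on UNIV"
    by (intro lebesgue_measurable_imp_measurable_on_real) auto
  then obtain Z c where Z: "negligible Z" and c: "\<And>n. continuous_on UNIV (c n)"
    and lim: "\<And>x. x \<notin> Z \<Longrightarrow> (\<lambda>n. c n x) \<longlonglongrightarrow> indicator unit_cube x *\<^sub>R h x"
    unfolding measurable_on_def by auto
  have AEZ: "AE x in U. x \<notin> Z"
  proof -
    have "AE x in lborel. x \<notin> Z"
      using Z AE_not_in[of Z lebesgue] by (simp add: negligible_iff_null_sets AE_completion_iff)
    then show ?thesis unfolding unit_lebesgue_def by (subst AE_restrict_space_iff) auto
  qed
  define W where "W = max M 1"
  \<comment> \<open>The lower level 1/(n+1) makes the cell values positive, as the result on step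
    functions requires, and it vanishes in the limit. Clipping is 1-Lipschitz, so approximation
    errors do not grow.\<close>
  define clip where "clip n t = max (1 / real (Suc n)) (min W t)" for n t
  have clip: "0 < clip n t" "clip n t \<le> W" "\<bar>clip n s - clip n t\<bar> \<le> \<bar>s - t\<bar>" for n s t
  proof -
    have u: "0 < 1 / real (Suc n)" "1 / real (Suc n) \<le> 1" "1 \<le> W" by (auto simp: W_def)
    then show "0 < clip n t" "clip n t \<le> W" "\<bar>clip n s - clip n t\<bar> \<le> \<bar>s - t\<bar>"
      unfolding clip_def by (auto simp only: max_def min_def split: if_splits)
  qed
  have "\<exists>m>0. \<forall>x\<in>unit_cube. \<bar>c n (corner m (index_of m x)) - c n x\<bar> < 1 / real (Suc n)" for n
  proof -
    \<comment> \<open>A corner may have a zero coordinate and then lies outside the half-open cube;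
      uniform continuity is therefore taken on the closed cube.\<close>
    have "continuous_on (cbox 0 1) (c n)" by (rule continuous_on_subset[OF c]) simp
    then have unif: "uniformly_continuous_on (cbox 0 1) (c n)"
      by (rule compact_uniformly_continuous) simp
    have "0 < 1 / real (Suc n)" by simp
    from unif[unfolded uniformly_continuous_on_def, rule_format, OF this]
    obtain \<delta> where \<delta>: "0 < \<delta>" "\<And>x y. x \<in> cbox 0 1 \<Longrightarrow> y \<in> cbox 0 1 \<Longrightarrow> dist y x < \<delta> \<Longrightarrow> dist (c n y) (c n x) < 1 / real (Suc n)"
      by blast
    obtain m where m: "real CARD('d) / \<delta> < real m" using reals_Archimedean2 by blast
    have "0 < real CARD('d) / \<delta>" using \<delta> by simp
    then have m0: "0 < m" using m by (cases "m = 0") auto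
    have "\<bar>c n (corner m (index_of m x)) - c n x\<bar> < 1 / real (Suc n)" if x: "x \<in> unit_cube" for x
    proof -
      define i where "i = index_of m x"
      have i: "i \<in> indices m" "x \<in> cell (corner m i) (1 / m)"
        using index_of_eq[OF m0 x] by (auto simp: i_def)
      then obtain y where y: "y \<in> unit_cube" "x = corner m i + (1 / m) *\<^sub>R y" by (auto simp: cell_def)
      have "norm y \<le> (\<Sum>i\<in>UNIV. \<bar>y $ i\<bar>)" by (rule norm_le_l1_cart)
      also have "\<dots> \<le> (\<Sum>i\<in>(UNIV::'d set). 1)"
        using y by (intro sum_mono) (auto simp: unit_cube_def abs_le_iff less_imp_le intro: order_trans[of _ 0])
      finally have "norm y \<le> real CARD('d)" by simp
      then have "dist (corner m i) x \<le> real CARD('d) / m"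
        using y m0 by (simp add: dist_norm divide_right_mono)
      also have "\<dots> < \<delta>" using m m0 \<delta> by (simp add: field_simps)
      finally have "dist (c n (corner m i)) (c n x) < 1 / real (Suc n)"
        using x corner_in_unit[OF m0 i(1)]
        by (intro \<delta>(2)) (auto simp: unit_cube_def mem_box_cart less_imp_le)
      then show ?thesis by (simp add: i_def dist_real_def)
    qed
    then show ?thesis using m0 by blast
  qed
  then obtain m where m: "\<And>n. 0 < m n"
    and near: "\<And>n x. x \<in> unit_cube \<Longrightarrow> \<bar>c n (corner (m n) (index_of (m n) x)) - c n x\<bar> < 1 / real (Suc n)"
    by metis
  define g where "g n = step (m n) (\<lambda>i. clip n (c n (corner (m n) i)))" for n
  have g: "g n x = clip n (c n (corner (m n) (index_of (m n) x)))" if "x \<in> unit_cube" for n x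
    unfolding g_def using that m by (subst step_eq) auto
  have null: "(\<lambda>n. 1 / real (Suc n)) \<longlonglongrightarrow> 0"
    using LIMSEQ_inverse_real_of_nat by (simp add: inverse_eq_divide)
  obtain q where q: "admissible (real CARD('d)) r q" using ex_admissible .
  show ?thesis
  proof (rule quantized_limit[OF q, where W = "\<lambda>_. W" and g = g])
    show "g n \<in> borel_measurable U" for n
      unfolding g_def by (intro borel_measurable_U step_measurable m)
    show "AE x in U. 0 \<le> g n x \<and> g n x \<le> W" for n
      using AE_U_cube by eventually_elim (use clip in \<open>auto simp: g less_imp_le\<close>)
    show "AE x in U. 0 \<le> h x \<and> h x \<le> W"
      using AE_U_cube by eventually_elim (use bd in \<open>fastforce simp: W_def\<close>)
    show "quantized (g n)" for n
      unfolding g_def using m clip by (intro quantized_step) auto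
    show "AE x in U. (\<lambda>n. g n x) \<longlonglongrightarrow> h x"
      using AEZ AE_U_cube
    proof eventually_elim
      case (elim x)
      have cl: "(\<lambda>n. c n x) \<longlonglongrightarrow> h x" using lim[OF elim(1)] elim(2) by simp
      have "(\<lambda>n. clip n (c n x)) \<longlonglongrightarrow> max 0 (min W (h x))"
        unfolding clip_def by (intro tendsto_max tendsto_min null cl tendsto_const)
      also have "max 0 (min W (h x)) = h x" using bd[OF elim(2)] by (auto simp: W_def)
      finally have cl2: "(\<lambda>n. clip n (c n x)) \<longlonglongrightarrow> h x" .
      have "(\<lambda>n. g n x - clip n (c n x)) \<longlonglongrightarrow> 0"
      proof (rule Lim_null_comparison[OF _ null], rule always_eventually, rule allI)
        fix n
        show "norm (g n x - clip n (c n x)) \<le> 1 / real (Suc n)"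
          using clip(3)[of n "c n (corner (m n) (index_of (m n) x))" "c n x"] near[OF elim(2), of n]
          by (simp add: g[OF elim(2)])
      qed
      from tendsto_add[OF this cl2] show ?case by simp
    qed
  qed (use h pos in auto)
qed

lemma integral_min_pos:
  fixes k :: real
  assumes h: "h \<in> borel_measurable U" "\<And>x. x \<in> unit_cube \<Longrightarrow> 0 \<le> h x" and k: "0 < k"
    and nz: "\<not> (AE x in U. h x = 0)"
  shows "0 < (\<integral>x. min (h x) k \<partial>U)"
proof -
  interpret U: prob_space U by (rule prob_space_U)
  note [measurable] = h(1)
  have int: "integrable U (\<lambda>x. min (h x) k)"
  proof (rule U.integrable_const_bound)
    show "AE x in U. norm (min (h x) k) \<le> k"
      using AE_U_cube by eventually_elim (use h k in \<open>auto simp: min_def\<close>)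
  qed measurable
  have nn: "AE x in U. 0 \<le> min (h x) k"
    using AE_U_cube by eventually_elim (use h k in auto)
  have "(\<integral>x. min (h x) k \<partial>U) \<noteq> 0"
  proof
    assume "(\<integral>x. min (h x) k \<partial>U) = 0"
    then have "AE x in U. min (h x) k = 0"
      using integral_nonneg_eq_0_iff_AE[OF int nn] by simp
    then have "AE x in U. h x = 0" by eventually_elim (use k in \<open>auto simp: min_def split: if_splits\<close>)
    then show False using nz by simp
  qed
  moreover have "0 \<le> (\<integral>x. min (h x) k \<partial>U)" using nn by (rule integral_nonneg_AE)
  ultimately show ?thesis by simp
qed

lemma quantized_min:
  fixes k :: real
  assumes h: "h \<in> borel_measurable U" "\<And>x. x \<in> unit_cube \<Longrightarrow> 0 \<le> h x" and k: "0 < k"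
    and nz: "\<not> (AE x in U. h x = 0)"
  shows "quantized (\<lambda>x. min (h x) k)"
  using h k integral_min_pos[OF h k nz] by (intro quantized_bounded[where M = k]) auto

text \<open>The truncations of h at height k + 1 are bounded, converge to h, and are majorised by h
  itself, whose integrability provides the dominating function.\<close>

lemma quantized_admissible:
  assumes q: "admissible (real CARD('d)) r q"
    and h: "h \<in> borel_measurable U" "\<And>x. x \<in> unit_cube \<Longrightarrow> 0 \<le> h x"
    and int: "integrable U h" "integrable U (\<lambda>x. h x powr q)" and pos: "0 < (\<integral>x. h x \<partial>U)"
  shows "quantized h"
proof (rule quantized_limit[OF q int, where g = "\<lambda>k x. min (h x) (real (Suc k))"])
  note [measurable] = h(1)
  have nz: "\<not> (AE x in U. h x = 0)"
  proof
    assume "AE x in U. h x = 0"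
    then have "(\<integral>x. h x \<partial>U) = (\<integral>x. 0 \<partial>U)" by (intro integral_cong_AE) auto
    then show False using pos by simp
  qed
  show "quantized (\<lambda>x. min (h x) (real (Suc k)))" for k
  proof -
    have "0 < real (Suc k)" by simp
    from quantized_min[OF h this nz] show ?thesis .
  qed
  show "(\<lambda>x. min (h x) (real (Suc k))) \<in> borel_measurable U" for k by measurable
  show "AE x in U. 0 \<le> min (h x) (real (Suc k)) \<and> min (h x) (real (Suc k)) \<le> h x" for k
    using AE_U_cube by eventually_elim (use h in auto)
  show "AE x in U. 0 \<le> h x \<and> h x \<le> h x"
    using AE_U_cube by eventually_elim (use h in auto)
  show "AE x in U. (\<lambda>k. min (h x) (real (Suc k))) \<longlonglongrightarrow> h x"
  proof (rule AE_I2)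
    fix x
    obtain k0 where k0: "h x \<le> real k0" using real_arch_simple by blast
    have "\<forall>\<^sub>F k in sequentially. h x = min (h x) (real (Suc k))"
      using eventually_ge_at_top[of k0] by eventually_elim (use k0 in auto)
    then show "(\<lambda>k. min (h x) (real (Suc k))) \<longlonglongrightarrow> h x"
      by (rule tendsto_eventually[OF eventually_mono]) simp
  qed
qed (use h pos in auto)

section \<open>The quantization coefficient\<close>

lemma quant_seq_eq: "quant_seq N r (real CARD('d)) \<nu> n
    = ennreal (rate n) * (INF A\<in>codebooks n. codebook_error \<nu> A)"
  by (simp add: quant_seq_def rate_def quant_error_eq)

text \<open>For each half of the order topology a value strictly between V and the given bound is
  inserted. Its cost differs from \<open>phi r V\<close> by a positive amount, which is the slack
  passed to \<open>quantized\<close>; monotonicity of \<open>phi r\<close> translates costs back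
  into errors.\<close>

lemma quant_seq_tendsto:
  assumes q: "admissible (real CARD('d)) r q"
    and h: "h \<in> borel_measurable U" "\<And>x. x \<in> unit_cube \<Longrightarrow> 0 \<le> h x"
    and int: "integrable U h" "integrable U (\<lambda>x. h x powr q)" "(\<integral>x. h x \<partial>U) = 1"
    and V: "0 < V" "phi r V = limit_value C h"
  shows "quant_seq N r (real CARD('d)) (density U (\<lambda>x. ennreal (h x))) \<longlonglongrightarrow> ennreal V"
proof (rule order_tendstoI)
  let ?\<nu> = "density U (\<lambda>x. ennreal (h x))"
  have C1: "scaled_const 1 = C" by (simp add: scaled_const_def)
  have quant: "quantized h" using int by (intro quantized_admissible[OF q h]) auto
  have ev: "\<forall>\<^sub>F n in sequentially.
      (\<exists>A. finite A \<and> A \<noteq> {} \<and> card A \<le> n \<and> cost (rate n) h A \<le> phi r V + e) \<and>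
      (\<forall>A. finite A \<longrightarrow> A \<noteq> {} \<longrightarrow> card A \<le> n \<longrightarrow> phi r V - e \<le> cost (rate n) h A)"
    if "0 < e" for e
    using quant[unfolded quantized_def, rule_format, of 1 e] that by (simp add: C1 V(2))
  have err: "\<exists>v>0. codebook_error ?\<nu> A = ennreal v \<and> phi r (rate n * v) = cost (rate n) h A"
    if "finite A" "A \<noteq> {}" "0 < n" for A n
    using codebook_error_cost[OF that(1,2) rate_pos[OF that(3)] q] h int by blast
  fix a :: ennreal
  {
    assume "a < ennreal V"
    then obtain b where b: "a < b" "b < ennreal V" using dense by blast
    then obtain v1 where v1: "b = ennreal v1" "0 \<le> v1" by (cases b) auto
    have "0 < b" using b(1) by (rule le_less_trans[rotated]) simp
    then have v1_pos: "0 < v1" using v1 by simp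
    have v1_V: "v1 < V" using b(2) v1 by (simp add: ennreal_less_iff)
    then have "0 < phi r V - phi r v1" using phi_strict_mono[OF v1_pos v1_V, of r] by simp
    from ev[OF this] show "\<forall>\<^sub>F n in sequentially. a < quant_seq N r (real CARD('d)) ?\<nu> n"
      using eventually_gt_at_top[of 0]
    proof eventually_elim
      case (elim n)
      have rn: "0 < rate n" using elim(2) by (rule rate_pos)
      have "ennreal (v1 / rate n) \<le> (INF A\<in>codebooks n. codebook_error ?\<nu> A)"
      proof (rule INF_greatest)
        fix A :: "(real^'d) set" assume "A \<in> codebooks n"
        then have A: "finite A" "A \<noteq> {}" "card A \<le> n" by (auto simp: codebooks_iff)
        obtain v where v: "0 < v" "codebook_error ?\<nu> A = ennreal v" "phi r (rate n * v) = cost (rate n) h A"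
          using err[OF A(1,2) elim(2)] by blast
        have "phi r v1 \<le> phi r (rate n * v)" using elim(1) A v(3) by auto
        then have "v1 \<le> rate n * v" using phi_le_iff[of v1 "rate n * v" r] v1_pos v(1) rn by simp
        then have "v1 / rate n \<le> v" using rn by (simp add: field_simps)
        then show "ennreal (v1 / rate n) \<le> codebook_error ?\<nu> A" unfolding v(2) by (rule ennreal_leI)
      qed
      then have "ennreal (rate n) * ennreal (v1 / rate n) \<le> quant_seq N r (real CARD('d)) ?\<nu> n"
        unfolding quant_seq_eq by (rule mult_left_mono) simp
      moreover have "ennreal (rate n) * ennreal (v1 / rate n) = b"
        using rn v1_pos v1 by (simp flip: ennreal_mult)
      ultimately show ?case using b(1) by simp
    qed
  }
  {
    assume "ennreal V < a"
    then obtain b where b: "ennreal V < b" "b < a" using dense by blast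
    then have "b \<noteq> top" by auto
    then obtain v2 where v2: "b = ennreal v2" "0 \<le> v2" by (cases b) auto
    have V_v2: "V < v2" using b(1) v2 V(1) by (simp add: ennreal_less_iff)
    then have "0 < phi r v2 - phi r V" using phi_strict_mono[OF V(1) V_v2, of r] by simp
    from ev[OF this] show "\<forall>\<^sub>F n in sequentially. quant_seq N r (real CARD('d)) ?\<nu> n < a"
      using eventually_gt_at_top[of 0]
    proof eventually_elim
      case (elim n)
      have rn: "0 < rate n" using elim(2) by (rule rate_pos)
      obtain A where A: "finite A" "A \<noteq> {}" "card A \<le> n" "cost (rate n) h A \<le> phi r v2"
        using elim(1) by auto
      obtain v where v: "0 < v" "codebook_error ?\<nu> A = ennreal v" "phi r (rate n * v) = cost (rate n) h A"
        using err[OF A(1,2) elim(2)] by blast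
      have "rate n * v \<le> v2" using phi_le_iff[of "rate n * v" v2 r] A(4) v rn V(1) V_v2 by simp
      then have "ennreal (rate n) * ennreal v \<le> b"
        using v(1) rn v2 by (simp add: ennreal_leI flip: ennreal_mult)
      moreover have "quant_seq N r (real CARD('d)) ?\<nu> n \<le> ennreal (rate n) * ennreal v"
        unfolding quant_seq_eq using A v(2) by (intro mult_left_mono INF_lower2[of A]) (auto simp: codebooks_iff)
      ultimately show ?case using b(2) by simp
    qed
  }
qed

text \<open>Applying the inverse of \<open>phi r\<close> to \<open>limit_value C h\<close> gives C
  times \<open>Phi r h\<close>; moments of order q make the integrals in \<open>Phi\<close> finite,
  and unit mass makes them positive where they are raised to a power.\<close>

lemma quant_seq_limit:
  assumes q: "admissible (real CARD('d)) r q"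
    and h: "h \<in> borel_measurable U" "\<And>x. x \<in> unit_cube \<Longrightarrow> 0 \<le> h x"
    and int: "integrable U h" "integrable U (\<lambda>x. h x powr q)" "(\<integral>x. h x \<partial>U) = 1"
  obtains P where "0 < P" "Phi r h = ennreal P"
    "quant_seq N r (real CARD('d)) (density U (\<lambda>x. ennreal (h x))) \<longlonglongrightarrow> ennreal (C * P)"
proof -
  interpret U: prob_space U by (rule prob_space_U)
  note [measurable] = h(1)
  have rd: "\<not> r \<le> - real CARD('d)" using r_gt by simp
  have "\<exists>P>0. Phi r h = ennreal P \<and> phi r (C * P) = limit_value C h"
  proof (cases "r = 0")
    case True
    then have q1: "1 < q" using q d_pos by (simp add: admissible_def)
    have E: "integrable U (\<lambda>x. h x * ln (h x))"
    proof (rule Bochner_Integration.integrable_bound[where g = "\<lambda>x. h x * ln (h x)"])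
      show "integrable U (\<lambda>x. 2 + h x powr q / (q - 1))" using int by auto
      show "AE x in U. norm (h x * ln (h x)) \<le> norm (2 + h x powr q / (q - 1))"
        using AE_U_cube
      proof eventually_elim
        case (elim x)
        have "\<bar>h x * ln (h x)\<bar> \<le> 2 + h x powr q / (q - 1)"
          using abs_mult_ln_le_powr[OF q1 h(2)[OF elim]] by simp
        then show ?case by simp
      qed
    qed measurable
    define L where "L = (\<integral>x. h x * ln (h x) \<partial>U)"
    have ext: "ext_integral U (\<lambda>x. ereal (h x * ln (h x))) = ereal L"
      unfolding L_def by (rule ext_integral_ereal[OF E])
    have "Phi r h = ennreal (exp (- L / real CARD('d)))"
      unfolding Phi_def Let_def ext using True by (simp add: eexp_def)
    moreover have "phi r (C * exp (- L / real CARD('d))) = limit_value C h"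
      unfolding phi_def limit_value_def using True C_pos int(3) by (simp add: ln_mult L_def)
    ultimately show ?thesis by (intro exI[of _ "exp (- L / real CARD('d))"]) simp
  next
    case False
    define S where "S = (\<integral>x. h x powr cexp \<partial>U)"
    have nn: "AE x in U. 0 \<le> h x powr cexp" by simp
    have Sint: "integrable U (\<lambda>x. h x powr cexp)"
    proof (rule Bochner_Integration.integrable_bound[where f = "\<lambda>x. 1 + h x + h x powr q"])
      show "AE x in U. norm (h x powr cexp) \<le> norm (1 + h x + h x powr q)"
        using AE_U_cube
      proof eventually_elim
        case (elim x)
        have "h x powr cexp \<le> 1 + h x + h x powr q"
          using powr_cexp_le[OF q h(2)[OF elim]] by simp
        then show ?case using h(2)[OF elim] by simp
      qed
    qed (use int in auto)
    have S: "0 < S"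
    proof -
      have "S \<noteq> 0"
      proof
        assume "S = 0"
        then have "AE x in U. h x powr cexp = 0"
          unfolding S_def using integral_nonneg_eq_0_iff_AE[OF Sint nn] by simp
        then have "AE x in U. h x = 0" by simp
        then have "(\<integral>x. h x \<partial>U) = (\<integral>x. 0 \<partial>U)" by (intro integral_cong_AE) auto
        then show False using int(3) by simp
      qed
      moreover have "0 \<le> S" unfolding S_def using nn by (rule integral_nonneg_AE)
      ultimately show ?thesis by simp
    qed
    have "(\<integral>\<^sup>+x. ennreal (\<bar>h x\<bar> powr cexp) \<partial>U) = (\<integral>\<^sup>+x. ennreal (h x powr cexp) \<partial>U)"
      using h(2) by (intro nn_integral_cong) simp
    also have "\<dots> = ennreal S" unfolding S_def by (rule nn_integral_eq_integral[OF Sint nn])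
    finally have "Lnorm (ereal cexp) h = ennreal (S powr (1 / cexp))"
      using S cexp_pos by (simp add: Lnorm_def epowr_ennreal_pos)
    then have "Phi r h = ennreal ((S powr (1 / cexp)) powr (1 / r))"
      using rd False S unfolding Phi_def Let_def cexp_def[symmetric] by (simp add: epowr_ennreal_pos)
    moreover have "phi r (C * (S powr (1 / cexp)) powr (1 / r)) = limit_value C h"
      unfolding phi_def limit_value_def S_def[symmetric] int(3)
      using False S by (simp add: powr_mult powr_powr)
    ultimately show ?thesis using S by (intro exI[of _ "(S powr (1 / cexp)) powr (1 / r)"]) simp
  qed
  then obtain P where P: "0 < P" "Phi r h = ennreal P" "phi r (C * P) = limit_value C h" by blast
  show ?thesis
    using C_pos P by (intro that[OF P(1,2)] quant_seq_tendsto[OF q h int]) auto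
qed

text \<open>The case h = 1, where \<open>Phi\<close> is 1. It turns C from an infimum over codebooks
  into the limit that defines the coefficient.\<close>

lemma quant_seq_uniform: "quant_seq N r (real CARD('d)) U \<longlonglongrightarrow> ennreal C"
proof -
  interpret U: prob_space U by (rule prob_space_U)
  obtain q where q: "admissible (real CARD('d)) r q" using ex_admissible .
  have 1: "(\<lambda>_. 1 :: real) \<in> borel_measurable U" by simp
  have Phi: "Phi r (\<lambda>_ :: real^'d. 1) = ennreal 1"
    using r_gt by (simp add: Phi_def Let_def Lnorm_def epowr_def ext_integral_def eexp_def zero_ereal_def[symmetric]
        emeasure_U_space e2ennreal_neg)
  obtain P where P: "0 < P" "Phi r (\<lambda>_ :: real^'d. 1) = ennreal P"
    "quant_seq N r (real CARD('d)) (density U (\<lambda>x. ennreal 1)) \<longlonglongrightarrow> ennreal (C * P)"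
    by (rule quant_seq_limit[OF q 1]) (auto simp: U.prob_space[unfolded space_U])
  have "P = 1" using P(1,2) Phi by simp
  then show ?thesis using P(3) by (simp add: density_1)
qed

text \<open>For r < 0, truncating h lowers the moment of order r and so raises the error; hence
  codebooks good for a truncation bound the error of h from above. The limits of these bounds tend
  to 0 because the integrals of the truncated density to the power \<open>cexp\<close> are
  unbounded.\<close>

lemma quant_seq_tendsto_zero:
  assumes r: "r < 0"
    and h: "h \<in> borel_measurable U" "\<And>x. x \<in> unit_cube \<Longrightarrow> 0 \<le> h x"
    and inf: "(\<integral>\<^sup>+x. ennreal (\<bar>h x\<bar> powr cexp) \<partial>U) = \<infinity>"
  shows "quant_seq N r (real CARD('d)) (density U (\<lambda>x. ennreal (h x))) \<longlonglongrightarrow> 0"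
proof (rule order_tendstoI)
  interpret U: prob_space U by (rule prob_space_U)
  note [measurable] = h(1)
  let ?\<nu> = "density U (\<lambda>x. ennreal (h x))"
  show "\<forall>\<^sub>F n in sequentially. a < quant_seq N r (real CARD('d)) ?\<nu> n" if "a < 0" for a
    using that by simp
  fix a :: ennreal assume "0 < a"
  then obtain b where b: "0 < b" "b < a" using dense by blast
  then have "b \<noteq> top" by auto
  then obtain v where v: "b = ennreal v" "0 < v" using b(1) by (cases b) auto
  define g where "g k x = min (h x) (real (Suc k))" for k x
  have gm [measurable]: "g k \<in> borel_measurable U" for k unfolding g_def by measurable
  have g: "0 \<le> g k x" "g k x \<le> real (Suc k)" "g k x \<le> h x" if "x \<in> unit_cube" for k x
    using h(2)[OF that] by (auto simp: g_def)
  have gint: "integrable U (\<lambda>x. g k x powr s)" if "0 \<le> s" for k s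
  proof (rule U.integrable_const_bound)
    show "AE x in U. norm (g k x powr s) \<le> real (Suc k) powr s"
      using AE_U_cube
    proof eventually_elim
      case (elim x)
      have "g k x powr s \<le> real (Suc k) powr s"
        using g[OF elim] that by (intro powr_mono2) auto
      then show ?case by simp
    qed
  qed measurable
  define S where "S k = (\<integral>x. g k x powr cexp \<partial>U)" for k
  \<comment> \<open>By Fatou's lemma, bounded integrals of the truncated powers would make the
    integral for h finite.\<close>
  have Sinf: "\<exists>k. B < S k" for B :: real
  proof (rule ccontr)
    assume "\<not> (\<exists>k. B < S k)"
    then have B: "S k \<le> B" for k by (simp add: not_less)
    have "(\<integral>\<^sup>+x. ennreal (\<bar>h x\<bar> powr cexp) \<partial>U) = (\<integral>\<^sup>+x. liminf (\<lambda>k. ennreal (g k x powr cexp)) \<partial>U)"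
    proof (rule nn_integral_cong)
      fix x assume "x \<in> space U"
      then have x: "x \<in> unit_cube" by simp
      obtain k0 where k0: "h x \<le> real k0" using real_arch_simple by blast
      have "\<forall>\<^sub>F k in sequentially. ennreal (g k x powr cexp) = ennreal (\<bar>h x\<bar> powr cexp)"
        using eventually_ge_at_top[of k0] by eventually_elim (use k0 h(2)[OF x] in \<open>auto simp: g_def min_def\<close>)
      then have "(\<lambda>k. ennreal (g k x powr cexp)) \<longlonglongrightarrow> ennreal (\<bar>h x\<bar> powr cexp)"
        by (rule tendsto_eventually)
      then show "ennreal (\<bar>h x\<bar> powr cexp) = liminf (\<lambda>k. ennreal (g k x powr cexp))"
        by (intro lim_imp_Liminf[symmetric]) auto
    qed
    also have "\<dots> \<le> liminf (\<lambda>k. \<integral>\<^sup>+x. ennreal (g k x powr cexp) \<partial>U)"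
      by (rule nn_integral_liminf) measurable
    also have "\<dots> \<le> liminf (\<lambda>k :: nat. ennreal B)"
    proof (rule Liminf_mono, rule always_eventually, rule allI)
      fix k
      have "(\<integral>\<^sup>+x. ennreal (g k x powr cexp) \<partial>U) = ennreal (S k)"
        unfolding S_def using gint[of cexp k] cexp_pos by (intro nn_integral_eq_integral) auto
      then show "(\<integral>\<^sup>+x. ennreal (g k x powr cexp) \<partial>U) \<le> ennreal B"
        using B[of k] by (simp add: ennreal_leI)
    qed
    also have "\<dots> = ennreal B" by (rule Liminf_const) simp
    finally show False using inf by (simp add: top_unique)
  qed
  \<comment> \<open>The summand -r compensates the slack 1 in the cost: multiplied by r < 0, that
    slack lowers the guaranteed moment by -r, and v^r must remain.\<close>
  obtain k where k: "((v powr r - r) / C powr r) powr cexp < S k" using Sinf by blast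
  have big: "v powr r - r \<le> C powr r * S k powr (1 / cexp)"
  proof -
    have "0 < v powr r - r" using r v(2) by (simp add: add_pos_pos diff_gt_0_iff_gt less_trans[OF r])
    then have "(v powr r - r) / C powr r = (((v powr r - r) / C powr r) powr cexp) powr (1 / cexp)"
      using cexp_pos C_pos by (simp add: powr_powr)
    also have "\<dots> \<le> S k powr (1 / cexp)" using k cexp_pos by (intro powr_mono2) auto
    finally show ?thesis using C_pos by (simp add: field_simps)
  qed
  have nz: "\<not> (AE x in U. h x = 0)"
  proof
    assume "AE x in U. h x = 0"
    then have "(\<integral>\<^sup>+x. ennreal (\<bar>h x\<bar> powr cexp) \<partial>U) = (\<integral>\<^sup>+x. 0 \<partial>U)"
      by (intro nn_integral_cong_AE) (auto elim!: eventually_mono)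
    then show False using inf by simp
  qed
  have "quantized (g k)"
  proof -
    have "0 < real (Suc k)" by simp
    from quantized_min[OF h this nz] show ?thesis by (simp add: g_def[abs_def])
  qed
  then have "\<forall>\<^sub>F n in sequentially. \<exists>A. finite A \<and> A \<noteq> {} \<and> card A \<le> n \<and>
      cost (rate n) (g k) A \<le> limit_value C (g k) + 1"
    unfolding quantized_def
    by (elim allE[of _ 1] impE) (auto simp: scaled_const_def elim!: allE[of _ "1::real"] eventually_mono)
  then show "\<forall>\<^sub>F n in sequentially. quant_seq N r (real CARD('d)) ?\<nu> n < a"
    using eventually_gt_at_top[of 0]
  proof eventually_elim
    case (elim n)
    define \<tau> where "\<tau> = rate n"
    have \<tau>: "0 < \<tau>" unfolding \<tau>_def using elim(2) by (rule rate_pos)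
    obtain A where A: "finite A" "A \<noteq> {}" "card A \<le> n" "cost \<tau> (g k) A \<le> limit_value C (g k) + 1"
      using elim(1) unfolding \<tau>_def by blast
    have [measurable]: "(\<lambda>x. dist_set N x A) \<in> borel_measurable U"
      using A by (intro borel_measurable_U) measurable
    have gint1: "integrable U (g k)"
      using gint[of 1 k] by (rule integrable_cong_AE_imp) (auto intro!: AE_mp[OF AE_U_cube] AE_I2 simp: g)
    have pint: "integrable U (\<lambda>x. phi r (1 * dist_set N x A) * g k x)"
      by (rule phi_dist_integrable_bounded[OF A(1,2) _ gm, of _ _ "real (Suc k)"])
         (auto intro!: AE_mp[OF AE_U_cube] AE_I2 simp: g simp del: of_nat_Suc)
    define X where "X = (\<integral>x. dist_set N x A powr r * g k x \<partial>U)"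
    define H where "H = (\<integral>x. g k x \<partial>U)"
    have cp: "cost \<tau> (g k) A = (\<tau> powr r * X - H) / r" and Xint: "integrable U (\<lambda>x. dist_set N x A powr r * g k x)"
      unfolding X_def H_def using cost_powr(1)[of A "g k"] cost_powr(2)[of A "g k" \<tau>] pint gint1 r by auto
    have "(\<tau> powr r * X - H) / r \<le> (C powr r * S k powr (1 / cexp) - H) / r + 1"
      using A(4) r unfolding cp by (simp add: limit_value_def S_def H_def)
    then have "C powr r * S k powr (1 / cexp) + r \<le> \<tau> powr r * X"
      using r by (simp add: field_simps)
    then have X: "v powr r \<le> \<tau> powr r * X" using big by simp
    have X0: "0 < X" using X v(2) \<tau> by (smt (verit) mult_nonneg_nonpos powr_ge_zero powr_gt_zero)
    have vX: "(v / \<tau>) powr r \<le> X"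
      using X \<tau> v(2) by (simp add: powr_divide field_simps)
    have nn: "AE x in U. 0 \<le> dist_set N x A powr r * g k x"
      using AE_U_cube by eventually_elim (simp add: g)
    have "ennreal X = (\<integral>\<^sup>+x. ennreal (dist_set N x A powr r * g k x) \<partial>U)"
      unfolding X_def using Xint nn by (rule nn_integral_eq_integral[symmetric])
    also have "\<dots> \<le> (\<integral>\<^sup>+x. ennreal (dist_set N x A powr r * h x) \<partial>U)"
      using g by (intro nn_integral_mono ennreal_leI mult_left_mono) auto
    also have "\<dots> = (\<integral>\<^sup>+x. ennreal (dist_set N x A) epowr r \<partial>?\<nu>)"
      using A h r by (intro nn_integral_dist_epowr[symmetric]) auto
    finally have XI: "ennreal X \<le> (\<integral>\<^sup>+x. ennreal (dist_set N x A) epowr r \<partial>?\<nu>)" .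
    have "codebook_error ?\<nu> A \<le> ennreal ((v / \<tau>) powr r) epowr (1 / r)"
      unfolding codebook_error_def using r vX
      by (auto intro!: epowr_antimono order_trans[OF _ XI] ennreal_leI)
    also have "\<dots> = ennreal (v / \<tau>)"
      using r v(2) \<tau> by (simp add: epowr_ennreal_pos powr_powr)
    finally have "codebook_error ?\<nu> A \<le> ennreal (v / \<tau>)" .
    then have "quant_seq N r (real CARD('d)) ?\<nu> n \<le> ennreal \<tau> * ennreal (v / \<tau>)"
      unfolding quant_seq_eq \<tau>_def[symmetric] using A
      by (intro mult_left_mono INF_lower2[of A]) (auto simp: codebooks_iff)
    also have "\<dots> = b" using \<tau> v by (simp flip: ennreal_mult)
    finally show ?case using b(2) by simp
  qed
qed

end

theorem theorem1p3:
  fixes N :: "real ^ 'd \<Rightarrow> real"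
    and h :: "real ^ 'd \<Rightarrow> real"
    and \<nu> :: "(real ^ 'd) measure"
    and r :: real
  assumes "is_norm N"
    and "h \<in> borel_measurable unit_lebesgue"
    and "\<forall>x\<in>unit_cube. 0 \<le> h x"
    and "\<nu> = density unit_lebesgue (\<lambda>x. ennreal (h x))"
    and "prob_space \<nu>"
  shows
    "(ereal r \<noteq> critical_order h \<or>
        (ereal r = critical_order h \<and> Lnorm (integrability_sup h) h = \<infinity>) \<longrightarrow>
      quant_coeff_exists N r (real CARD('d)) \<nu> \<and>
      quant_coeff N r (real CARD('d)) \<nu> < \<infinity> \<and>
      quant_coeff N r (real CARD('d)) \<nu>
        = quant_coeff N r (real CARD('d)) (unit_lebesgue :: (real ^ 'd) measure) * Phi r h) \<and>
     (ereal r > critical_order h \<longrightarrow> quant_coeff N r (real CARD('d)) \<nu> > 0) \<and>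
     (ereal r < critical_order h \<or>
        (ereal r = critical_order h \<and> Lnorm (integrability_sup h) h = \<infinity>) \<longrightarrow>
      quant_coeff N r (real CARD('d)) \<nu> = 0)"
proof -
  interpret normed_cube N by unfold_locales fact
  let ?d = "real CARD('d)"
  note hm [measurable] = assms(2)
  have h0: "\<And>x. x \<in> unit_cube \<Longrightarrow> 0 \<le> h x" using assms(3) by blast
  have mass: "(\<integral>\<^sup>+x. ennreal (h x) \<partial>unit_lebesgue) = 1"
  proof -
    interpret \<nu>: prob_space \<nu> by fact
    have "(\<integral>\<^sup>+x. ennreal (h x) \<partial>unit_lebesgue) = (\<integral>\<^sup>+x. ennreal (h x) * indicator (space unit_lebesgue) x \<partial>unit_lebesgue)"
      by (intro nn_integral_cong) (simp only: indicator_simps mult_1_right)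
    also have "\<dots> = emeasure \<nu> (space unit_lebesgue)"
      unfolding assms(4) by (intro emeasure_density[symmetric] sets.top) measurable
    also have "\<dots> = 1" using \<nu>.emeasure_space_1 by (simp only: assms(4) space_density)
    finally show ?thesis .
  qed
  have AE0: "AE x in unit_lebesgue. 0 \<le> h x" using AE_U_cube by eventually_elim (rule h0)
  have hint: "integrable unit_lebesgue h"
    using mass AE0 by (intro integrableI_nonneg) auto
  have hmass: "(\<integral>x. h x \<partial>unit_lebesgue) = 1"
    using nn_integral_eq_integral[OF hint AE0] mass by (metis ennreal_1 ennreal_inj integral_nonneg_AE[OF AE0] zero_le_one)
  have above: "\<exists>C P. 0 < C \<and> 0 < P \<and> Phi r h = ennreal P \<and>
      quant_seq N r ?d (unit_lebesgue :: (real^'d) measure) \<longlonglongrightarrow> ennreal C \<and> quant_seq N r ?d \<nu> \<longlonglongrightarrow> ennreal (C * P)"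
    if above_crit: "critical_order h < ereal r"
  proof -
    obtain q where q: "- ?d < r" "admissible ?d r q" "integrable unit_lebesgue (\<lambda>x. h x powr q)"
      using above_critical_order[OF hm h0 mass above_crit] by blast
    interpret quantization N r by unfold_locales (rule q(1))
    obtain C where C: "0 < C"
      "\<And>A. finite A \<Longrightarrow> A \<noteq> {} \<Longrightarrow>
        phi r C \<le> (\<integral>x. phi r (real (card A) powr (1 / CARD('d)) * dist_set N x A) \<partial>U)"
      "\<And>e. 0 < e \<Longrightarrow> \<exists>A. finite A \<and> A \<noteq> {} \<and>
        (\<integral>x. phi r (real (card A) powr (1 / CARD('d)) * dist_set N x A) \<partial>U) < phi r C + e"
      by (rule ex_constant) blast
    interpret quantization_const N r C by unfold_locales (fact C)+
    obtain P where "0 < P" "Phi r h = ennreal P"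
      "quant_seq N r ?d (density U (\<lambda>x. ennreal (h x))) \<longlonglongrightarrow> ennreal (C * P)"
      using quant_seq_limit[OF q(2) hm h0 hint q(3) hmass] by blast
    then show ?thesis using C(1) quant_seq_uniform assms(4) by blast
  qed
  have below: "Phi r h = 0 \<and> quant_seq N r ?d \<nu> \<longlonglongrightarrow> 0"
    if b: "ereal r < critical_order h \<or> (ereal r = critical_order h \<and> Lnorm (integrability_sup h) h = \<infinity>)"
  proof (cases "r \<le> - ?d")
    \<comment> \<open>\<open>Phi\<close> is 0 by definition in this range, and the error itself is 0
      for every n \<ge> 1.\<close>
    case True
    have "\<forall>\<^sub>F n in sequentially. quant_seq N r ?d \<nu> n = 0"
      using eventually_gt_at_top[of 0]
      by eventually_elim (simp add: quant_seq_def assms(4) quant_error_zero[OF True _ hm mass])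
    then show ?thesis using True by (simp add: Phi_def tendsto_eventually)
  next
    case False
    then have gt: "- ?d < r" by simp
    have r0: "r < 0" and L: "Lnorm (ereal (?d / (?d + r))) h = \<infinity>"
      using below_critical_order[OF hm h0 mass b gt] by auto
    interpret quantization N r by unfold_locales (rule gt)
    obtain C where C: "0 < C"
      "\<And>A. finite A \<Longrightarrow> A \<noteq> {} \<Longrightarrow>
        phi r C \<le> (\<integral>x. phi r (real (card A) powr (1 / CARD('d)) * dist_set N x A) \<partial>U)"
      "\<And>e. 0 < e \<Longrightarrow> \<exists>A. finite A \<and> A \<noteq> {} \<and>
        (\<integral>x. phi r (real (card A) powr (1 / CARD('d)) * dist_set N x A) \<partial>U) < phi r C + e"
      by (rule ex_constant) blast
    interpret quantization_const N r C by unfold_locales (fact C)+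
    have "(\<integral>\<^sup>+x. ennreal (\<bar>h x\<bar> powr cexp) \<partial>U) = \<infinity>"
      using L Lnorm_finite_iff[OF cexp_pos, of h] unfolding cexp_def by (simp add: not_less top_unique)
    then have "quant_seq N r ?d \<nu> \<longlonglongrightarrow> 0"
      unfolding assms(4) using r0 hm h0 by (intro quant_seq_tendsto_zero) auto
    then show ?thesis using L False r0 by (simp add: Phi_def Let_def epowr_def)
  qed
  show ?thesis
  proof (cases "critical_order h < ereal r")
    case True
    obtain C P where CP: "0 < C" "0 < P" "Phi r h = ennreal P"
      "quant_seq N r ?d (unit_lebesgue :: (real^'d) measure) \<longlonglongrightarrow> ennreal C" "quant_seq N r ?d \<nu> \<longlonglongrightarrow> ennreal (C * P)"
      using above[OF True] by blast
    have "quant_coeff N r ?d \<nu> = ennreal (C * P)" "quant_coeff N r ?d (unit_lebesgue :: (real^'d) measure) = ennreal C"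
      unfolding quant_coeff_def using CP(4,5) by (auto intro: limI)
    moreover have "quant_coeff_exists N r ?d \<nu>" unfolding quant_coeff_exists_def using CP(5) by (rule convergentI)
    moreover have "ennreal (C * P) = ennreal C * ennreal P" using CP(1,2) by (simp add: ennreal_mult)
    moreover have "0 < ennreal (C * P)" "ennreal (C * P) < \<infinity>" using CP(1,2) by simp_all
    ultimately show ?thesis using True CP(3) by auto
  next
    case False
    \<comment> \<open>With \<open>Phi r h = 0\<close> the product formula reads 0 = 0, since in
      \<open>ennreal\<close> every product with 0 is 0.\<close>
    have *: "quant_coeff N r ?d \<nu> = 0 \<and> quant_coeff_exists N r ?d \<nu> \<and> Phi r h = 0"
      if "ereal r < critical_order h \<or> (ereal r = critical_order h \<and> Lnorm (integrability_sup h) h = \<infinity>)"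
      using below[OF that] unfolding quant_coeff_def quant_coeff_exists_def
      by (auto intro: limI convergentI)
    have **: "ereal r \<noteq> critical_order h \<Longrightarrow> ereal r < critical_order h" using False by auto
    show ?thesis
    proof (cases "ereal r < critical_order h \<or> (ereal r = critical_order h \<and> Lnorm (integrability_sup h) h = \<infinity>)")
      case below: True
      show ?thesis using *[OF below] False by simp
    next
      \<comment> \<open>What remains is the critical order with a finite norm, for which the three
        implications are vacuous.\<close>
      case not_below: False
      then show ?thesis using ** False by blast
    qed
  qed
qed

end
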